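(* Let $n\geq 1$, let $w\in F_n$ be a non-empty cyclically reduced word, and suppose that $P_n(w)$ is an orientable redundant cyclic presentation. Then $G_n(w)$ contains a non-abelian free subgroup unless $n=2$ and either (i) $w$ is a cyclic permutation of $x_0^{\epsilon}x_1^{\epsilon}$ for some $\epsilon=\pm1$, in which case $G_n(w)\cong\mathbb{Z}$; or (ii) $w$ is a cyclic permutation of $x_0^{2\epsilon}x_1^{2\epsilon}$ for some $\epsilon=\pm1$, in which case $G_n(w)\cong BS(1,-1)$.
   Context: $F_n$ is the free group with basis $x_0,\ldots,x_{n-1}$; subscripts are taken modulo $n$; $\theta(x_i)=x_{i+1}$. $P_n(w)=\langle x_0,\ldots,x_{n-1}\mid w,\theta(w),\ldots,\theta^{n-1}(w)\rangle$ and $G_n(w)$ is the group it defines. $P_n(w)$ is orientable if $w$ is not a cyclic permutation of the inverse of any of its shifts $\theta^i(w)$, $0\leq i<n$. A presentation with cyclically reduced relators is redundant if some relator $r$ is freely trivial or there is another relator $s$ such that $r$ is a cyclic permutation of $s$ or of $s^{-1}$; thus an orientable $P_n(w)$ is redundant if and only if $w$ is equal to a cyclic permutation of $\theta^i(w)$ for some $1\leq i<n$. $BS(1,-1)=\langle a,b\mid bab^{-1}=a^{-1}\rangle$ is the Klein bottle group. *)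

theory Defs
  imports "HOL-Algebra.Elementary_Groups"
begin

section \<open>Words and free groups\<close>

text \<open>
  The letter \<open>(x, True)\<close> stands for the generator \<open>x\<close> and \<open>(x, False)\<close> for its formal inverse.
\<close>

type_synonym 'a letter = "'a \<times> bool"
type_synonym 'a word = "'a letter list"

definition inv_letter :: "'a letter \<Rightarrow> 'a letter" where
  "inv_letter a = (fst a, \<not> snd a)"

definition inv_word :: "'a word \<Rightarrow> 'a word" where
  "inv_word w = rev (map inv_letter w)"

definition reduced :: "'a word \<Rightarrow> bool" where
  "reduced w \<longleftrightarrow> successively (\<lambda>a b. b \<noteq> inv_letter a) w"

definition cyclically_reduced :: "'a word \<Rightarrow> bool" where
  "cyclically_reduced w \<longleftrightarrow> reduced w \<and> (w \<noteq> [] \<longrightarrow> last w \<noteq> inv_letter (hd w))"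

definition cyclic_permutation :: "'a word \<Rightarrow> 'a word \<Rightarrow> bool" where
  "cyclic_permutation u v \<longleftrightarrow> (\<exists>k. u = rotate k v)"

fun cons_reduce :: "'a letter \<Rightarrow> 'a word \<Rightarrow> 'a word" where
  "cons_reduce a [] = [a]"
| "cons_reduce a (b # w) = (if b = inv_letter a then w else a # b # w)"

definition free_reduction :: "'a word \<Rightarrow> 'a word" where
  "free_reduction w = foldr cons_reduce w []"

text \<open>The elements of the free group with basis \<open>S\<close> are the reduced words themselves.\<close>

definition free_group :: "'a set \<Rightarrow> 'a word monoid" where
  "free_group S = \<lparr>carrier = {w \<in> lists (S \<times> UNIV). reduced w},
     monoid.mult = (\<lambda>u v. free_reduction (u @ v)), one = []\<rparr>"

lemma inv_letter_inv_letter [simp]: "inv_letter (inv_letter a) = a"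
  by (simp add: inv_letter_def)

lemma reduced_Nil [simp]: "reduced []"
  by (simp add: reduced_def)

lemma reduced_Cons: "reduced (a # w) \<longleftrightarrow> reduced w \<and> (w = [] \<or> hd w \<noteq> inv_letter a)"
  by (cases w) (auto simp: reduced_def)

lemma reduced_cons_reduce: "reduced w \<Longrightarrow> reduced (cons_reduce a w)"
  by (cases w) (simp_all add: reduced_Cons)

lemma reduced_free_reduction: "reduced (free_reduction w)"
  unfolding free_reduction_def
  by (induction w) (simp_all add: reduced_cons_reduce)

lemma free_reduction_reduced: "reduced w \<Longrightarrow> free_reduction w = w"
  unfolding free_reduction_def
proof (induction w)
  case (Cons a w)
  then show ?case by (cases w) (auto simp: reduced_Cons)
qed simp

lemma cons_reduce_inv: "reduced w \<Longrightarrow> cons_reduce (inv_letter a) (cons_reduce a w) = w"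
proof (cases w)
  case (Cons b v)
  assume "reduced w"
  with Cons show ?thesis by (cases v) (auto simp: reduced_Cons)
qed simp

lemma foldr_cons_reduce_reduced:
  "reduced v \<Longrightarrow> reduced (foldr cons_reduce u v)"
  by (induction u) (auto simp: reduced_cons_reduce)

lemma foldr_cons_reduce_cons_reduce:
  assumes "reduced v"
  shows "foldr cons_reduce (cons_reduce a u) v = cons_reduce a (foldr cons_reduce u v)"
proof (cases u)
  case (Cons b t)
  then show ?thesis
    using cons_reduce_inv[OF foldr_cons_reduce_reduced[OF assms], of "inv_letter a" t] by auto
qed simp

lemma foldr_cons_reduce_free_reduction:
  "reduced v \<Longrightarrow> foldr cons_reduce (free_reduction u) v = foldr cons_reduce u v"
  by (induction u) (auto simp: free_reduction_def foldr_cons_reduce_cons_reduce)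

lemma free_reduction_append_left:
  "free_reduction (free_reduction u @ v) = free_reduction (u @ v)"
proof -
  have "reduced (foldr cons_reduce v [])"
    using reduced_free_reduction[of v] by (simp add: free_reduction_def)
  from foldr_cons_reduce_free_reduction[OF this, of u] show ?thesis
    by (simp add: free_reduction_def)
qed

lemma free_reduction_append_right:
  "free_reduction (u @ free_reduction v) = free_reduction (u @ v)"
  using free_reduction_reduced[OF reduced_free_reduction[of v]]
  by (simp add: free_reduction_def)

lemma cons_reduce_lists:
  "a \<in> A \<Longrightarrow> w \<in> lists A \<Longrightarrow> cons_reduce a w \<in> lists A"
  by (cases w) auto

lemma free_reduction_lists: "w \<in> lists A \<Longrightarrow> free_reduction w \<in> lists A"
  unfolding free_reduction_def by (induction w) (auto simp: cons_reduce_lists)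

lemma inv_word_lists: "w \<in> lists (S \<times> UNIV) \<Longrightarrow> inv_word w \<in> lists (S \<times> UNIV)"
  by (fastforce simp: inv_word_def inv_letter_def in_lists_conv_set)

lemma free_reduction_inv_word: "free_reduction (inv_word w @ w) = []"
proof (induction w)
  case (Cons a w)
  have r: "reduced (foldr cons_reduce w [])"
    using reduced_free_reduction[of w] by (simp add: free_reduction_def)
  then show ?case
    using Cons cons_reduce_inv[OF r, of a] by (simp add: free_reduction_def inv_word_def)
qed (simp add: free_reduction_def inv_word_def)

lemma group_free_group: "group (free_group S)"
proof (rule groupI)
  fix w assume w: "w \<in> carrier (free_group S)"
  have "free_reduction (free_reduction (inv_word w) @ w) = []"
    by (simp add: free_reduction_append_left free_reduction_inv_word)
  moreover have "free_reduction (inv_word w) \<in> carrier (free_group S)"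
    using w by (simp add: free_group_def reduced_free_reduction free_reduction_lists
      inv_word_lists del: in_lists_conv_set)
  ultimately show "\<exists>v\<in>carrier (free_group S). v \<otimes>\<^bsub>free_group S\<^esub> w = \<one>\<^bsub>free_group S\<^esub>"
    by (auto simp: free_group_def)
qed (simp_all add: free_group_def reduced_free_reduction free_reduction_lists
      free_reduction_append_left free_reduction_append_right free_reduction_reduced
      del: in_lists_conv_set)

section \<open>Presentations\<close>

text \<open>
  A presentation consists of a set of generators and a list of relators, which are reduced words
  in the generators. A list rather than a set is used because redundancy compares a relator with
  the other entries of the presentation.
\<close>

type_synonym 'a presentation = "'a set \<times> 'a word list"

definition normal_closure :: "('a, 'b) monoid_scheme \<Rightarrow> 'a set \<Rightarrow> 'a set" where
  "normal_closure G R = \<Inter>{N. N \<lhd> G \<and> R \<subseteq> N}"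

definition presented_group :: "'a presentation \<Rightarrow> 'a word set monoid" where
  "presented_group P =
     free_group (fst P) Mod normal_closure (free_group (fst P)) (set (snd P))"

definition redundant :: "'a presentation \<Rightarrow> bool" where
  "redundant P \<longleftrightarrow> (\<exists>i < length (snd P).
     free_reduction (snd P ! i) = [] \<or>
     (\<exists>j < length (snd P). j \<noteq> i \<and>
        (cyclic_permutation (snd P ! i) (snd P ! j) \<or>
         cyclic_permutation (snd P ! i) (inv_word (snd P ! j)))))"

section \<open>Cyclic presentations\<close>

text \<open>The generators \<open>x\<^sub>0, \<dots>, x\<^sub>n\<^sub>-\<^sub>1\<close> are the numbers \<open>0, \<dots>, n - 1\<close>.\<close>

definition theta :: "nat \<Rightarrow> nat word \<Rightarrow> nat word" where
  "theta n = map (\<lambda>(i, e). ((i + 1) mod n, e))"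

definition cyclic_presentation :: "nat \<Rightarrow> nat word \<Rightarrow> nat presentation" where
  "cyclic_presentation n w = ({..<n}, map (\<lambda>i. (theta n ^^ i) w) [0..<n])"

definition cyclically_presented_group :: "nat \<Rightarrow> nat word \<Rightarrow> nat word set monoid" where
  "cyclically_presented_group n w = presented_group (cyclic_presentation n w)"

definition orientable :: "nat \<Rightarrow> nat word \<Rightarrow> bool" where
  "orientable n w \<longleftrightarrow> (\<forall>i < n. \<not> cyclic_permutation w (inv_word ((theta n ^^ i) w)))"

section \<open>Free subgroups and the Klein bottle group\<close>

text \<open>
  Taking the basis from the element type of \<open>G\<close> is no restriction, since a basis of a free group
  \<open>G\<close> can be chosen inside \<open>carrier G\<close>.
\<close>

definition is_free_group :: "('a, 'b) monoid_scheme \<Rightarrow> bool" where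
  "is_free_group G \<longleftrightarrow> (\<exists>S :: 'a set. G \<cong> free_group S)"

definition contains_nonabelian_free_subgroup :: "('a, 'b) monoid_scheme \<Rightarrow> bool" where
  "contains_nonabelian_free_subgroup G \<longleftrightarrow>
     (\<exists>H. subgroup H G \<and> is_free_group (G\<lparr>carrier := H\<rparr>) \<and> \<not> comm_group (G\<lparr>carrier := H\<rparr>))"

text \<open>
  \<open>BS(1,-1)\<close>, with generators \<open>a = 0\<close> and \<open>b = 1\<close>: the relation \<open>b a b\<^sup>-\<^sup>1 = a\<^sup>-\<^sup>1\<close> is written
  as the relator \<open>b a b\<^sup>-\<^sup>1 a\<close>.
\<close>

definition klein_bottle_group :: "nat word set monoid" where
  "klein_bottle_group =
     presented_group ({0, 1}, [[(1, True), (0, True), (1, False), (0, True)]])"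

end

(*
  A homomorphism onto a group in which two words act freely detects a free subgroup, and all the
  target groups used here are groups of permutations.

  For n >= 3 a relator is cyclically equivalent to its shift by some proper divisor d of n, so d
  relators suffice and there are at least d + 2 generators. Map x_0 and x_d to 1 and -1 in Z and the
  other generators to 0. Counting unknowns shows that the relations, linearised along this map, have
  a finitely supported solution; placing it twice, far apart, with values in the powers of two free
  generators, gives an action on Z times a free group (a version of the Baumslag-Pride argument).

  For n = 2 one can write w, up to cyclic permutation, as a product of alternating shifts of a word
  u = x_0^{a_1} x_1^{a_2} ... x_0^{a_q} with q odd. If the exponent sum of u vanishes, the symmetry
  makes the linearised relations vanish and the same action works. Otherwise G is the subgroup
  of index 2 generated by x and t x t in <x, t | t^2, (x^{a_1} t ... x^{a_q} t)^M>, and a representation by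
  matrices of size 2 with x = diag(2, 1/2) and t an involution depending on a parameter is found by
  solving a polynomial equation in this parameter; powers of x and t x t then play ping-pong. The
  case w = x_0^a x_1^a with |a| >= 3 is treated by hand.
*)

theory Submission
  imports Defs "HOL-Computational_Algebra.Fundamental_Theorem_Algebra"
begin

section \<open>Values of words and presented groups\<close>

text \<open>Maps to Z exist because of the shift symmetry: a relator cyclically equal to its shift
  by d has the same exponent sum in x_0 and x_d. A long window of positions makes the extra
  equations at its two ends negligible, so d + 2 generators, one of them spent as the pure shift of
  Z, beat d relators. For n = 2 the product that must get order M has an odd number of factors t,
  hence determinant -1; with trace 0 it is an involution, which is enough as M is even. The
  parameters 0, 1, -1 are forbidden: there t sends an eigenline of x to an eigenline of x, and
  ping-pong breaks down. The trace is nonzero at 1 and -1 exactly because the exponent sum is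
  nonzero, which is why sum zero is a case of its own. With a single syllable the trace vanishes at
  0 only; for M >= 4 other roots of unity, together with a scalar factor of x, take the place of
  trace 0, and what remains is M = 2, the relator x_0^a x_1^a.\<close>

primrec word_value :: "('k, 'm) monoid_scheme \<Rightarrow> ('a \<Rightarrow> 'k) \<Rightarrow> 'a word \<Rightarrow> 'k" where
  "word_value K \<phi> [] = \<one>\<^bsub>K\<^esub>"
| "word_value K \<phi> (a # w) =
     (if snd a then \<phi> (fst a) else inv\<^bsub>K\<^esub> (\<phi> (fst a))) \<otimes>\<^bsub>K\<^esub> word_value K \<phi> w"

lemma fst_inv_letter [simp]: "fst (inv_letter a) = fst a"
  and snd_inv_letter [simp]: "snd (inv_letter a) \<longleftrightarrow> \<not> snd a"
  by (simp_all add: inv_letter_def)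

lemma free_reduction_Nil [simp]: "free_reduction [] = []"
  by (simp add: free_reduction_def)

lemma free_reduction_Cons [simp]: "free_reduction (a # w) = cons_reduce a (free_reduction w)"
  by (simp add: free_reduction_def)

lemma free_group_carrier: "w \<in> carrier (free_group S) \<longleftrightarrow> w \<in> lists (S \<times> UNIV) \<and> reduced w"
  by (auto simp: free_group_def)

lemma free_group_mult: "u \<otimes>\<^bsub>free_group S\<^esub> v = free_reduction (u @ v)"
  by (simp add: free_group_def)

lemma free_group_one: "\<one>\<^bsub>free_group S\<^esub> = []"
  by (simp add: free_group_def)

lemma lists_Cons_letter: "a # w \<in> lists (S \<times> UNIV) \<longleftrightarrow> fst a \<in> S \<and> w \<in> lists (S \<times> UNIV)"
  by (cases a) auto

lemma free_reduction_carrier: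
  "w \<in> lists (S \<times> UNIV) \<Longrightarrow> free_reduction w \<in> carrier (free_group S)"
  by (simp add: free_group_carrier free_reduction_lists reduced_free_reduction del: in_lists_conv_set)

context group
begin

lemma word_value_closed:
  "\<phi> \<in> S \<rightarrow> carrier G \<Longrightarrow> w \<in> lists (S \<times> UNIV) \<Longrightarrow> word_value G \<phi> w \<in> carrier G"
  by (induction w) (auto simp: Pi_iff)

lemma word_value_append:
  assumes "\<phi> \<in> S \<rightarrow> carrier G" "u \<in> lists (S \<times> UNIV)" "v \<in> lists (S \<times> UNIV)"
  shows "word_value G \<phi> (u @ v) = word_value G \<phi> u \<otimes> word_value G \<phi> v"
  using assms(2)
proof (induction u)
  case Nil
  then show ?case using word_value_closed[OF assms(1,3)] by simp
next
  case (Cons a u)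
  then have "fst a \<in> S" "u \<in> lists (S \<times> UNIV)"
    by (auto simp: mem_Times_iff)
  then show ?case
    using Cons.IH assms word_value_closed[OF assms(1)] by (simp add: m_assoc Pi_iff del: in_lists_conv_set)
qed

lemma word_value_cons_reduce:
  assumes "\<phi> \<in> S \<rightarrow> carrier G" "a # w \<in> lists (S \<times> UNIV)"
  shows "word_value G \<phi> (cons_reduce a w) = word_value G \<phi> (a # w)"
proof (cases w)
  case (Cons b v)
  show ?thesis
  proof (cases "b = inv_letter a")
    case True
    have "fst a \<in> S" "v \<in> lists (S \<times> UNIV)"
      using assms(2) unfolding Cons lists_Cons_letter by auto
    then have "\<phi> (fst a) \<in> carrier G" "word_value G \<phi> v \<in> carrier G"
      using assms(1) word_value_closed by auto
    then show ?thesis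
      using Cons True by (simp add: m_assoc[symmetric])
  qed (simp add: Cons)
qed simp

lemma word_value_free_reduction:
  assumes "\<phi> \<in> S \<rightarrow> carrier G" "w \<in> lists (S \<times> UNIV)"
  shows "word_value G \<phi> (free_reduction w) = word_value G \<phi> w"
  using assms(2)
proof (induction w)
  case (Cons a w)
  then have "fst a \<in> S" and w: "w \<in> lists (S \<times> UNIV)"
    by (auto simp: mem_Times_iff)
  then have "a # free_reduction w \<in> lists (S \<times> UNIV)"
    unfolding lists_Cons_letter using free_reduction_lists by blast
  from word_value_cons_reduce[OF assms(1) this] show ?case
    using Cons.IH w by simp
qed simp

lemma word_value_hom:
  "\<phi> \<in> S \<rightarrow> carrier G \<Longrightarrow> word_value G \<phi> \<in> hom (free_group S) G"
  by (rule homI)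
     (simp_all add: free_group_carrier free_group_mult word_value_closed word_value_append
        word_value_free_reduction del: in_lists_conv_set)

lemma word_value_cong:
  "w \<in> lists (S \<times> UNIV) \<Longrightarrow> (\<And>i. i \<in> S \<Longrightarrow> \<phi> i = \<psi> i) \<Longrightarrow> word_value G \<phi> w = word_value G \<psi> w"
  by (induction w) auto

text \<open>In any group ab = 1 if and only if ba = 1.\<close>

lemma word_value_cyclic_permutation:
  assumes "\<phi> \<in> S \<rightarrow> carrier G" "w \<in> lists (S \<times> UNIV)"
    and "cyclic_permutation v w" "word_value G \<phi> w = \<one>"
  shows "word_value G \<phi> v = \<one>"
proof -
  obtain k where "v = rotate k w"
    using assms(3) by (auto simp: cyclic_permutation_def)
  then obtain a b where ab: "w = a @ b" "v = b @ a"
    by (metis append_take_drop_id rotate_drop_take)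
  then have l: "a \<in> lists (S \<times> UNIV)" "b \<in> lists (S \<times> UNIV)"
    using assms(2) by auto
  then have "word_value G \<phi> a \<otimes> word_value G \<phi> b = \<one>"
    using assms(1,4) ab word_value_append by metis
  then have "word_value G \<phi> b \<otimes> word_value G \<phi> a = \<one>"
    using inv_comm l assms(1) word_value_closed by metis
  then show ?thesis
    using l assms(1) ab word_value_append by metis
qed

end

lemma word_value_map:
  "word_value K \<phi> (map (\<lambda>(i, e). (g i, e)) w) = word_value K (\<phi> \<circ> g) w"
  by (induction w) (auto split: prod.splits)

lemma hom_word_value:
  assumes "h \<in> hom G K" "group G" "group K" "\<phi> \<in> S \<rightarrow> carrier G" "w \<in> lists (S \<times> UNIV)"
  shows "h (word_value G \<phi> w) = word_value K (h \<circ> \<phi>) w"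
proof -
  interpret group_hom G K h
    using assms by (simp add: group_hom_def group_hom_axioms_def)
  show ?thesis
    using assms(5)
  proof (induction w)
    case (Cons a w)
    then have "fst a \<in> S" "w \<in> lists (S \<times> UNIV)"
      by (auto simp: mem_Times_iff)
    then show ?case
      using Cons.IH assms(4) G.word_value_closed[OF assms(4), of w]
      by (auto simp: Pi_iff simp del: in_lists_conv_set)
  qed simp
qed

lemma word_value_free_group:
  assumes "w \<in> lists (S \<times> UNIV)"
  shows "word_value (free_group S) (\<lambda>i. [(i, True)]) w = free_reduction w"
  using assms
proof (induction w)
  case (Cons a w)
  interpret group "free_group S" by (rule group_free_group)
  have S: "fst a \<in> S" and w: "w \<in> lists (S \<times> UNIV)"
    using Cons.hyps by (auto simp: mem_Times_iff)
  have "inv\<^bsub>free_group S\<^esub> [(fst a, True)] = [(fst a, False)]"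
    by (rule inv_equality)
       (use S in \<open>simp_all add: free_group_carrier free_group_mult free_group_one reduced_def
          inv_letter_def\<close>)
  then have "word_value (free_group S) (\<lambda>i. [(i, True)]) (a # w)
    = [a] \<otimes>\<^bsub>free_group S\<^esub> free_reduction w"
    using Cons w by (cases a) auto
  then show ?case
    by (simp add: free_group_mult free_reduction_append_right free_reduction_reduced
        reduced_free_reduction)
qed (simp add: free_group_one)

section \<open>Presented groups and their universal property\<close>

definition relator_closure :: "'a presentation \<Rightarrow> 'a word set" where
  "relator_closure P = normal_closure (free_group (fst P)) (set (snd P))"

definition presented_gen :: "'a presentation \<Rightarrow> 'a \<Rightarrow> 'a word set" where
  "presented_gen P i = relator_closure P #>\<^bsub>free_group (fst P)\<^esub> [(i, True)]"

lemma (in group) normal_closure_normal: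
  assumes "R \<subseteq> carrier G"
  shows "normal_closure G R \<lhd> G" "R \<subseteq> normal_closure G R"
proof -
  have self: "carrier G \<lhd> G" by (simp add: normal_inv_iff subgroup_self)
  then have ne: "carrier G \<in> {N. N \<lhd> G \<and> R \<subseteq> N}" using assms by blast
  have "subgroup (normal_closure G R) G"
    unfolding normal_closure_def
    by (rule subgroups_Inter) (use ne in \<open>auto simp: normal_def\<close>)
  then show "normal_closure G R \<lhd> G"
    unfolding normal_inv_iff normal_closure_def by (auto simp: normal_inv_iff)
  show "R \<subseteq> normal_closure G R"
    by (auto simp: normal_closure_def)
qed

locale presentation =
  fixes P :: "'a presentation"
  assumes relators: "set (snd P) \<subseteq> carrier (free_group (fst P))"
begin

sublocale N: normal "relator_closure P" "free_group (fst P)"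
  unfolding relator_closure_def
  by (intro group.normal_closure_normal(1) group_free_group relators)

lemma presented_group_eq: "presented_group P = free_group (fst P) Mod relator_closure P"
  by (simp add: presented_group_def relator_closure_def)

lemma group_presented: "group (presented_group P)"
  unfolding presented_group_eq by (rule N.factorgroup_is_group)

lemma quotient_hom:
  "(\<lambda>w. relator_closure P #>\<^bsub>free_group (fst P)\<^esub> w) \<in> hom (free_group (fst P)) (presented_group P)"
  unfolding presented_group_eq by (rule N.r_coset_hom_Mod)

lemma presented_gen_closed: "presented_gen P \<in> fst P \<rightarrow> carrier (presented_group P)"
  using hom_in_carrier[OF quotient_hom]
  by (auto simp: presented_gen_def free_group_carrier reduced_def)

lemma word_value_presented:
  assumes "w \<in> lists (fst P \<times> UNIV)"
  shows "word_value (presented_group P) (presented_gen P) w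
    = relator_closure P #>\<^bsub>free_group (fst P)\<^esub> free_reduction w"
proof -
  have g: "(\<lambda>i. [(i, True)]) \<in> fst P \<rightarrow> carrier (free_group (fst P))"
    by (auto simp: free_group_carrier reduced_def)
  show ?thesis
    using hom_word_value[OF quotient_hom group_free_group group_presented g assms]
    by (simp add: word_value_free_group[OF assms] presented_gen_def[abs_def] comp_def)
qed

lemma presented_group_cases:
  assumes "C \<in> carrier (presented_group P)"
  obtains w where "w \<in> carrier (free_group (fst P))"
    "C = word_value (presented_group P) (presented_gen P) w"
proof -
  obtain w where w: "w \<in> carrier (free_group (fst P))" "C = relator_closure P #>\<^bsub>free_group (fst P)\<^esub> w"
    using assms unfolding presented_group_eq by (auto simp: FactGroup_def RCOSETS_def)
  then show ?thesis
    using that word_value_presented[of w] by (simp add: free_group_carrier free_reduction_reduced)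
qed

lemma word_value_relator:
  assumes "r \<in> set (snd P)"
  shows "word_value (presented_group P) (presented_gen P) r = \<one>\<^bsub>presented_group P\<^esub>"
proof -
  have r: "r \<in> carrier (free_group (fst P))" using assms relators by blast
  have "r \<in> relator_closure P"
    unfolding relator_closure_def
    using group.normal_closure_normal(2)[OF group_free_group relators] assms by blast
  then have "relator_closure P #>\<^bsub>free_group (fst P)\<^esub> r = relator_closure P"
    by (intro N.coset_join2 r N.subgroup_axioms)
  then show ?thesis
    using word_value_presented[of r] r
    by (simp add: free_group_carrier free_reduction_reduced presented_group_eq FactGroup_def)
qed

text \<open>The kernel of the evaluation is a normal subgroup containing the relators, so it
  contains their normal closure, and evaluation is constant on cosets; hence any chosen
  representative defines \<open>h\<close>.\<close>

lemma von_dyck: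
  assumes K: "group K" and \<phi>: "\<phi> \<in> fst P \<rightarrow> carrier K"
    and rel: "\<And>r. r \<in> set (snd P) \<Longrightarrow> word_value K \<phi> r = \<one>\<^bsub>K\<^esub>"
  obtains h where "h \<in> hom (presented_group P) K"
    "\<And>w. w \<in> lists (fst P \<times> UNIV) \<Longrightarrow>
      h (word_value (presented_group P) (presented_gen P) w) = word_value K \<phi> w"
    "\<And>i. i \<in> fst P \<Longrightarrow> h (presented_gen P i) = \<phi> i"
proof -
  let ?F = "free_group (fst P)"
  interpret K: group K by (rule K)
  interpret G: group "presented_group P" by (rule group_presented)
  interpret e: group_hom ?F K "word_value K \<phi>"
    using K.word_value_hom[OF \<phi>] by (simp add: group_hom_def group_hom_axioms_def group_free_group K)
  have "kernel ?F K (word_value K \<phi>) \<lhd> ?F" by (rule e.normal_kernel)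
  moreover have "set (snd P) \<subseteq> kernel ?F K (word_value K \<phi>)"
    using rel relators by (auto simp: kernel_def)
  ultimately have ker: "relator_closure P \<subseteq> kernel ?F K (word_value K \<phi>)"
    unfolding relator_closure_def normal_closure_def by blast
  define h where "h C = word_value K \<phi> (SOME w. w \<in> C)" for C
  have h: "h (relator_closure P #>\<^bsub>?F\<^esub> w) = word_value K \<phi> w" if w: "w \<in> carrier ?F" for w
  proof -
    have "w \<in> relator_closure P #>\<^bsub>?F\<^esub> w"
      by (rule group.rcos_self[OF group_free_group w N.subgroup_axioms])
    then have "(SOME v. v \<in> relator_closure P #>\<^bsub>?F\<^esub> w) \<in> relator_closure P #>\<^bsub>?F\<^esub> w"
      by (rule someI)
    then obtain v where v: "v \<in> relator_closure P"
      "(SOME v. v \<in> relator_closure P #>\<^bsub>?F\<^esub> w) = v \<otimes>\<^bsub>?F\<^esub> w"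
      by (auto simp: r_coset_def)
    then have "v \<in> carrier ?F" "word_value K \<phi> v = \<one>\<^bsub>K\<^esub>"
      using ker by (auto simp: kernel_def)
    then show ?thesis
      using v w by (simp add: h_def)
  qed
  have hw: "h (word_value (presented_group P) (presented_gen P) w) = word_value K \<phi> w"
    if "w \<in> lists (fst P \<times> UNIV)" for w
    using h[OF free_reduction_carrier[OF that]] that
    by (simp add: word_value_presented K.word_value_free_reduction[OF \<phi> that])
  have "h \<in> hom (presented_group P) K"
  proof (rule homI)
    fix C assume "C \<in> carrier (presented_group P)"
    then obtain u where u: "u \<in> carrier ?F"
      "C = word_value (presented_group P) (presented_gen P) u"
      by (rule presented_group_cases)
    then show "h C \<in> carrier K"
      using hw by (simp add: free_group_carrier K.word_value_closed[OF \<phi>])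
    fix D assume "D \<in> carrier (presented_group P)"
    then obtain v where v: "v \<in> carrier ?F"
      "D = word_value (presented_group P) (presented_gen P) v"
      by (rule presented_group_cases)
    have l: "u \<in> lists (fst P \<times> UNIV)" "v \<in> lists (fst P \<times> UNIV)"
      using u v by (simp_all add: free_group_carrier)
    show "h (C \<otimes>\<^bsub>presented_group P\<^esub> D) = h C \<otimes>\<^bsub>K\<^esub> h D"
      using hw[of "u @ v"] hw[OF l(1)] hw[OF l(2)] u(2) v(2)
        G.word_value_append[OF presented_gen_closed l] K.word_value_append[OF \<phi> l] l by (simp del: in_lists_conv_set)
  qed
  moreover have "h (presented_gen P i) = \<phi> i" if i: "i \<in> fst P" for i
  proof -
    have "presented_gen P i \<in> carrier (presented_group P)" "\<phi> i \<in> carrier K"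
      using presented_gen_closed \<phi> i by auto
    then show ?thesis
      using hw[of "[(i, True)]"] i by simp
  qed
  ultimately show ?thesis using that hw by blast
qed

lemma endomorphism_identity:
  assumes f: "f \<in> hom (presented_group P) (presented_group P)"
    and gen: "\<And>i. i \<in> fst P \<Longrightarrow> f (presented_gen P i) = presented_gen P i"
    and C: "C \<in> carrier (presented_group P)"
  shows "f C = C"
proof -
  interpret G: group "presented_group P" by (rule group_presented)
  obtain w where w: "w \<in> carrier (free_group (fst P))"
    "C = word_value (presented_group P) (presented_gen P) w"
    using presented_group_cases[OF C] .
  then have l: "w \<in> lists (fst P \<times> UNIV)" by (simp add: free_group_carrier)
  have "f C = word_value (presented_group P) (f \<circ> presented_gen P) w"
    using hom_word_value[OF f group_presented group_presented presented_gen_closed l] w by simp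
  also have "\<dots> = C"
    unfolding w(2) by (rule G.word_value_cong[OF l]) (simp add: gen)
  finally show ?thesis .
qed

text \<open>\<open>K\<close> is arbitrary, so \<open>h \<circ> k\<close> is controlled on all
  elements; \<open>k \<circ> h\<close> is an endomorphism of a presented group, for which the
  generators suffice.\<close>

lemma iso_of_inverse_homs:
  assumes h: "h \<in> hom (presented_group P) K" and k: "k \<in> hom K (presented_group P)"
    and kh: "\<And>i. i \<in> fst P \<Longrightarrow> k (h (presented_gen P i)) = presented_gen P i"
    and hk: "\<And>x. x \<in> carrier K \<Longrightarrow> h (k x) = x"
  shows "presented_group P \<cong> K"
proof -
  have kh': "k (h C) = C" if "C \<in> carrier (presented_group P)" for C
    using endomorphism_identity[OF hom_compose[OF h k] _ that] kh by simp
  have "bij_betw h (carrier (presented_group P)) (carrier K)"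
    by (rule bij_betwI[where g = k]) (use kh' hk hom_in_carrier[OF h] hom_in_carrier[OF k] in auto)
  then show ?thesis
    using h by (auto simp: is_iso_def iso_def)
qed

text \<open>A relation between two elements survives every homomorphism, so freeness may be tested
  in \<open>K\<close>. The type \<open>bool\<close> serves as an alphabet with two letters.\<close>

lemma contains_nonabelian_freeI:
  fixes \<alpha> :: "bool \<Rightarrow> 'a word"
  assumes K: "group K" and \<phi>: "\<phi> \<in> fst P \<rightarrow> carrier K"
    and rel: "\<And>r. r \<in> set (snd P) \<Longrightarrow> word_value K \<phi> r = \<one>\<^bsub>K\<^esub>"
    and \<alpha>: "\<And>b. \<alpha> b \<in> lists (fst P \<times> UNIV)"
    and free: "\<And>v. reduced v \<Longrightarrow> v \<noteq> [] \<Longrightarrow> word_value K (\<lambda>b. word_value K \<phi> (\<alpha> b)) v \<noteq> \<one>\<^bsub>K\<^esub>"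
  shows "contains_nonabelian_free_subgroup (presented_group P)"
proof -
  interpret K: group K by (rule K)
  interpret G: group "presented_group P" by (rule group_presented)
  obtain h where h: "h \<in> hom (presented_group P) K"
    "\<And>w. w \<in> lists (fst P \<times> UNIV) \<Longrightarrow>
      h (word_value (presented_group P) (presented_gen P) w) = word_value K \<phi> w"
    using von_dyck[OF K \<phi> rel] by metis
  define A where "A b = word_value (presented_group P) (presented_gen P) (\<alpha> b)" for b
  have hA: "h (A b) = word_value K \<phi> (\<alpha> b)" for b
    using h(2)[OF \<alpha>] by (simp add: A_def)
  have A: "A \<in> UNIV \<rightarrow> carrier (presented_group P)"
    using G.word_value_closed[OF presented_gen_closed \<alpha>] by (simp add: A_def)
  have A_free: "word_value (presented_group P) A v \<noteq> \<one>\<^bsub>presented_group P\<^esub>"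
    if "reduced v" "v \<noteq> []" for v
  proof
    assume "word_value (presented_group P) A v = \<one>\<^bsub>presented_group P\<^esub>"
    then have "word_value K (h \<circ> A) v = \<one>\<^bsub>K\<^esub>"
      using hom_word_value[OF h(1) group_presented K A, of v] hom_one[OF h(1) group_presented K] by simp
    moreover have "h \<circ> A = (\<lambda>b. word_value K \<phi> (\<alpha> b))"
      using hA by auto
    ultimately show False using free that by simp
  qed
  \<comment> \<open>Needed to translate words over \<open>range A\<close> back into words over
    \<open>bool\<close>; for distinct b, c the reduced word b c^-1 separates the values.\<close>
  have "inj A"
  proof (rule injI, rule ccontr)
    fix b c assume eq: "A b = A c" and "b \<noteq> c"
    then have "reduced [(b, True), (c, False)]" by (simp add: reduced_def inv_letter_def)
    from A_free[OF this] show False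
      using eq A by (simp add: Pi_iff)
  qed
  \<comment> \<open>\<open>is_free_group\<close> wants a basis inside the element type, so the
    generators themselves form it rather than \<open>bool\<close>.\<close>
  let ?B = "free_group (range A)"
  define \<psi> where "\<psi> = word_value (presented_group P) (id :: 'a word set \<Rightarrow> _)"
  have \<psi>: "\<psi> \<in> hom ?B (presented_group P)"
    unfolding \<psi>_def by (rule G.word_value_hom) (use A in auto)
  interpret \<psi>: group_hom ?B "presented_group P" \<psi>
    using \<psi> group_free_group group_presented by (simp add: group_hom_def group_hom_axioms_def)
  have "inj_on \<psi> (carrier ?B)"
  unfolding \<psi>.inj_on_one_iff
  proof (intro allI impI)
    fix v assume v: "v \<in> carrier ?B" "\<psi> v = \<one>\<^bsub>presented_group P\<^esub>"
    define v' where "v' = map (\<lambda>(x, e). (the_inv A x, e)) v"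
    have "map (\<lambda>(x, e). (A (the_inv A x), e)) v = v"
      by (rule map_idI)
         (use v(1) \<open>inj A\<close> in \<open>auto simp: free_group_carrier f_the_inv_into_f dest!: bspec\<close>)
    then have vv': "map (\<lambda>(b, e). (A b, e)) v' = v"
      by (simp add: v'_def case_prod_unfold comp_def)
    have "successively (\<lambda>a b. b \<noteq> inv_letter a) (map (\<lambda>(b, e). (A b, e)) v')"
      using v(1) by (simp add: vv' free_group_carrier reduced_def)
    then have red: "reduced v'"
      unfolding reduced_def successively_map
      by (rule successively_mono) (auto simp: inv_letter_def)
    have "word_value (presented_group P) A v' = \<one>\<^bsub>presented_group P\<^esub>"
      using v(2) word_value_map[of "presented_group P" id A v'] by (simp add: vv' \<psi>_def)
    then have "v' = []" using A_free red by blast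
    then show "v = \<one>\<^bsub>?B\<^esub>" using vv' by (simp add: free_group_one)
  qed
  define H where "H = \<psi> ` carrier ?B"
  have H: "subgroup H (presented_group P)"
    unfolding H_def by (rule \<psi>.img_is_subgroup)
  have AH: "A b \<in> H" for b
  proof -
    have "\<psi> [(A b, True)] = A b" using A by (simp add: \<psi>_def Pi_iff)
    moreover have "[(A b, True)] \<in> carrier ?B"
      by (simp add: free_group_carrier reduced_def)
    ultimately show ?thesis unfolding H_def by (metis imageI)
  qed
  have "\<psi> \<in> iso ?B (presented_group P\<lparr>carrier := H\<rparr>)"
    using \<psi> \<open>inj_on \<psi> (carrier ?B)\<close> by (auto simp: iso_def hom_def bij_betw_def H_def)
  then have "?B \<cong> presented_group P\<lparr>carrier := H\<rparr>" by (auto simp: is_iso_def)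
  then have "presented_group P\<lparr>carrier := H\<rparr> \<cong> ?B"
    by (rule group.iso_sym[OF group_free_group])
  then have "is_free_group (presented_group P\<lparr>carrier := H\<rparr>)"
    unfolding is_free_group_def by blast
  moreover have "\<not> comm_group (presented_group P\<lparr>carrier := H\<rparr>)"
  proof
    assume "comm_group (presented_group P\<lparr>carrier := H\<rparr>)"
    then interpret H: comm_group "presented_group P\<lparr>carrier := H\<rparr>" .
    have c: "A True \<otimes>\<^bsub>presented_group P\<^esub> A False = A False \<otimes>\<^bsub>presented_group P\<^esub> A True"
      using H.m_comm[of "A True" "A False"] AH by simp
    have "reduced [(True, True), (False, True), (True, False), (False, False)]"
      by (simp add: reduced_def inv_letter_def)
    moreover have Ac: "A b \<in> carrier (presented_group P)" for b using A by blast
    have "word_value (presented_group P) A [(True, True), (False, True), (True, False), (False, False)]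
        = (A True \<otimes>\<^bsub>presented_group P\<^esub> A False) \<otimes>\<^bsub>presented_group P\<^esub>
          inv\<^bsub>presented_group P\<^esub> (A False \<otimes>\<^bsub>presented_group P\<^esub> A True)"
      using Ac by (simp add: G.m_assoc G.inv_mult_group)
    then have "word_value (presented_group P) A [(True, True), (False, True), (True, False), (False, False)]
        = \<one>\<^bsub>presented_group P\<^esub>"
      using c Ac by simp
    ultimately show False using A_free by blast
  qed
  ultimately show ?thesis
    using H unfolding contains_nonabelian_free_subgroup_def by blast
qed

end

section \<open>Permutation actions and linearised relations\<close>

definition perms :: "('x \<Rightarrow> 'x) monoid" where
  "perms = \<lparr>carrier = {f. bij f}, monoid.mult = (\<circ>), one = id\<rparr>"

lemma perms_simps [simp]:
  "f \<in> carrier perms \<longleftrightarrow> bij f" "f \<otimes>\<^bsub>perms\<^esub> g = f \<circ> g" "\<one>\<^bsub>perms\<^esub> = id"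
  by (simp_all add: perms_def)

lemma group_perms: "group (perms :: ('x \<Rightarrow> 'x) monoid)"
proof (rule groupI)
  fix f :: "'x \<Rightarrow> 'x" assume "f \<in> carrier perms"
  then show "\<exists>g\<in>carrier perms. g \<otimes>\<^bsub>perms\<^esub> f = \<one>\<^bsub>perms\<^esub>"
    by (intro bexI[of _ "inv_into UNIV f"]) (simp_all add: bij_imp_bij_inv bij_is_inj)
qed (auto simp: bij_comp comp_assoc)

interpretation perms: group "perms :: ('x \<Rightarrow> 'x) monoid"
  by (rule group_perms)

lemma perms_inv_equality:
  assumes "f \<circ> g = id" "g \<circ> f = id"
  shows "bij f" "inv\<^bsub>perms\<^esub> f = g"
proof -
  have b: "bij f" "bij g" using assms o_bij by blast+
  then show "bij f" "inv\<^bsub>perms\<^esub> f = g"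
    using assms perms.inv_equality[of g f] by auto
qed

lemma perms_inv_left [simp]: "bij f \<Longrightarrow> (inv\<^bsub>perms\<^esub> f) (f x) = x"
  and perms_inv_right [simp]: "bij f \<Longrightarrow> f ((inv\<^bsub>perms\<^esub> f) x) = x"
  using perms.l_inv[of f] perms.r_inv[of f] by (auto dest: fun_cong)

lemma bij_perms_inv [simp]: "bij f \<Longrightarrow> bij (inv\<^bsub>perms\<^esub> f)"
  using perms.inv_closed[of f] by simp

lemma bij_int_pow_perms [simp]: "bij f \<Longrightarrow> bij (f [^]\<^bsub>perms\<^esub> (a :: int))"
  using perms.int_pow_closed[of f a] by simp

lemma nat_pow_perms: "f [^]\<^bsub>perms\<^esub> (k :: nat) = f ^^ k"
  by (induction k) (simp_all add: funpow_Suc_right del: funpow.simps)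

text \<open>\<open>U l\<close> attracts under the letter \<open>l\<close>. By induction from the
  right end, a reduced word sends \<open>p\<close> into the set of its first letter, which does not
  contain \<open>p\<close>. \<open>X\<close> cuts out the points where the dynamics is controlled:
  reduced words, or nonzero vectors.\<close>

lemma ping_pong:
  fixes U :: "'i letter \<Rightarrow> 'x set"
  assumes bij: "\<And>i. bij (B i)"
    and U: "\<And>l. U l \<subseteq> X" "\<And>l l'. l \<noteq> l' \<Longrightarrow> U l \<inter> U l' = {}"
    and p: "p \<in> X" "\<And>l. p \<notin> U l"
    and fwd: "\<And>i x. x \<in> X \<Longrightarrow> x \<notin> U (i, False) \<Longrightarrow> B i x \<in> U (i, True)"
    and bwd: "\<And>i x. x \<in> X \<Longrightarrow> x \<notin> U (i, True) \<Longrightarrow> (inv\<^bsub>perms\<^esub> (B i)) x \<in> U (i, False)"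
    and v: "reduced v" "v \<noteq> []"
  shows "word_value perms B v \<noteq> \<one>\<^bsub>perms\<^esub>"
proof -
  have step: "(if snd a then B (fst a) else inv\<^bsub>perms\<^esub> (B (fst a))) x \<in> U a"
    if "x \<in> X" "x \<notin> U (inv_letter a)" for a x
    using that fwd bwd by (cases a) (auto simp: inv_letter_def)
  have "word_value perms B v p \<in> U (hd v)"
    using v
  proof (induction v)
    case (Cons a v)
    have "word_value perms B v p \<in> X \<and> word_value perms B v p \<notin> U (inv_letter a)"
    proof (cases v)
      case Nil
      then show ?thesis using p by simp
    next
      case (Cons b w)
      then have "word_value perms B v p \<in> U b" "b \<noteq> inv_letter a"
        using Cons.IH Cons.prems by (auto simp: reduced_Cons)
      then show ?thesis using U by blast
    qed
    then show ?case using step by simp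
  qed simp
  then have "word_value perms B v p \<noteq> p" using p(2) by metis
  then show ?thesis by auto
qed

text \<open>Left multiplication in the free group, extended by the identity to unreduced words so
  that it permutes a whole type.\<close>

definition letter_action :: "'i letter \<Rightarrow> 'i word \<Rightarrow> 'i word" where
  "letter_action a w = (if reduced w then cons_reduce a w else w)"

lemma letter_action_inverse:
  "letter_action a \<circ> letter_action (inv_letter a) = id"
  "letter_action (inv_letter a) \<circ> letter_action a = id"
  using cons_reduce_inv[of _ "inv_letter a"] cons_reduce_inv[of _ a]
  by (auto simp: letter_action_def fun_eq_iff reduced_cons_reduce)

lemma bij_letter_action [simp]: "bij (letter_action a)"
  and inv_letter_action: "inv\<^bsub>perms\<^esub> (letter_action a) = letter_action (inv_letter a)"
  by (rule perms_inv_equality[OF letter_action_inverse])+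

lemma letter_action_pow:
  assumes "reduced w" "w = [] \<or> hd w \<noteq> inv_letter a"
  shows "reduced ((letter_action a ^^ Suc k) w) \<and> (letter_action a ^^ Suc k) w \<noteq> [] \<and>
    hd ((letter_action a ^^ Suc k) w) = a"
proof (induction k)
  case 0
  show ?case using assms by (cases w) (auto simp: letter_action_def reduced_Cons)
next
  case (Suc k)
  define u where "u = (letter_action a ^^ Suc k) w"
  have "reduced u" "u \<noteq> []" "hd u = a" using Suc by (simp_all add: u_def del: funpow.simps)
  moreover have "a \<noteq> inv_letter a" by (simp add: inv_letter_def prod_eq_iff)
  ultimately have "reduced (letter_action a u) \<and> letter_action a u \<noteq> [] \<and> hd (letter_action a u) = a"
    by (cases u) (auto simp: letter_action_def reduced_Cons)
  then show ?case by (simp add: u_def)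
qed

lemma letter_action_int_pow:
  "letter_action (i, True) [^]\<^bsub>perms\<^esub> (c :: int) = letter_action (i, 0 < c) ^^ nat \<bar>c\<bar>"
proof (cases "0 < c")
  case True
  define m where "m = nat c"
  have "c = int m" using True by (simp add: m_def)
  then show ?thesis using True by (simp add: int_pow_int nat_pow_perms)
next
  case False
  define m where "m = nat (- c)"
  have m: "c = - int m" using False by (simp add: m_def)
  have "letter_action (i, True) [^]\<^bsub>perms\<^esub> c = inv\<^bsub>perms\<^esub> (letter_action (i, True) [^]\<^bsub>perms\<^esub> m)"
    using perms.int_pow_neg[of "letter_action (i, True)" "int m"] by (simp add: m int_pow_int)
  also have "\<dots> = (inv\<^bsub>perms\<^esub> (letter_action (i, True))) [^]\<^bsub>perms\<^esub> m"
    using perms.nat_pow_inv[of "letter_action (i, True)" m] by simp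
  also have "\<dots> = letter_action (i, False) ^^ m"
    by (simp add: inv_letter_action inv_letter_def nat_pow_perms)
  finally show ?thesis by (simp add: m)
qed

lemma letter_action_powers_free:
  assumes "\<And>i. c i \<noteq> (0 :: int)" "reduced v" "v \<noteq> []"
  shows "word_value perms (\<lambda>i. letter_action (i, True) [^]\<^bsub>perms\<^esub> c i) v \<noteq> \<one>\<^bsub>perms\<^esub>"
proof -
  \<comment> \<open>When \<open>c i\<close> is negative the power prepends the opposite letter, so
    the sign of the first letter is compared with the sign of \<open>c i\<close>.\<close>
  define U :: "'a letter \<Rightarrow> 'a word set" where
    "U l = {w. reduced w \<and> w \<noteq> [] \<and> hd w = (fst l, snd l = (0 < c (fst l)))}" for l
  have step: "(letter_action (i, e) ^^ nat \<bar>c i\<bar>) x \<in> U (i, e = (0 < c i))"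
    if "reduced x" "x \<notin> U (i, e \<noteq> (0 < c i))" for i e x
  proof -
    obtain k where "nat \<bar>c i\<bar> = Suc k"
      using assms(1)[of i] by (cases "nat \<bar>c i\<bar>") auto
    moreover have "x = [] \<or> hd x \<noteq> inv_letter (i, e)"
      using that by (auto simp: U_def inv_letter_def)
    ultimately show ?thesis
      using letter_action_pow[OF that(1), of "(i, e)" k] by (auto simp: U_def simp del: funpow.simps)
  qed
  have inv: "inv\<^bsub>perms\<^esub> (letter_action (i, True) [^]\<^bsub>perms\<^esub> c i) = letter_action (i, \<not> 0 < c i) ^^ nat \<bar>c i\<bar>" for i
    using perms.int_pow_neg[of "letter_action (i, True)" "c i"] letter_action_int_pow[of i "- c i"]
      assms(1)[of i] by (auto simp: not_less le_less)
  show ?thesis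
  proof (rule ping_pong[of _ U "{w. reduced w}" "[]"])
    show "bij (letter_action (i, True) [^]\<^bsub>perms\<^esub> c i)" for i
      by simp
    fix i x assume x: "x \<in> {w :: 'a word. reduced w}"
    show "(letter_action (i, True) [^]\<^bsub>perms\<^esub> c i) x \<in> U (i, True)" if "x \<notin> U (i, False)"
      using step[of x i "0 < c i"] that x unfolding letter_action_int_pow by simp
    show "(inv\<^bsub>perms\<^esub> (letter_action (i, True) [^]\<^bsub>perms\<^esub> c i)) x \<in> U (i, False)" if "x \<notin> U (i, True)"
      using step[of x i "\<not> 0 < c i"] that x unfolding inv by (cases "0 < c i") auto
  qed (use assms in \<open>auto simp: U_def prod_eq_iff\<close>)
qed

section \<open>Syllables and skew products over Z\<close>

definition syllable :: "'a \<Rightarrow> int \<Rightarrow> 'a word" where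
  "syllable i a = replicate (nat \<bar>a\<bar>) (i, 0 < a)"

lemma syllable_lists: "i \<in> S \<Longrightarrow> syllable i a \<in> lists (S \<times> UNIV)"
  by (auto simp: syllable_def)

lemma (in group) word_value_syllable:
  assumes "\<phi> i \<in> carrier G"
  shows "word_value G \<phi> (syllable i a) = \<phi> i [^] a"
proof -
  have pos: "word_value G \<phi> (replicate k (i, True)) = \<phi> i [^] k" for k
    by (induction k) (use assms nat_pow_Suc2[OF assms] in auto)
  have neg: "word_value G \<phi> (replicate k (i, False)) = inv (\<phi> i) [^] k" for k
    by (induction k) (use assms nat_pow_Suc2[OF inv_closed[OF assms]] in auto)
  show ?thesis
  proof (cases "0 < a")
    case True
    then show ?thesis using pos by (simp add: syllable_def flip: int_pow_int)
  next
    case False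
    then have "\<phi> i [^] a = inv (\<phi> i [^] (nat \<bar>a\<bar>))"
      using int_pow_neg[OF assms, of "- a"] by (simp flip: int_pow_int)
    then show ?thesis using False neg assms by (simp add: syllable_def nat_pow_inv)
  qed
qed

text \<open>A generator moves the position by \<open>f i\<close> and acts on the fibre by a
  permutation depending on the position where the step starts: an action through the unrestricted
  wreath product with Z.\<close>

definition skew_action :: "('a \<Rightarrow> int) \<Rightarrow> ('a \<Rightarrow> int \<Rightarrow> 'x \<Rightarrow> 'x) \<Rightarrow> 'a \<Rightarrow> int \<times> 'x \<Rightarrow> int \<times> 'x" where
  "skew_action f g i = (\<lambda>(s, x). (s + f i, g i s x))"

primrec height :: "('a \<Rightarrow> int) \<Rightarrow> 'a word \<Rightarrow> int" where
  "height f [] = 0"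
| "height f (a # w) = (if snd a then f (fst a) else - f (fst a)) + height f w"

text \<open>The fibre part of a word started at position \<open>s\<close>. Letters act from the
  right; an inverse letter undoes a step that started \<open>f (fst a)\<close> before the current
  position.\<close>

primrec cocycle :: "('a \<Rightarrow> int) \<Rightarrow> ('a \<Rightarrow> int \<Rightarrow> 'x \<Rightarrow> 'x) \<Rightarrow> 'a word \<Rightarrow> int \<Rightarrow> 'x \<Rightarrow> 'x" where
  "cocycle f g [] s = id"
| "cocycle f g (a # w) s =
     (if snd a then g (fst a) (s + height f w)
      else inv\<^bsub>perms\<^esub> (g (fst a) (s + height f w - f (fst a)))) \<circ> cocycle f g w s"

lemma skew_action_inverse:
  assumes "\<And>s. bij (g i s)"
  shows "bij (skew_action f g i)"
    "inv\<^bsub>perms\<^esub> (skew_action f g i) = (\<lambda>(s, x). (s - f i, (inv\<^bsub>perms\<^esub> (g i (s - f i))) x))"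
proof -
  have "skew_action f g i \<circ> (\<lambda>(s, x). (s - f i, (inv\<^bsub>perms\<^esub> (g i (s - f i))) x)) = id"
    "(\<lambda>(s, x). (s - f i, (inv\<^bsub>perms\<^esub> (g i (s - f i))) x)) \<circ> skew_action f g i = id"
    by (simp_all add: skew_action_def fun_eq_iff assms)
  from perms_inv_equality[OF this] show "bij (skew_action f g i)"
    "inv\<^bsub>perms\<^esub> (skew_action f g i) = (\<lambda>(s, x). (s - f i, (inv\<^bsub>perms\<^esub> (g i (s - f i))) x))" .
qed

lemma word_value_skew_action:
  assumes "\<And>i s. i \<in> S \<Longrightarrow> bij (g i s)" "w \<in> lists (S \<times> UNIV)"
  shows "word_value perms (skew_action f g) w (s, x) = (s + height f w, cocycle f g w s x)"
  using assms(2)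
proof (induction w)
  case (Cons a w)
  then have "\<And>s. bij (g (fst a) s)" using assms(1) by (auto simp: mem_Times_iff)
  from skew_action_inverse(2)[of g, OF this] show ?case
    using Cons.IH by (auto simp: skew_action_def algebra_simps)
qed simp

lemma skew_action_shift:
  assumes "\<And>s. g i s = id" "f i = 1"
  shows "(skew_action f g i [^]\<^bsub>perms\<^esub> (k :: int)) (s, x) = (s + k, x)"
proof -
  have b: "bij (skew_action f g i)"
    using skew_action_inverse(1)[of g i f] assms by simp
  have nat: "(skew_action f g i ^^ m) (s, x) = (s + int m, x)" for m s
    by (induction m arbitrary: s) (use assms in \<open>simp_all add: skew_action_def\<close>)
  show ?thesis
  proof (cases "0 \<le> k")
    case True
    then obtain m where "k = int m" using nonneg_int_cases by blast
    then show ?thesis using nat by (simp add: int_pow_int nat_pow_perms)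
  next
    case False
    define m where "m = nat (- k)"
    have m: "k = - int m" using False by (simp add: m_def)
    have "skew_action f g i [^]\<^bsub>perms\<^esub> k = inv\<^bsub>perms\<^esub> (skew_action f g i ^^ m)"
      using perms.int_pow_neg[of "skew_action f g i" "int m"] b
      by (simp add: m int_pow_int nat_pow_perms)
    moreover have "bij (skew_action f g i ^^ m)"
      using b by (rule bij_betw_funpow)
    ultimately show ?thesis
      using nat[of m "s + k"] perms_inv_left[of "skew_action f g i ^^ m" "(s + k, x)"] m by simp
  qed
qed

lemma word_value_fibre:
  assumes "\<And>b. bij (A b)" "\<And>b. bij (B b)" "\<And>b x. A b (s, x) = (s, B b x)"
  shows "word_value perms A v (s, x) = (s, word_value perms B v x)"
proof (induction v)
  case (Cons a v)
  have "(inv\<^bsub>perms\<^esub> (A b)) (s, y) = (s, (inv\<^bsub>perms\<^esub> (B b)) y)" for b y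
    using perms_inv_left[of "A b" "(s, (inv\<^bsub>perms\<^esub> (B b)) y)"] assms by simp
  then show ?case using Cons assms(3) by simp
qed simp

text \<open>One fibre is enough: the words \<open>\<alpha> b\<close> fix the position
  \<open>s\<close>, act on its fibre through \<open>B b\<close>, and a product that moves a point
  there is not the identity.\<close>

lemma (in presentation) contains_nonabelian_free_fibreI:
  fixes \<phi> :: "'a \<Rightarrow> int \<times> 'x \<Rightarrow> int \<times> 'x" and B :: "bool \<Rightarrow> 'x \<Rightarrow> 'x"
  assumes \<phi>: "\<And>i. i \<in> fst P \<Longrightarrow> bij (\<phi> i)"
    and rel: "\<And>r. r \<in> set (snd P) \<Longrightarrow> word_value perms \<phi> r = \<one>\<^bsub>perms\<^esub>"
    and \<alpha>: "\<And>b. \<alpha> b \<in> lists (fst P \<times> UNIV)"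
    and B: "\<And>b. bij (B b)" "\<And>b x. word_value perms \<phi> (\<alpha> b) (s, x) = (s, B b x)"
    and free: "\<And>v. reduced v \<Longrightarrow> v \<noteq> [] \<Longrightarrow> word_value perms B v \<noteq> \<one>\<^bsub>perms\<^esub>"
  shows "contains_nonabelian_free_subgroup (presented_group P)"
proof (rule contains_nonabelian_freeI[OF group_perms _ rel \<alpha>])
  show phi: "\<phi> \<in> fst P \<rightarrow> carrier perms" using \<phi> by simp
  fix v :: "bool word" assume "reduced v" "v \<noteq> []"
  then obtain x where "word_value perms B v x \<noteq> x"
    using free[of v] by (auto simp: fun_eq_iff)
  moreover have "bij (word_value perms \<phi> (\<alpha> b))" for b
    using perms.word_value_closed[OF phi \<alpha>] by simp
  ultimately have "word_value perms (\<lambda>b. word_value perms \<phi> (\<alpha> b)) v (s, x) \<noteq> (s, x)"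
    using word_value_fibre[of "\<lambda>b. word_value perms \<phi> (\<alpha> b)" B s v x] B by simp
  then show "word_value perms (\<lambda>b. word_value perms \<phi> (\<alpha> b)) v \<noteq> \<one>\<^bsub>perms\<^esub>"
    by auto
qed

text \<open>The cocycle with fibre permutations replaced by integers: in effect the Fox derivatives
  of the word along \<open>f\<close>, paired with \<open>c\<close>.\<close>

primrec weight :: "('a \<Rightarrow> int) \<Rightarrow> ('a \<Rightarrow> int \<Rightarrow> int) \<Rightarrow> 'a word \<Rightarrow> int \<Rightarrow> int" where
  "weight f c [] s = 0"
| "weight f c (a # w) s =
     (if snd a then c (fst a) (s + height f w) else - c (fst a) (s + height f w - f (fst a)))
     + weight f c w s"

lemma height_bound:
  assumes "\<And>i. i \<in> S \<Longrightarrow> \<bar>f i\<bar> \<le> 1" "w \<in> lists (S \<times> UNIV)"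
  shows "\<bar>height f w\<bar> \<le> int (length w)"
  using assms(2)
proof (induction w)
  case (Cons a w)
  then have "\<bar>f (fst a)\<bar> \<le> 1" using assms(1) by (auto simp: mem_Times_iff)
  then show ?case using Cons.IH by auto
qed simp

text \<open>Powers of one permutation commute, so composing them adds exponents. A word started at
  \<open>s\<close> meets only positions within its length of \<open>s\<close>, so \<open>g\<close>
  may be arbitrary elsewhere.\<close>

lemma cocycle_power:
  assumes f: "\<And>i. i \<in> S \<Longrightarrow> \<bar>f i\<bar> \<le> 1" and w: "w \<in> lists (S \<times> UNIV)"
    and g: "\<And>i p. i \<in> S \<Longrightarrow> \<bar>p - s\<bar> \<le> int (length w) \<Longrightarrow> g i p = y [^]\<^bsub>perms\<^esub> c i p"
    and y: "bij y"
  shows "cocycle f g w s = y [^]\<^bsub>perms\<^esub> weight f c w s"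
  using w g
proof (induction w)
  case (Cons a w)
  have a: "fst a \<in> S" using Cons.hyps by (auto simp: mem_Times_iff)
  have IH: "cocycle f g w s = y [^]\<^bsub>perms\<^esub> weight f c w s"
    by (rule Cons.IH) (use Cons.prems in auto)
  have h: "\<bar>height f w\<bar> \<le> int (length w)" by (rule height_bound[OF f Cons.hyps(2)])
  then have 1: "g (fst a) (s + height f w) = y [^]\<^bsub>perms\<^esub> c (fst a) (s + height f w)"
    by (intro Cons.prems a) simp
  have 2: "g (fst a) (s + height f w - f (fst a)) = y [^]\<^bsub>perms\<^esub> c (fst a) (s + height f w - f (fst a))"
    by (intro Cons.prems a) (use h f[OF a] in simp)
  have "inv\<^bsub>perms\<^esub> (y [^]\<^bsub>perms\<^esub> k) = y [^]\<^bsub>perms\<^esub> (- k)" for k :: int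
    using y perms.int_pow_neg[of y k] by simp
  moreover have "(y [^]\<^bsub>perms\<^esub> k) ((y [^]\<^bsub>perms\<^esub> l) x) = (y [^]\<^bsub>perms\<^esub> (k + l)) x" for k l :: int and x
    using perms.int_pow_mult[of y k l] y by simp
  ultimately show ?case unfolding cocycle.simps IH 1 2 by (auto simp: fun_eq_iff)
qed simp

text \<open>
  A finitely supported solution \<open>c\<close> of the linearised relations is used twice, in two distant zones
  of positions, with values in the powers of two free generators.
\<close>

lemma (in presentation) contains_nonabelian_free_weightI:
  assumes f: "\<And>i. i \<in> fst P \<Longrightarrow> \<bar>f i\<bar> \<le> 1"
    and i0: "i0 \<in> fst P" "f i0 = 1" "\<And>s. c i0 s = 0"
    and supp: "\<And>i s. s < 0 \<or> k \<le> s \<Longrightarrow> c i s = 0"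
    and nz: "i \<in> fst P" "c i q \<noteq> 0"
    and rel: "\<And>r. r \<in> set (snd P) \<Longrightarrow> height f r = 0"
      "\<And>r s. r \<in> set (snd P) \<Longrightarrow> weight f c r s = 0"
  shows "contains_nonabelian_free_subgroup (presented_group P)"
proof -
  define L where "L = int (sum_list (map length (snd P)))"
  have L: "int (length r) \<le> L" if "r \<in> set (snd P)" for r
    using that by (auto simp: L_def intro!: member_le_sum_list)
  \<comment> \<open>The supports of the two copies, [0, k) and [D, D + k), are so far apart that no
    window of radius \<open>L\<close> meets both.\<close>
  define D where "D = \<bar>k\<bar> + 2 * L"
  have "L \<ge> 0" by (simp add: L_def)
  have q: "0 \<le> q" "q < k" using supp[of q i] nz by force+
  define y where "y b = letter_action (b :: bool, True)" for b
  have y: "bij (y b)" for b by (simp add: y_def)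
  define g where "g i s = y True [^]\<^bsub>perms\<^esub> c i s \<circ> y False [^]\<^bsub>perms\<^esub> c i (s - D)" for i s
  have g: "bij (g i s)" for i s using y by (simp add: g_def bij_comp)
  have g1: "g i s = y True [^]\<^bsub>perms\<^esub> c i s" if "s < D" for i s
    using that supp[of "s - D"] by (simp add: g_def)
  have g2: "g i s = y False [^]\<^bsub>perms\<^esub> c i (s - D)" if "k \<le> s" for i s
    using that supp[of "s"] by (simp add: g_def)
  define \<phi> where "\<phi> = skew_action f g"
  have \<phi>: "bij (\<phi> i)" for i unfolding \<phi>_def by (rule skew_action_inverse) (rule g)
  have shift: "(\<phi> i0 [^]\<^bsub>perms\<^esub> (m :: int)) (s, x) = (s + m, x)" for m s x
    unfolding \<phi>_def by (rule skew_action_shift) (simp_all add: i0 g_def)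
  \<comment> \<open>\<open>i0\<close> moves positions without touching fibres; it returns the step
    of \<open>i\<close> to its position, leaving only the fibre map \<open>g i\<close>.\<close>
  define u where "u = (i, True) # syllable i0 (- f i)"
  have u: "u \<in> lists (fst P \<times> UNIV)"
    using nz(1) i0(1) syllable_lists[of i0 "fst P"] by (simp add: u_def del: in_lists_conv_set)
  have uval: "word_value perms \<phi> u (s + f i, x) = (s + f i, g i s x)" for s x
    using perms.word_value_syllable[of \<phi> i0 "- f i"] \<phi>
    by (simp add: u_def shift) (simp add: \<phi>_def skew_action_def)
  \<comment> \<open>Conjugating \<open>u\<close> by the shift through \<open>D\<close> reads the
    second copy instead of the first.\<close>
  define \<alpha> where "\<alpha> b = (if b then u else syllable i0 (- D) @ u @ syllable i0 D)" for b :: bool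
  show ?thesis
  proof (rule contains_nonabelian_free_fibreI)
    show "bij (\<phi> i)" for i by (rule \<phi>)
    show "\<alpha> b \<in> lists (fst P \<times> UNIV)" for b
      using u syllable_lists[OF i0(1)] by (simp add: \<alpha>_def del: in_lists_conv_set)
    show "bij (y b [^]\<^bsub>perms\<^esub> c i q)" for b using y by simp
    have \<phi>': "\<phi> \<in> fst P \<rightarrow> carrier perms" using \<phi> by simp
    have sl: "syllable i0 m \<in> lists (fst P \<times> UNIV)" for m by (rule syllable_lists[OF i0(1)])
    have "D \<ge> k" "q < D" using \<open>L \<ge> 0\<close> q by (auto simp: D_def)
    then show "word_value perms \<phi> (\<alpha> b) (q + f i, x) = (q + f i, (y b [^]\<^bsub>perms\<^esub> c i q) x)" for b x
      using uval[of q] uval[of "q + D"] g1[of q] g2[of "q + D"] q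
        perms.word_value_append[OF \<phi>' sl append_in_lists_conv[THEN iffD2, OF conjI, OF u sl]]
        perms.word_value_append[OF \<phi>' u sl] perms.word_value_syllable[of \<phi> i0] \<phi> shift
      by (auto simp: \<alpha>_def algebra_simps)
    show "word_value perms (\<lambda>b. y b [^]\<^bsub>perms\<^esub> c i q) v \<noteq> \<one>\<^bsub>perms\<^esub>"
      if "reduced v" "v \<noteq> []" for v
      unfolding y_def by (rule letter_action_powers_free) (use that nz in auto)
    fix r assume r: "r \<in> set (snd P)"
    then have rl: "r \<in> lists (fst P \<times> UNIV)" using relators free_group_carrier by blast
    have "cocycle f g r s = id" for s
    \<comment> \<open>The positions a relator reaches lie below \<open>D\<close> in the first case
      and at or above \<open>k\<close> in the second, so only one of the two factors of
      \<open>g\<close> is visible and the weights decide.\<close>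
    proof (cases "s < k + L")
      case True
      have "cocycle f g r s = y True [^]\<^bsub>perms\<^esub> weight f c r s"
        by (rule cocycle_power[OF f rl _ y], assumption, rule g1)
           (use True L[OF r] in \<open>auto simp: D_def\<close>)
      then show ?thesis using rel(2)[OF r] by simp
    next
      case False
      have "cocycle f (\<lambda>i t. g i (t + D)) r (s - D) = y False [^]\<^bsub>perms\<^esub> weight f c r (s - D)"
        by (rule cocycle_power[OF f rl _ y], assumption) (use False L[OF r] g2 in auto)
      moreover have "cocycle f (\<lambda>i t. g i (t + D)) v (s - D) = cocycle f g v s" for v
        by (induction v) (auto simp: algebra_simps)
      ultimately show ?thesis using rel(2)[OF r] by simp
    qed
    then have "word_value perms \<phi> r (s, x) = (s, x)" for s x
      unfolding \<phi>_def using word_value_skew_action[of "fst P" g r f s x] g rl rel(1)[OF r] by simp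
    then show "word_value perms \<phi> r = \<one>\<^bsub>perms\<^esub>" by (simp add: fun_eq_iff)
  qed
qed

text \<open>Gaussian elimination by cross-multiplication instead of division, so that integer
  systems have integer solutions.\<close>

lemma underdetermined_system:
  fixes a :: "'j \<Rightarrow> 'i \<Rightarrow> 'r :: idom"
  assumes "finite J" "finite I" "card J < card I"
  shows "\<exists>m. (\<exists>i\<in>I. m i \<noteq> 0) \<and> (\<forall>j\<in>J. (\<Sum>i\<in>I. a j i * m i) = 0)"
  using assms
proof (induction J arbitrary: I a rule: finite_induct)
  case empty
  then show ?case by (intro exI[of _ "\<lambda>_. 1"]) (simp add: card_gt_0_iff ex_in_conv)
next
  case (insert j0 J)
  show ?case
  proof (cases "\<forall>i\<in>I. a j0 i = 0")
    case True
    have "card J < card I" using insert.hyps insert.prems by simp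
    from insert.IH[OF insert.prems(1) this, of a] show ?thesis using True by auto
  next
    case False
    then obtain i0 where i0: "i0 \<in> I" "a j0 i0 \<noteq> 0" by blast
    have "card J < card (I - {i0})" using insert.hyps insert.prems i0 by simp
    from insert.IH[OF _ this, of "\<lambda>j i. a j0 i0 * a j i - a j i0 * a j0 i"] insert.prems obtain m
      where m: "\<exists>i\<in>I - {i0}. m i \<noteq> 0"
        "\<And>j. j \<in> J \<Longrightarrow> (\<Sum>i\<in>I - {i0}. (a j0 i0 * a j i - a j i0 * a j0 i) * m i) = 0"
      by auto
    \<comment> \<open>All other unknowns are multiplied by the pivot \<open>a j0 i0\<close>; then
      equation \<open>j0\<close> can be solved for the unknown \<open>i0\<close> inside the
      ring.\<close>
    define m' where "m' i = (if i = i0 then - (\<Sum>i\<in>I - {i0}. a j0 i * m i) else a j0 i0 * m i)" for i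
    have sum: "(\<Sum>i\<in>I. a j i * m' i) =
      - a j i0 * (\<Sum>i\<in>I - {i0}. a j0 i * m i) + a j0 i0 * (\<Sum>i\<in>I - {i0}. a j i * m i)" for j
    proof -
      have "(\<Sum>i\<in>I - {i0}. a j i * m' i) = a j0 i0 * (\<Sum>i\<in>I - {i0}. a j i * m i)"
        unfolding sum_distrib_left by (rule sum.cong) (auto simp: m'_def)
      then show ?thesis
        using i0 insert.prems by (simp add: sum.remove[of I i0 "\<lambda>i. a j i * m' i"]) (simp add: m'_def)
    qed
    have "(\<Sum>i\<in>I. a j i * m' i) = 0" if "j \<in> insert j0 J" for j
    proof (cases "j = j0")
      case False
      then have "0 = (\<Sum>i\<in>I - {i0}. (a j0 i0 * a j i - a j i0 * a j0 i) * m i)" using m that by simp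
      also have "\<dots> = (\<Sum>i\<in>I. a j i * m' i)"
        unfolding sum by (simp add: left_diff_distrib sum_subtractf sum_distrib_left mult.assoc sum_negf)
      finally show ?thesis by simp
    next
      case True
      then show ?thesis using sum[of j0] by simp
    qed
    moreover have "\<exists>i\<in>I. m' i \<noteq> 0" using m(1) i0 by (auto simp: m'_def)
    ultimately show ?thesis by blast
  qed
qed

lemma weight_sum:
  "weight f (\<lambda>i p. \<Sum>k\<in>I. m k * c k i p) w s = (\<Sum>k\<in>I. m k * weight f (c k) w s)"
proof (induction w)
  case (Cons a w)
  show ?case
    unfolding weight.simps Cons.IH distrib_left sum.distrib by (simp add: sum_negf)
qed simp

lemma weight_zero:
  assumes f: "\<And>i. i \<in> S \<Longrightarrow> \<bar>f i\<bar> \<le> 1" and w: "w \<in> lists (S \<times> UNIV)"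
    and c: "\<And>i p. i \<in> S \<Longrightarrow> \<bar>p - s\<bar> \<le> int (length w) \<Longrightarrow> c i p = 0"
  shows "weight f c w s = 0"
  using w c
proof (induction w)
  case (Cons a w)
  have a: "fst a \<in> S" using Cons.hyps by (auto simp: mem_Times_iff)
  have "weight f c w s = 0" by (rule Cons.IH) (use Cons.prems in auto)
  moreover have h: "\<bar>height f w\<bar> \<le> int (length w)" by (rule height_bound[OF f Cons.hyps(2)])
  then have "c (fst a) (s + height f w) = 0" by (intro Cons.prems a) simp
  moreover have "c (fst a) (s + height f w - f (fst a)) = 0"
    by (intro Cons.prems a) (use h f[OF a] in simp)
  ultimately show ?case by simp
qed simp

section \<open>Symmetric relators and the case of at least three generators\<close>

lemma cyclic_permutation_refl [simp]: "cyclic_permutation w w"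
  by (auto simp: cyclic_permutation_def intro: exI[of _ 0])

lemma cyclic_permutation_append [simp]: "cyclic_permutation (u @ v) (v @ u)"
  unfolding cyclic_permutation_def by (intro exI[of _ "length v"]) (simp add: rotate_append)

lemma cyclic_permutation_cases:
  assumes "cyclic_permutation u v"
  obtains a b where "u = a @ b" "v = b @ a"
  using assms that unfolding cyclic_permutation_def by (metis append_take_drop_id rotate_drop_take)

lemma cyclic_permutation_sym: "cyclic_permutation u v \<Longrightarrow> cyclic_permutation v u"
  by (erule cyclic_permutation_cases) simp

lemma cyclic_permutation_trans:
  "cyclic_permutation u v \<Longrightarrow> cyclic_permutation v w \<Longrightarrow> cyclic_permutation u w"
  by (auto simp: cyclic_permutation_def rotate_rotate)

lemma cyclic_permutation_map: "cyclic_permutation u v \<Longrightarrow> cyclic_permutation (map f u) (map f v)"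
  by (auto simp: cyclic_permutation_def rotate_map)

lemma cyclic_permutation_set: "cyclic_permutation u v \<Longrightarrow> set u = set v"
  by (auto simp: cyclic_permutation_def)

lemma theta_funpow_eq_map: "(theta n ^^ k) w = map ((\<lambda>(i, e). ((i + 1) mod n, e)) ^^ k) w"
  by (induction k) (simp_all add: theta_def)

lemma theta_funpow:
  assumes "w \<in> lists ({..<n} \<times> UNIV)"
  shows "(theta n ^^ k) w = map (\<lambda>(i, e). ((i + k) mod n, e)) w"
proof (induction k)
  case 0
  show ?case by (rule sym, simp, rule map_idI) (use assms in fastforce)
next
  case (Suc k)
  then show ?case by (auto simp: theta_def mod_Suc_eq)
qed

lemma theta_funpow_lists:
  assumes "w \<in> lists ({..<n} \<times> UNIV)"
  shows "(theta n ^^ k) w \<in> lists ({..<n} \<times> UNIV)"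
  unfolding theta_funpow[OF assms] using assms by fastforce

lemma theta_funpow_mod:
  "w \<in> lists ({..<n} \<times> UNIV) \<Longrightarrow> (theta n ^^ (k mod n)) w = (theta n ^^ k) w"
  by (simp add: theta_funpow mod_add_right_eq)

lemma cyclic_permutation_theta:
  "cyclic_permutation u v \<Longrightarrow> cyclic_permutation ((theta n ^^ k) u) ((theta n ^^ k) v)"
  unfolding theta_funpow_eq_map by (rule cyclic_permutation_map)

lemma inv_word_theta: "inv_word ((theta n ^^ k) w) = (theta n ^^ k) (inv_word w)"
proof (induction k)
  case (Suc k)
  have "inv_word (theta n v) = theta n (inv_word v)" for v
    by (auto simp: inv_word_def theta_def rev_map inv_letter_def)
  then show ?case using Suc by simp
qed simp

text \<open>Adding k modulo n is injective on the indices below n, so a shift creates no cancelling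
  pair.\<close>

lemma reduced_theta:
  assumes "w \<in> lists ({..<n} \<times> UNIV)" "reduced w"
  shows "reduced ((theta n ^^ k) w)"
  unfolding theta_funpow[OF assms(1)] reduced_def successively_map
proof (rule successively_mono)
  show "successively (\<lambda>a b. b \<noteq> inv_letter a) w" using assms by (simp add: reduced_def)
  fix a b assume ab: "a \<in> set w" "b \<in> set w" "b \<noteq> inv_letter a"
  have "fst a < n" "fst b < n" using ab assms(1) by (auto simp: mem_Times_iff)
  moreover have "x = y" if "(x + k) mod n = (y + k) mod n" "x < n" "y < n" for x y
    using that
  proof (induction x y rule: linorder_wlog)
    case (le x y)
    then have "n dvd (y + k) - (x + k)" by (metis add_le_mono1 mod_eq_dvd_iff_nat)
    then show ?case using le by (auto dest: dvd_imp_le)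
  qed simp
  ultimately have "(fst b + k) mod n = (fst a + k) mod n \<Longrightarrow> fst b = fst a" by blast
  then show "(case b of (i, e) \<Rightarrow> ((i + k) mod n, e)) \<noteq> inv_letter (case a of (i, e) \<Rightarrow> ((i + k) mod n, e))"
    using ab(3) by (auto simp: inv_letter_def prod_eq_iff case_prod_unfold)
qed

locale redundant_cyclic_presentation =
  fixes n :: nat and w :: "nat word"
  assumes w_carrier: "w \<in> carrier (free_group {..<n})"
    and w_nonempty: "w \<noteq> []"
    and orientable: "orientable n w"
    and redundant: "redundant (cyclic_presentation n w)"
begin

lemma w_lists: "w \<in> lists ({..<n} \<times> UNIV)"
  and w_reduced: "reduced w"
  using w_carrier by (simp_all add: free_group_carrier)

sublocale presentation "cyclic_presentation n w"
proof
  show "set (snd (cyclic_presentation n w)) \<subseteq> carrier (free_group (fst (cyclic_presentation n w)))"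
    using theta_funpow_lists[OF w_lists] reduced_theta[OF w_lists w_reduced]
    by (auto simp: cyclic_presentation_def free_group_carrier simp del: in_lists_conv_set)
qed

lemma generators: "fst (cyclic_presentation n w) = {..<n}"
  and relators_iff: "r \<in> set (snd (cyclic_presentation n w)) \<longleftrightarrow> (\<exists>j<n. r = (theta n ^^ j) w)"
  by (auto simp: cyclic_presentation_def)

text \<open>The shifts that preserve \<open>w\<close> up to cyclic permutation are closed under
  addition of exponents modulo n. Redundancy supplies a nonzero exponent \<open>e\<close>, and then
  gcd(e, n), a proper divisor of n, is one as well.\<close>

lemma symmetry_exponent:
  obtains d where "0 < d" "d < n" "d dvd n" "cyclic_permutation w ((theta n ^^ d) w)"
proof -
  have nth: "snd (cyclic_presentation n w) ! j = (theta n ^^ j) w" if "j < n" for j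
    using that by (simp add: cyclic_presentation_def)
  have len: "length (snd (cyclic_presentation n w)) = n"
    by (simp add: cyclic_presentation_def)
  have red: "free_reduction ((theta n ^^ i) w) \<noteq> []" for i
    using free_reduction_reduced[OF reduced_theta[OF w_lists w_reduced]] w_nonempty
    by (simp add: theta_funpow_eq_map)
  have shift: "(theta n ^^ (n - i)) ((theta n ^^ j) w) = (theta n ^^ ((n - i + j) mod n)) w" for i j
    unfolding theta_funpow_mod[OF w_lists] by (simp add: funpow_add)
  have shift0: "(theta n ^^ (n - i)) ((theta n ^^ i) w) = w" if "i < n" for i
    using shift[of i i] that by simp
  obtain i j where ij: "i < n" "j < n" "j \<noteq> i"
    "cyclic_permutation ((theta n ^^ i) w) ((theta n ^^ j) w) \<or>
     cyclic_permutation ((theta n ^^ i) w) (inv_word ((theta n ^^ j) w))"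
    using redundant red by (auto simp: redundant_def len nth)
  \<comment> \<open>This is j - i modulo n, arranged to avoid truncated subtraction.\<close>
  define e where "e = (n - i + j) mod n"
  have "e < n" using ij by (simp add: e_def)
  have shift_e: "(theta n ^^ (n - i)) ((theta n ^^ j) w) = (theta n ^^ e) w"
    unfolding e_def by (rule shift)
  \<comment> \<open>Shifting both relators so that the first becomes \<open>w\<close> gives exactly
    the situation that orientability forbids.\<close>
  have "\<not> cyclic_permutation ((theta n ^^ i) w) (inv_word ((theta n ^^ j) w))"
  proof
    assume "cyclic_permutation ((theta n ^^ i) w) (inv_word ((theta n ^^ j) w))"
    from cyclic_permutation_theta[OF this, where n = n and k = "n - i"]
    have "cyclic_permutation w (inv_word ((theta n ^^ e) w))"
      unfolding shift0[OF ij(1)] inv_word_theta[symmetric] shift_e .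
    then show False using orientable \<open>e < n\<close> by (auto simp: orientable_def)
  qed
  then have "cyclic_permutation ((theta n ^^ i) w) ((theta n ^^ j) w)"
    using ij(4) by blast
  from cyclic_permutation_theta[OF this, where n = n and k = "n - i"]
  have e: "cyclic_permutation w ((theta n ^^ e) w)"
    unfolding shift0[OF ij(1)] shift_e .
  have "e \<noteq> 0"
  proof (cases "j < i")
    case True
    then show ?thesis using ij by (simp add: e_def)
  next
    case False
    then have "n - i + j = (j - i) + n" using ij by simp
    then have "e = (j - i + n) mod n" by (simp only: e_def)
    then have "e = j - i" using ij by simp
    then show ?thesis using ij False by simp
  qed
  have iter: "cyclic_permutation w ((theta n ^^ (e * k)) w)" for k
  proof (induction k)
    case (Suc k)
    then have "cyclic_permutation ((theta n ^^ e) w) ((theta n ^^ e) ((theta n ^^ (e * k)) w))"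
      by (rule cyclic_permutation_theta)
    from cyclic_permutation_trans[OF e this] show ?case by (simp add: funpow_add)
  qed simp
  \<comment> \<open>The multiple of n is invisible to the shift, so the x-th multiple of
    \<open>e\<close> acts as the gcd.\<close>
  obtain x y where xy: "e * x = n * y + gcd e n"
    using bezout_nat[OF \<open>e \<noteq> 0\<close>] by blast
  have "(theta n ^^ (e * x)) w = (theta n ^^ gcd e n) w"
    using theta_funpow_mod[OF w_lists, of "e * x"] theta_funpow_mod[OF w_lists, of "gcd e n"]
    unfolding xy by simp
  then have "cyclic_permutation w ((theta n ^^ gcd e n) w)" using iter[of x] by simp
  moreover have "0 < gcd e n" "gcd e n < n"
    using \<open>e \<noteq> 0\<close> le_less_trans[OF gcd_le1_nat[OF \<open>e \<noteq> 0\<close>] \<open>e < n\<close>] by simp_all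
  ultimately show ?thesis using that[of "gcd e n"] by simp
qed

end

section \<open>Heights and weights under cyclic permutation\<close>

lemma height_append: "height f (u @ v) = height f u + height f v"
  by (induction u) auto

lemma weight_append: "weight f c (u @ v) s = weight f c u (s + height f v) + weight f c v s"
  by (induction u) (auto simp: height_append algebra_simps)

lemma height_cyclic_permutation: "cyclic_permutation u v \<Longrightarrow> height f u = height f v"
  by (erule cyclic_permutation_cases) (simp add: height_append)

lemma weight_cyclic_permutation:
  assumes "cyclic_permutation u v" "height f v = 0" "\<And>s. weight f c v s = 0"
  shows "weight f c u s = 0"
proof -
  obtain a b where ab: "u = a @ b" "v = b @ a"
    using assms(1) by (rule cyclic_permutation_cases)
  have "height f a + height f b = 0" using assms(2) ab by (simp add: height_append)
  then show ?thesis
    using assms(3)[of "s + height f b"] ab by (simp add: weight_append add.commute add.left_commute)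
qed

lemma height_map: "height f (map (\<lambda>(i, e). (g i, e)) w) = height (f \<circ> g) w"
  by (induction w) (auto split: prod.splits)

lemma height_diff: "height (\<lambda>i. f i - g i) w = height f w - height g w"
  by (induction w) auto

lemma height_cong:
  "w \<in> lists (S \<times> UNIV) \<Longrightarrow> (\<And>i. i \<in> S \<Longrightarrow> f i = g i) \<Longrightarrow> height f w = height g w"
  by (induction w) auto

context redundant_cyclic_presentation
begin

lemma contains_nonabelian_free_of_ge_3:
  assumes "3 \<le> n"
  shows "contains_nonabelian_free_subgroup (presented_group (cyclic_presentation n w))"
proof -
  obtain d where d: "0 < d" "d < n" "d dvd n" "cyclic_permutation w ((theta n ^^ d) w)"
    by (rule symmetry_exponent)
  \<comment> \<open>If n = d + 1, then d divides 1, so n = 2.\<close>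
  have "d + 1 < n"
  proof (rule ccontr)
    assume "\<not> d + 1 < n"
    then have "n = d + 1" using d by simp
    then have "d dvd 1" using d(3) by (metis dvd_add_right_iff dvd_refl)
    then show False using assms \<open>n = d + 1\<close> by simp
  qed
  have lists: "(theta n ^^ j) w \<in> lists ({..<n} \<times> UNIV)" for j
    by (rule theta_funpow_lists[OF w_lists])
  define f :: "nat \<Rightarrow> int" where "f i = (if i = 0 then 1 else 0) - (if i = d then 1 else 0)" for i
  have f1: "\<bar>f i\<bar> \<le> 1" for i by (simp add: f_def)
  \<comment> \<open>The shift by \<open>d\<close> turns x_0, and no other generator, into x_d;
    cyclic symmetry then equates the two exponent sums.\<close>
  have height: "height f ((theta n ^^ j) w) = 0" for j
  proof -
    define v where "v = (theta n ^^ j) w"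
    have v: "v \<in> lists ({..<n} \<times> UNIV)" unfolding v_def by (rule lists)
    define \<delta> :: "nat \<Rightarrow> int" where "\<delta> i = (if i = d then 1 else 0)" for i
    have "(theta n ^^ d) v = (theta n ^^ j) ((theta n ^^ d) w)"
      unfolding v_def by (metis add.commute comp_apply funpow_add)
    then have "cyclic_permutation v ((theta n ^^ d) v)"
      using cyclic_permutation_theta[OF d(4)] by (simp add: v_def)
    then have "height \<delta> v = height \<delta> ((theta n ^^ d) v)" by (rule height_cyclic_permutation)
    also have "\<dots> = height (\<delta> \<circ> (\<lambda>i. (i + d) mod n)) v"
      unfolding theta_funpow[OF v] by (rule height_map)
    also have "\<dots> = height (\<lambda>i. if i = 0 then 1 else 0) v"
    proof (rule height_cong[OF v])
      fix i assume "i \<in> {..<n}"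
      then have "(i + d) mod n = d \<longleftrightarrow> i = 0"
        using d(1,2) by (cases "i + d < n") (auto simp: mod_if)
      then show "(\<delta> \<circ> (\<lambda>i. (i + d) mod n)) i = (if i = 0 then 1 else 0)" by (simp add: \<delta>_def)
    qed
    finally show ?thesis unfolding f_def v_def[symmetric] height_diff \<delta>_def by simp
  qed
  \<comment> \<open>Relators started outside [-L, k + L) never meet the support [0, k), so d (k + 2
    L) equations suffice. The value of \<open>k\<close> is the solution of d (k + 2 L) = (d + 1) k -
    1, one less than the number of unknowns for d + 1 generators.\<close>
  define L where "L = int (length w) + 1"
  define k where "k = 2 * int d * L + 1"
  have kL: "0 < k" "0 < L" using d by (auto simp: k_def L_def)
  \<comment> \<open>Generator 0 gets no unknowns because it has to act as the pure shift.\<close>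
  define I where "I = {1..<n} \<times> {0..<k}"
  define J where "J = {..<d} \<times> {- L..<k + L}"
  define e :: "nat \<times> int \<Rightarrow> nat \<Rightarrow> int \<Rightarrow> int" where "e \<kappa> i p = (if \<kappa> = (i, p) then 1 else 0)" for \<kappa> i p
  define a where "a j \<kappa> = weight f (e \<kappa>) ((theta n ^^ fst j) w) (snd j)" for j \<kappa>
  have "int (card J) = int d * (k + 2 * L)" using kL by (simp add: J_def)
  also have "\<dots> = (int d + 1) * k - 1" by (simp add: k_def algebra_simps)
  also have "\<dots> < (int n - 1) * k"
  proof -
    have "(int d + 1) * k \<le> (int n - 1) * k"
      by (rule mult_right_mono) (use \<open>d + 1 < n\<close> kL in auto)
    then show ?thesis by simp
  qed
  also have "\<dots> = int (card I)" using kL d by (simp add: I_def of_nat_diff)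
  finally have "card J < card I" by simp
  moreover have "finite I" "finite J" by (simp_all add: I_def J_def)
  ultimately obtain m where m: "\<exists>\<kappa>\<in>I. m \<kappa> \<noteq> 0" "\<forall>j\<in>J. (\<Sum>\<kappa>\<in>I. a j \<kappa> * m \<kappa>) = 0"
    using underdetermined_system[of J I a] by auto
  define c where "c i p = (\<Sum>\<kappa>\<in>I. m \<kappa> * e \<kappa> i p)" for i p
  have c: "c i p = (if (i, p) \<in> I then m (i, p) else 0)" for i p
    using \<open>finite I\<close> by (simp add: c_def e_def if_distrib sum.delta cong: if_cong)
  have weight_base: "weight f c ((theta n ^^ j) w) s = 0" if "j < d" for j s
  proof (cases "- L \<le> s \<and> s < k + L")
    case True
    then have "(j, s) \<in> J" using that by (simp add: J_def)
    then have "(\<Sum>\<kappa>\<in>I. a (j, s) \<kappa> * m \<kappa>) = 0" using m by blast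
    then show ?thesis
      unfolding c_def[abs_def] weight_sum by (simp add: a_def mult.commute)
  next
    case False
    show ?thesis
    proof (rule weight_zero[OF f1 lists])
      fix i p assume "\<bar>p - s\<bar> \<le> int (length ((theta n ^^ j) w))"
      then have "(i, p) \<notin> I" using False by (auto simp: I_def L_def theta_funpow_eq_map)
      then show "c i p = 0" by (simp add: c)
    qed
  qed
  \<comment> \<open>Relator j is a rotation of relator j - d, so the first d relators control all of
    them.\<close>
  have weight: "weight f c ((theta n ^^ j) w) s = 0" for j s
  proof (induction j arbitrary: s rule: less_induct)
    case (less j)
    show ?case
    proof (cases "j < d")
      case False
      have "cyclic_permutation ((theta n ^^ (j - d)) w) ((theta n ^^ (j - d)) ((theta n ^^ d) w))"
        by (rule cyclic_permutation_theta[OF d(4)])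
      also have "(theta n ^^ (j - d)) ((theta n ^^ d) w) = (theta n ^^ j) w"
        using False by (simp flip: funpow_add comp_apply[of "theta n ^^ (j - d)"])
      finally show ?thesis
        using weight_cyclic_permutation[OF cyclic_permutation_sym height less] False d(1) by simp
    qed (rule weight_base)
  qed
  obtain i q where iq: "(i, q) \<in> I" "m (i, q) \<noteq> 0" using m(1) by auto
  show ?thesis
  proof (rule contains_nonabelian_free_weightI[of f 0 c k i q])
    show "c i s = 0" if "s < 0 \<or> k \<le> s" for i s
      using that by (auto simp: c I_def)
    show "c i q \<noteq> 0" using iq by (simp add: c)
    show "i \<in> fst (cyclic_presentation n w)" using iq by (simp add: generators I_def)
    show "f 0 = 1" using d by (simp add: f_def)
    show "c 0 s = 0" for s by (simp add: c I_def)
    show "0 \<in> fst (cyclic_presentation n w)" using assms by (simp add: generators)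
    show "height f r = 0" "weight f c r s = 0" if "r \<in> set (snd (cyclic_presentation n w))" for r s
      using that height weight unfolding relators_iff by blast+
  qed (rule f1)
qed

end

section \<open>Two generators: decomposition of the relator\<close>

fun alternating :: "nat \<Rightarrow> int list \<Rightarrow> nat word" where
  "alternating i [] = []"
| "alternating i (a # as) = syllable i a @ alternating (1 - i) as"

lemma syllable_Suc:
  "(i, 0 < b) # syllable i b = syllable i (if 0 < b then b + 1 else b - 1)" if "b \<noteq> 0"
proof -
  have "nat \<bar>if 0 < b then b + 1 else b - 1\<bar> = Suc (nat \<bar>b\<bar>)"
    "(0 < (if 0 < b then b + 1 else b - 1)) = (0 < b)"
    using that by auto
  then show ?thesis unfolding syllable_def by simp
qed

lemma syllable_one: "syllable i (if e then 1 else - 1) = [(i, e)]"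
  by (simp add: syllable_def)

text \<open>Syllables are split off from the left. The parity clause records on which generator the
  word ends, since the generators alternate.\<close>

lemma alternating_decomposition:
  assumes "reduced u" "u \<noteq> []" "u \<in> lists ({..<2} \<times> UNIV)" "fst (hd u) = i"
  shows "\<exists>as. u = alternating i as \<and> as \<noteq> [] \<and> 0 \<notin> set as \<and> (odd (length as) \<longleftrightarrow> fst (last u) = i)"
  using assms
proof (induction u arbitrary: i)
  case (Cons l v)
  obtain e where l: "l = (i, e)" using Cons.prems by (cases l) auto
  have i: "i < 2" using Cons.prems(3) l by auto
  have one: "(if e then 1 else - 1 :: int) \<noteq> 0" by simp
  show ?case
  proof (cases "v = []")
    case True
    have "l # v = alternating i [if e then 1 else - 1]"
      by (simp only: alternating.simps syllable_one True l append.simps)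
    then show ?thesis using True l one
      by (intro exI[of _ "[if e then 1 else - 1]"]) (simp add: syllable_def)
  next
    case False
    have v: "reduced v" "v \<in> lists ({..<2} \<times> UNIV)" "hd v \<noteq> inv_letter l"
      using Cons.prems False by (simp_all add: reduced_Cons)
    obtain as where as: "v = alternating (fst (hd v)) as" "as \<noteq> []" "0 \<notin> set as"
      "odd (length as) \<longleftrightarrow> fst (last v) = fst (hd v)"
      using Cons.IH[OF v(1) False v(2) refl] by blast
    have hv: "fst (hd v) < 2" "fst (last v) < 2"
      using v(2) hd_in_set[OF False] last_in_set[OF False] by (auto simp: mem_Times_iff)
    show ?thesis
    proof (cases "fst (hd v) = i")
      \<comment> \<open>The new letter joins the first syllable; as the word is reduced, their signs
        agree and the syllable grows.\<close>
      case True
      obtain b bs where b: "as = b # bs" using as(2) by (cases as) auto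
      then have "b \<noteq> 0" using as(3) by auto
      then have "syllable i b \<noteq> [] \<and> hd (syllable i b) = (i, 0 < b)"
        by (simp add: syllable_def)
      then have "hd v = (i, 0 < b)" using as(1) b True by simp
      then have "e = (0 < b)" using v(3) l by (auto simp: inv_letter_def)
      define b' where "b' = (if 0 < b then b + 1 else b - 1)"
      have "l # v = alternating i (b' # bs)"
        using as(1) True unfolding b l \<open>e = (0 < b)\<close> b'_def
        by (simp flip: syllable_Suc[OF \<open>b \<noteq> 0\<close>])
      moreover have "b' \<noteq> 0" using \<open>b \<noteq> 0\<close> by (auto simp: b'_def)
      ultimately show ?thesis
        using as True False b by (intro exI[of _ "b' # bs"]) auto
    next
      case F: False
      then have "fst (hd v) = 1 - i" using hv i by auto
      then have "l # v = alternating i ((if e then 1 else - 1) # as)"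
        using as(1) by (simp only: alternating.simps syllable_one l append.simps)
      moreover have "fst (last (l # v)) = i \<longleftrightarrow> fst (last v) \<noteq> fst (hd v)"
        using False F hv i by auto
      ultimately show ?thesis
        using as one by (intro exI[of _ "(if e then 1 else - 1) # as"]) auto
    qed
  qed
qed simp

lemma cyclically_reduced_permutation:
  assumes "cyclic_permutation u v" "cyclically_reduced v"
  shows "reduced u"
proof -
  obtain a b where ab: "u = a @ b" "v = b @ a"
    using assms(1) by (rule cyclic_permutation_cases)
  show ?thesis
  proof (cases "a = [] \<or> b = []")
    case True
    then show ?thesis using assms(2) ab by (auto simp: cyclically_reduced_def)
  next
    case False
    then have "last a \<noteq> inv_letter (hd b)"
      using assms(2) ab by (simp add: cyclically_reduced_def)
    then have "hd b \<noteq> inv_letter (last a)" by auto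
    then show ?thesis
      using assms(2) False
      by (auto simp: ab cyclically_reduced_def reduced_def successively_append_iff)
  qed
qed

section \<open>Rotations, blocks and the half turn\<close>

lemma concat_blocks:
  "length v = M * g \<Longrightarrow> concat (map (\<lambda>j. take g (drop (j * g) v)) [0..<M]) = v"
proof (induction M arbitrary: v)
  case (Suc M)
  have "take g (drop (j * g) (take (M * g) v)) = take g (drop (j * g) v)" if "j < M" for j
  proof -
    have "g \<le> M * g - j * g"
      using that by (metis Suc_leI diff_mult_distrib mult_le_mono1 nat_mult_1 zero_less_diff One_nat_def)
    then show ?thesis by (simp add: drop_take min_def)
  qed
  then have "concat (map (\<lambda>j. take g (drop (j * g) v)) [0..<M])
      = concat (map (\<lambda>j. take g (drop (j * g) (take (M * g) v))) [0..<M])"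
    by (intro arg_cong[of _ _ concat] map_cong) auto
  also have "\<dots> = take (M * g) v" by (rule Suc.IH) (use Suc.prems in simp)
  finally show ?case using Suc.prems by simp
qed simp

text \<open>Rotate so that \<open>y\<close> comes first, then move the whole initial run of letters
  violating \<open>p\<close> to the end.\<close>

lemma rotation_boundary:
  assumes "x \<in> set w" "p x" "y \<in> set w" "\<not> p y"
  obtains v where "cyclic_permutation w v" "v \<noteq> []" "p (hd v)" "\<not> p (last v)"
proof -
  obtain a b where ab: "w = a @ y # b" using split_list[OF assms(3)] by blast
  define z where "z = (y # b) @ a"
  have z: "cyclic_permutation w z" unfolding ab z_def by (rule cyclic_permutation_append)
  define t where "t = takeWhile (\<lambda>x. \<not> p x) z"
  define r where "r = dropWhile (\<lambda>x. \<not> p x) z"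
  have "z = t @ r" by (simp add: t_def r_def)
  have "t \<noteq> []" using assms(4) by (simp add: t_def z_def)
  then have "\<not> p (last t)" using last_in_set[of t] set_takeWhileD[of "last t"] unfolding t_def by blast
  have "r \<noteq> []" using assms(1,2) cyclic_permutation_set[OF z] by (auto simp: r_def dropWhile_eq_Nil_conv)
  then have "p (hd r)" using hd_dropWhile[of "\<lambda>x. \<not> p x" z] by (simp add: r_def)
  have "cyclic_permutation w (r @ t)"
    using z \<open>z = t @ r\<close> cyclic_permutation_append cyclic_permutation_trans by metis
  then show ?thesis
    using that[of "r @ t"] \<open>t \<noteq> []\<close> \<open>r \<noteq> []\<close> \<open>p (hd r)\<close> \<open>\<not> p (last t)\<close> by simp
qed

lemma theta_two_funpow:
  assumes "w \<in> lists ({..<2} \<times> UNIV)"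
  shows "(theta 2 ^^ k) w = (if even k then w else theta 2 w)"
  using theta_funpow_mod[OF assms, of k] by (cases "even k") (auto simp: even_iff_mod_2_eq_zero odd_iff_mod_2_eq_one)

text \<open>The rotations taking \<open>v\<close> to itself or to its shift are the multiples of the
  least positive one, g. The shift moves the first letter to the other generator, so it differs from
  \<open>v\<close>; hence g itself realises the shift, and the full turn, which fixes
  \<open>v\<close>, is an even multiple of g.\<close>

lemma half_rotation:
  assumes v: "v \<in> lists ({..<2} \<times> UNIV)" "v \<noteq> []" "cyclic_permutation v (theta 2 v)"
  obtains g M where "even M" "0 < M" "0 < g" "length v = M * g" "rotate g v = theta 2 v"
proof -
  have tt: "theta 2 (theta 2 v) = v"
    using theta_two_funpow[OF v(1), of 2] by (simp add: numeral_2_eq_2)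
  have ne: "theta 2 v \<noteq> v"
  proof
    assume "theta 2 v = v"
    then have "hd (theta 2 v) = hd v" by simp
    moreover have "fst (hd (theta 2 v)) = (fst (hd v) + 1) mod 2"
      using v(2) by (simp add: theta_def hd_map case_prod_unfold)
    moreover have "fst (hd v) < 2" using v(1) hd_in_set[OF v(2)] by (auto simp: mem_Times_iff)
    ultimately show False by presburger
  qed
  have rot_theta: "rotate k (theta 2 u) = theta 2 (rotate k u)" for k u
    by (simp add: theta_def rotate_map)
  define K where "K k \<longleftrightarrow> rotate k v = v \<or> rotate k v = theta 2 v" for k
  obtain r where r: "rotate r v = theta 2 v"
    using cyclic_permutation_sym[OF v(3)] by (auto simp: cyclic_permutation_def)
  have K_length: "0 < length v \<and> K (length v)" using v(2) by (simp add: K_def)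
  define g where "g = (LEAST k. 0 < k \<and> K k)"
  have g: "0 < g" "K g" "\<And>k. 0 < k \<Longrightarrow> K k \<Longrightarrow> g \<le> k"
    using LeastI[of "\<lambda>k. 0 < k \<and> K k", OF K_length] Least_le[of "\<lambda>k. 0 < k \<and> K k"]
    by (simp_all add: g_def)
  have rg: "rotate (q * g) v = (if even q \<or> rotate g v = v then v else theta 2 v)" for q
  proof (induction q)
    case (Suc q)
    have "rotate (Suc q * g) v = rotate g (rotate (q * g) v)" by (simp add: rotate_rotate)
    then show ?case using Suc g(2) tt by (auto simp: K_def rot_theta)
  qed simp
  have dvd: "g dvd k" if "K k" for k
  proof -
    have "rotate k v = rotate (k mod g) (rotate (k div g * g) v)"
      by (simp add: rotate_rotate)
    then have "rotate k v = rotate (k mod g) v \<or> rotate k v = theta 2 (rotate (k mod g) v)"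
      unfolding rg by (auto simp: rot_theta)
    moreover have "theta 2 (theta 2 (rotate (k mod g) v)) = rotate (k mod g) v"
      using tt by (metis rot_theta)
    ultimately have "K (k mod g)" using that tt unfolding K_def by metis
    then show ?thesis using g(1) g(3)[of "k mod g"] by (metis dvd_eq_mod_eq_0 mod_less_divisor not_le neq0_conv)
  qed
  have "K r" using r by (simp add: K_def)
  then obtain q where "r = q * g" using dvd by (metis dvd_def mult.commute)
  then have gr: "rotate g v = theta 2 v" using rg[of q] r ne g(2) by (auto simp: K_def)
  obtain M where M: "length v = M * g"
    using dvd[of "length v"] K_length by (metis dvd_def mult.commute)
  have "rotate (M * g) v = v" by (simp flip: M)
  then have "even M" using rg[of M] gr ne by (auto split: if_splits)
  moreover have "0 < M" using M v(2) by (cases M) auto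
  ultimately show ?thesis using that M gr g(1) by blast
qed

context redundant_cyclic_presentation
begin

text \<open>If rotation by g equals the shift, then the consecutive blocks of length g are the
  successive shifts of the first one.\<close>

lemma half_turn_decomposition:
  assumes "n = 2" "cyclically_reduced w"
  obtains as M where "0 \<notin> set as" "odd (length as)" "even M" "0 < M"
    "cyclic_permutation w (concat (map (\<lambda>j. (theta 2 ^^ j) (alternating 0 as)) [0..<M]))"
proof -
  obtain d where "0 < d" "d < n" "cyclic_permutation w ((theta n ^^ d) w)"
    by (rule symmetry_exponent)
  moreover then have "d = 1" using assms by simp
  ultimately have sym: "cyclic_permutation w (theta 2 w)" using assms by simp
  have wl: "w \<in> lists ({..<2} \<times> UNIV)" using w_lists assms by simp
  obtain i e where ie: "(i, e) \<in> set w" "i < 2"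
    using hd_in_set[OF w_nonempty] wl
    by (metis SigmaE in_lists_conv_set lessThan_iff)
  then have "((i + 1) mod 2, e) \<in> set (theta 2 w)" by (force simp: theta_def)
  then have "((i + 1) mod 2, e) \<in> set w" using cyclic_permutation_set[OF sym] by simp
  then have "(0, e) \<in> set w" "(1, e) \<in> set w" using ie by (auto simp: less_2_cases_iff)
  \<comment> \<open>Starting with x_0 and ending with x_1 makes the block boundaries fall between
    syllables.\<close>
  then obtain v where v: "cyclic_permutation w v" "v \<noteq> []" "fst (hd v) = 0" "fst (last v) \<noteq> 0"
    using rotation_boundary[of "(0, e)" w "\<lambda>l. fst l = 0" "(1, e)"] by force
  have vl: "v \<in> lists ({..<2} \<times> UNIV)"
    using cyclic_permutation_set[OF v(1)] wl by (simp add: lists_eq_set)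
  have "cyclic_permutation v (theta 2 v)"
    using cyclic_permutation_map[OF v(1), of "\<lambda>(i, e). ((i + 1) mod 2, e)"] sym v(1)
    unfolding theta_def by (blast intro: cyclic_permutation_sym cyclic_permutation_trans)
  then obtain g M where gM: "even M" "0 < M" "0 < g" "length v = M * g" "rotate g v = theta 2 v"
    using half_rotation[OF vl v(2)] by blast
  define u where "u = take g v"
  have rot: "rotate (j * g) v = (theta 2 ^^ j) v" for j
  proof (induction j)
    case (Suc j)
    have "rotate (Suc j * g) v = rotate g (rotate (j * g) v)" by (simp add: rotate_rotate)
    also have "\<dots> = (theta 2 ^^ j) (rotate g v)" by (simp add: Suc theta_funpow_eq_map rotate_map)
    finally show ?case using gM(5) by (simp add: funpow_swap1)
  qed simp
  have block: "(theta 2 ^^ j) u = take g (drop (j * g) v)" if "j < M" for j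
  proof -
    have jM: "j * g + g \<le> M * g" using that by (metis Suc_leI add.commute mult_Suc mult_le_mono1)
    have "j * g < length v" using jM gM by linarith
    then have "rotate (j * g) v = drop (j * g) v @ take (j * g) v" by (simp add: rotate_drop_take)
    moreover have "(theta 2 ^^ j) u = take g ((theta 2 ^^ j) v)"
      by (simp add: u_def theta_funpow_eq_map take_map)
    ultimately show ?thesis using jM gM by (simp add: rot[symmetric])
  qed
  have "v = concat (map (\<lambda>j. take g (drop (j * g) v)) [0..<M])"
    by (rule concat_blocks[OF gM(4), symmetric])
  also have "map (\<lambda>j. take g (drop (j * g) v)) [0..<M] = map (\<lambda>j. (theta 2 ^^ j) u) [0..<M]"
    by (rule map_cong) (simp_all add: block)
  finally have v_eq: "v = concat (map (\<lambda>j. (theta 2 ^^ j) u) [0..<M])" .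
  have "g \<le> length v" using gM by simp
  then have "u \<noteq> []" "fst (hd u) = 0" using gM(3) v(2,3) by (auto simp: u_def)
  have "reduced v" using cyclically_reduced_permutation[OF cyclic_permutation_sym[OF v(1)] assms(2)] .
  then have "reduced (u @ drop g v)" by (simp add: u_def)
  then have "reduced u" unfolding reduced_def by (simp only: successively_append_iff)
  have ul: "u \<in> lists ({..<2} \<times> UNIV)" using vl by (auto simp: u_def dest: in_set_takeD)
  \<comment> \<open>The last block is shifted an odd number of times. As \<open>v\<close> ends in
    x_1, the block \<open>u\<close> ends in x_0, where it also began, so it has an odd number of
    syllables.\<close>
  obtain M' where M': "M = Suc M'" "odd M'" using gM(1,2) by (cases M) auto
  have "last v = last (theta 2 u)"
    using v_eq \<open>u \<noteq> []\<close> theta_two_funpow[OF ul] M' by (simp add: theta_def)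
  then have "fst (last v) = (fst (last u) + 1) mod 2"
    using \<open>u \<noteq> []\<close> by (simp add: theta_def last_map case_prod_unfold)
  moreover have "fst (last u) < 2"
    using ul last_in_set[OF \<open>u \<noteq> []\<close>] by (auto simp: mem_Times_iff)
  ultimately have "fst (last u) = 0" using v(4) by presburger
  then obtain as where "u = alternating 0 as" "0 \<notin> set as" "odd (length as)"
    using alternating_decomposition[OF \<open>reduced u\<close> \<open>u \<noteq> []\<close> ul \<open>fst (hd u) = 0\<close>] by blast
  then show ?thesis using that gM v(1) v_eq by blast
qed

end

lemma alternating_lists: "i < 2 \<Longrightarrow> alternating i as \<in> lists ({..<2} \<times> UNIV)"
  by (induction i as rule: alternating.induct) (auto intro!: syllable_lists[simplified])

text \<open>The restriction to x_0 = x, x_1 = t x t of a representation of the free product of Z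
  with the group of order 2; the shift of generators becomes conjugation by t.\<close>

definition half_turn :: "('k, 'm) monoid_scheme \<Rightarrow> 'k \<Rightarrow> 'k \<Rightarrow> nat \<Rightarrow> 'k" where
  "half_turn K x t i = (if i = 0 then x else t \<otimes>\<^bsub>K\<^esub> x \<otimes>\<^bsub>K\<^esub> t)"

context group
begin

context
  fixes x t
  assumes x: "x \<in> carrier G" and t: "t \<in> carrier G" and tt: "t \<otimes> t = \<one>"
begin

lemma half_turn_closed: "half_turn G x t \<in> {..<2} \<rightarrow> carrier G"
  using x t by (simp add: half_turn_def)

lemma involution_cancel: "y \<in> carrier G \<Longrightarrow> t \<otimes> (t \<otimes> y) = y"
  using t tt by (simp flip: m_assoc)

lemma word_value_half_turn_theta:
  assumes "u \<in> lists ({..<2} \<times> UNIV)"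
  shows "word_value G (half_turn G x t) (theta 2 u) = t \<otimes> word_value G (half_turn G x t) u \<otimes> t"
  using assms
proof (induction u)
  case Nil
  then show ?case using t tt by (simp add: theta_def)
next
  case (Cons a u)
  obtain i e where a: "a = (i, e)" by (cases a)
  have i: "i = 0 \<or> i = 1" using Cons.hyps a by (auto simp: less_2_cases_iff)
  have c: "word_value G (half_turn G x t) u \<in> carrier G"
    by (rule word_value_closed[OF half_turn_closed Cons.hyps(2)])
  have inv_t: "inv t = t" using inv_equality[OF tt t t] .
  define h where "h = word_value G (half_turn G x t) u"
  have "word_value G (half_turn G x t) (theta 2 (a # u))
    = (if e then half_turn G x t ((i + 1) mod 2) else inv (half_turn G x t ((i + 1) mod 2)))
      \<otimes> word_value G (half_turn G x t) (theta 2 u)"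
    by (simp add: theta_def a)
  also have "\<dots> = t \<otimes> word_value G (half_turn G x t) (a # u) \<otimes> t"
    using i x t c unfolding Cons.IH a word_value.simps h_def[symmetric] half_turn_def
    by (auto simp: m_assoc involution_cancel inv_mult_group inv_t)
  finally show ?case .
qed

lemma word_value_half_turn_theta_funpow:
  assumes "u \<in> lists ({..<2} \<times> UNIV)"
  shows "word_value G (half_turn G x t) ((theta 2 ^^ j) u) \<otimes> t [^] j
    = t [^] j \<otimes> word_value G (half_turn G x t) u"
proof (induction j)
  case 0
  then show ?case using word_value_closed[OF half_turn_closed assms] by simp
next
  case (Suc j)
  have c: "word_value G (half_turn G x t) ((theta 2 ^^ j) u) \<in> carrier G"
    "word_value G (half_turn G x t) u \<in> carrier G"
    using word_value_closed[OF half_turn_closed] theta_funpow_lists[OF assms] assms by blast+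
  have "t [^] Suc j = t \<otimes> t [^] j" by (rule nat_pow_Suc2[OF t])
  then show ?case
    using word_value_half_turn_theta[OF theta_funpow_lists[OF assms], of j] c t Suc
    by (simp add: m_assoc involution_cancel)
qed

text \<open>Block j is the first block conjugated by t^j, so between neighbouring blocks all but one
  t cancel.\<close>

lemma word_value_half_turn_concat:
  assumes "u \<in> lists ({..<2} \<times> UNIV)"
  shows "word_value G (half_turn G x t) (concat (map (\<lambda>j. (theta 2 ^^ j) u) [0..<M])) \<otimes> t [^] M
    = (word_value G (half_turn G x t) u \<otimes> t) [^] M"
proof (induction M)
  case (Suc M)
  let ?V = "word_value G (half_turn G x t)"
  let ?C = "concat (map (\<lambda>j. (theta 2 ^^ j) u) [0..<M])"
  have l: "?C \<in> lists ({..<2} \<times> UNIV)" "(theta 2 ^^ M) u \<in> lists ({..<2} \<times> UNIV)"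
    using theta_funpow_lists[OF assms] by (fastforce simp: lists_eq_set)+
  have c: "?V ?C \<in> carrier G" "?V ((theta 2 ^^ M) u) \<in> carrier G" "?V u \<in> carrier G"
    using word_value_closed[OF half_turn_closed] l assms by blast+
  have "?V (concat (map (\<lambda>j. (theta 2 ^^ j) u) [0..<Suc M])) \<otimes> t [^] Suc M
    = ?V ?C \<otimes> (?V ((theta 2 ^^ M) u) \<otimes> t [^] M) \<otimes> t"
    using word_value_append[OF half_turn_closed l] c t by (simp add: m_assoc)
  also have "\<dots> = (?V ?C \<otimes> t [^] M) \<otimes> (?V u \<otimes> t)"
    unfolding word_value_half_turn_theta_funpow[OF assms] using c t by (simp add: m_assoc)
  finally show ?case using Suc by simp
qed simp

text \<open>Syllables alternate between powers of x and of t x t, which leaves one t between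
  consecutive powers of x; the outer powers of t account for the starting generator and the parity
  of the length.\<close>

lemma word_value_half_turn_alternating:
  "i < 2 \<Longrightarrow> word_value G (half_turn G x t) (alternating i as) \<otimes> t [^] (length as + i)
    = t [^] i \<otimes> foldr (\<lambda>a y. x [^] a \<otimes> (t \<otimes> y)) as \<one>"
proof (induction i as rule: alternating.induct)
  case (1 i)
  then show ?case using t by simp
next
  case (2 i a as)
  let ?V = "word_value G (half_turn G x t)"
  let ?F = "\<lambda>as :: int list. foldr (\<lambda>a y. x [^] a \<otimes> (t \<otimes> y)) as \<one>"
  have F: "?F bs \<in> carrier G" for bs by (induction bs) (use x t int_pow_closed[OF x] in \<open>auto simp: comp_def\<close>)
  have l: "syllable i a \<in> lists ({..<2} \<times> UNIV)" "alternating (1 - i) as \<in> lists ({..<2} \<times> UNIV)"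
    using 2(2) syllable_lists[of i "{..<2}"] alternating_lists by auto
  have c: "?V (syllable i a) \<in> carrier G" "?V (alternating (1 - i) as) \<in> carrier G"
    using word_value_closed[OF half_turn_closed] l by blast+
  have eq: "?V (alternating i (a # as)) = ?V (syllable i a) \<otimes> ?V (alternating (1 - i) as)"
    using word_value_append[OF half_turn_closed l] by simp
  have inv_t: "inv t = t" using inv_equality[OF tt t t] .
  consider "i = 0" | "i = 1" using 2(2) by linarith
  then show ?case
  proof cases
    case 1
    then have "?V (syllable i a) = x [^] a"
      using word_value_syllable[of "half_turn G x t" i a] x by (simp add: half_turn_def)
    then show ?thesis using 2(1) 1 eq c x t F by (simp add: m_assoc)
  next
    case 2
    have "syllable i a = theta 2 (syllable 0 a)" by (simp add: syllable_def theta_def 2)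
    then have s: "?V (syllable i a) = t \<otimes> x [^] a \<otimes> t"
      using word_value_half_turn_theta[of "syllable 0 a"] syllable_lists[of 0 "{..<2 :: nat}" a]
        word_value_syllable[of "half_turn G x t" 0 a] x by (simp add: half_turn_def)
    have "?V (alternating 0 as) \<otimes> t [^] length as = ?F as"
      using "2.IH" 2 F by simp
    moreover have "t [^] Suc (Suc k) = t [^] k" for k :: nat
      using t tt by (simp add: m_assoc)
    ultimately show ?thesis
      using 2 eq c x t F s by (simp add: m_assoc del: nat_pow_Suc)
  qed
qed

end

end

section \<open>Vanishing exponent sum, and ping-pong for matrices\<close>

lemma weight_map: "weight f c (map (\<lambda>(i, e). (g i, e)) w) s = weight (f \<circ> g) (c \<circ> g) w s"
  by (induction w) (auto simp: height_map comp_def split: prod.splits)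

lemma weight_add: "weight f (\<lambda>i p. c i p + c' i p) w s = weight f c w s + weight f c' w s"
  by (induction w) auto

lemma weight_cong:
  "w \<in> lists (S \<times> UNIV) \<Longrightarrow> (\<And>i p. i \<in> S \<Longrightarrow> c i p = c' i p) \<Longrightarrow> weight f c w s = weight f c' w s"
  by (induction w) auto

lemma weight_coboundary: "weight f (\<lambda>i p. h (p + f i) - h p) w s = h (s + height f w) - h s"
proof (induction w)
  case (Cons a w)
  show ?case unfolding weight.simps Cons by (simp add: ac_simps add_diff_eq)
qed simp

lemma height_alternating: "height (\<lambda>_. 1) (alternating i as) = sum_list as"
proof (induction i as rule: alternating.induct)
  case (2 i a as)
  have "height (\<lambda>_. 1) (replicate k (i, e)) = (if e then int k else - int k)" for k e
    by (induction k) auto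
  then have "height (\<lambda>_. 1) (syllable i a) = a" by (simp add: syllable_def)
  then show ?case using 2 by (simp add: height_append)
qed simp

context redundant_cyclic_presentation
begin

lemma relator_cyclic_permutation:
  assumes "n = 2" "cyclic_permutation w v" "r \<in> set (snd (cyclic_presentation n w))"
  shows "cyclic_permutation r v"
proof -
  obtain d where "0 < d" "d < n" and d: "cyclic_permutation w ((theta n ^^ d) w)"
    by (rule symmetry_exponent)
  then have "d = 1" using assms by simp
  obtain j where j: "j < 2" "r = (theta n ^^ j) w" using assms(3) assms(1) unfolding relators_iff by blast
  have "cyclic_permutation r w"
  proof (cases "j = 0")
    case False
    then have "j = d" using j \<open>d = 1\<close> by simp
    then show ?thesis using d j(2) cyclic_permutation_sym by simp
  qed (simp add: j)
  then show ?thesis using assms(2) by (rule cyclic_permutation_trans)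
qed

text \<open>Send both generators to 1 in Z. The block \<open>u\<close> and its shift then have
  height 0 and opposite weights, and the relator is a product of such pairs because \<open>M\<close>
  is even.\<close>

lemma contains_nonabelian_free_of_sum_zero:
  assumes n: "n = 2" and "even M"
    and wv: "cyclic_permutation w (concat (map (\<lambda>j. (theta 2 ^^ j) (alternating 0 as)) [0..<M]))"
    and sum: "sum_list as = 0"
  shows "contains_nonabelian_free_subgroup (presented_group (cyclic_presentation n w))"
proof -
  define u where "u = alternating 0 as"
  have u: "u \<in> lists ({..<2} \<times> UNIV)" unfolding u_def by (rule alternating_lists) simp
  let ?f = "\<lambda>_ :: nat. 1 :: int"
  \<comment> \<open>Added to its image under exchanging the generators, this gives the indicator of
    position 0 for both generators, which is the coboundary of the step function at 0 and so has
    weight 0 on words of height 0.\<close>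
  define c :: "nat \<Rightarrow> int \<Rightarrow> int" where "c i p = (if i = 1 \<and> p = 0 then 1 else 0)" for i p
  have hu: "height ?f u = 0" "height ?f (theta 2 u) = 0"
    using height_alternating sum by (simp_all add: u_def theta_def height_map comp_def)
  have "weight ?f c (theta 2 u) s = weight ?f (\<lambda>i. c ((i + 1) mod 2)) u s" for s
    unfolding theta_def weight_map by (simp add: comp_def)
  then have "weight ?f c u s + weight ?f c (theta 2 u) s
      = weight ?f (\<lambda>i p. c i p + c ((i + 1) mod 2) p) u s" for s
    by (simp add: weight_add)
  also have "weight ?f (\<lambda>i p. c i p + c ((i + 1) mod 2) p) u s
      = weight ?f (\<lambda>i p. (if 0 < p + ?f i then 1 else 0) - (if 0 < p then 1 else 0)) u s" for s
    by (rule weight_cong[OF u]) (auto simp: c_def less_2_cases_iff)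
  also have "weight ?f (\<lambda>i p. (if 0 < p + ?f i then 1 else 0) - (if 0 < p then 1 else 0)) u s = 0" for s
    using weight_coboundary[of ?f "\<lambda>p. if 0 < p then 1 else 0" u s] hu by simp
  finally have wu: "weight ?f c u s + weight ?f c (theta 2 u) s = 0" for s .
  obtain m where M: "M = 2 * m" using \<open>even M\<close> by blast
  define v where "v k = concat (map (\<lambda>j. (theta 2 ^^ j) u) [0..<k])" for k
  have "height ?f (v (2 * k)) = 0 \<and> (\<forall>s. weight ?f c (v (2 * k)) s = 0)" for k
  proof (induction k)
    case (Suc k)
    have "v (2 * Suc k) = v (2 * k) @ u @ theta 2 u"
      using theta_two_funpow[OF u, of "2 * k"] by (simp add: v_def)
    then show ?case using Suc hu wu by (simp add: height_append weight_append add.commute)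
  qed (simp add: v_def)
  then have v: "height ?f (v M) = 0" "\<And>s. weight ?f c (v M) s = 0" by (auto simp: M)
  have wv: "cyclic_permutation w (v M)" using wv by (simp add: v_def u_def)
  show ?thesis
  proof (rule contains_nonabelian_free_weightI[of ?f 0 c 1 1 0])
    fix r assume "r \<in> set (snd (cyclic_presentation n w))"
    then have r: "cyclic_permutation r (v M)" by (rule relator_cyclic_permutation[OF n wv])
    show "height ?f r = 0" using height_cyclic_permutation[OF r] v by simp
    show "weight ?f c r s = 0" for s using weight_cyclic_permutation[OF r v] .
  next
    show "0 \<in> fst (cyclic_presentation n w)" "1 \<in> fst (cyclic_presentation n w)"
      unfolding generators by (simp_all add: n)
  qed (auto simp: c_def)
qed

end

section \<open>Diagonal matrices and involutions acting on pairs of complex numbers\<close>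

definition scale :: "complex \<Rightarrow> complex \<Rightarrow> complex \<times> complex \<Rightarrow> complex \<times> complex" where
  "scale c d = (\<lambda>(z1, z2). (c * z1, d * z2))"

text \<open>The matrix with rows (\<alpha>, \<alpha> + 1) and (1 - \<alpha>, -\<alpha>), of trace 0
  and determinant -1. It is linear in \<alpha>, triangular at 1 and -1, and has no zero entry away
  from 0, 1, -1.\<close>

definition involution :: "complex \<Rightarrow> complex \<times> complex \<Rightarrow> complex \<times> complex" where
  "involution \<alpha> = (\<lambda>(z1, z2). (\<alpha> * z1 + (\<alpha> + 1) * z2, (1 - \<alpha>) * z1 - \<alpha> * z2))"

lemma involution_involution: "involution \<alpha> \<circ> involution \<alpha> = id"
  by (auto simp: involution_def fun_eq_iff algebra_simps)

lemma bij_involution [simp]: "bij (involution \<alpha>)"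
  using perms_inv_equality(1)[OF involution_involution involution_involution] .

lemma scale_inverse:
  assumes "c \<noteq> 0" "d \<noteq> 0"
  shows "bij (scale c d)" "inv\<^bsub>perms\<^esub> (scale c d) = scale (inverse c) (inverse d)"
proof -
  have "scale c d \<circ> scale (inverse c) (inverse d) = id" "scale (inverse c) (inverse d) \<circ> scale c d = id"
    using assms by (simp_all add: scale_def fun_eq_iff)
  from perms_inv_equality[OF this] show "bij (scale c d)"
    "inv\<^bsub>perms\<^esub> (scale c d) = scale (inverse c) (inverse d)" .
qed

lemma scale_int_pow:
  assumes "c \<noteq> 0" "d \<noteq> 0"
  shows "scale c d [^]\<^bsub>perms\<^esub> (a :: int) = scale (c powi a) (d powi a)"
proof -
  have nat: "scale c d ^^ k = scale (c ^ k) (d ^ k)" for k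
    by (induction k) (simp_all add: scale_def fun_eq_iff)
  show ?thesis
  proof (cases "0 \<le> a")
    case True
    then obtain k where "a = int k" using nonneg_int_cases by blast
    then show ?thesis using nat by (simp add: int_pow_int nat_pow_perms)
  next
    case False
    define k where "k = nat (- a)"
    have a: "a = - int k" using False by (simp add: k_def)
    have "scale c d [^]\<^bsub>perms\<^esub> a = inv\<^bsub>perms\<^esub> (scale (c ^ k) (d ^ k))"
      using perms.int_pow_neg[of "scale c d" "int k"] scale_inverse(1)[OF assms]
      by (simp add: a int_pow_int nat_pow_perms nat)
    then show ?thesis
      using assms scale_inverse(2)[of "c ^ k" "d ^ k"] by (simp add: a power_int_minus)
  qed
qed

text \<open>High powers of the diagonal matrix attract to one axis and repel from the other. No
  entry of the involution vanishes, so it moves both axes to two further lines; narrow cones about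
  the four lines are disjoint and play ping-pong. The scalar \<zeta> does not affect the
  lines.\<close>

lemma scale_involution_free:
  assumes \<alpha>: "\<alpha> \<noteq> 0" "\<alpha> \<noteq> 1" "\<alpha> \<noteq> - 1" and \<zeta>: "\<zeta> \<noteq> 0"
  shows "\<exists>N :: int. \<forall>v. reduced v \<longrightarrow> v \<noteq> [] \<longrightarrow>
    word_value perms (\<lambda>b. if b then scale (2 * \<zeta>) (\<zeta> / 2) [^]\<^bsub>perms\<^esub> N
      else involution \<alpha> \<circ> scale (2 * \<zeta>) (\<zeta> / 2) [^]\<^bsub>perms\<^esub> N \<circ> involution \<alpha>) v \<noteq> \<one>\<^bsub>perms\<^esub>"
proof -
  let ?T = "involution \<alpha>"
  define a b c where "a = cmod \<alpha>" and "b = cmod (\<alpha> + 1)" and "c = cmod (1 - \<alpha>)"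
  have "\<alpha> + 1 \<noteq> 0" using \<alpha>(3) by (metis add_eq_0_iff2)
  then have pos: "0 < a" "0 < b" "0 < c"
    using \<alpha> by (auto simp: a_def b_def c_def)
  define s where "s = a + b + c"
  \<comment> \<open>Chosen so that R times each entry of the involution, in modulus, is at least
    three times their sum \<open>s\<close>; \<open>key\<close> bounds three terms by
    \<open>s\<close> each.\<close>
  define R where "R = 1 + 3 * s / a + 3 * s / b + 3 * s / c"
  have "0 < s" using pos by (simp add: s_def)
  then have R1: "1 \<le> R" using pos by (simp add: R_def)
  have R: "3 * s \<le> R * y" if "y \<in> {a, b, c}" for y
  proof -
    have "0 \<le> 3 * s / a" "0 \<le> 3 * s / b" "0 \<le> 3 * s / c" using pos \<open>0 < s\<close> by simp_all
    then have "3 * s / y \<le> R" "0 < y" using that pos unfolding R_def by auto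
    then show ?thesis by (simp add: divide_le_eq)
  qed
  define big :: "bool \<Rightarrow> complex \<times> complex \<Rightarrow> bool" where
    "big e z \<longleftrightarrow> (if e then R * cmod (snd z) < cmod (fst z) else R * cmod (fst z) < cmod (snd z))" for e z
  have R_mono: "x \<le> R * x" if "0 \<le> x" for x
    using mult_right_mono[OF R1 that] by simp
  have big_excl: "\<not> (big e z \<and> big (\<not> e) z)" for e z
    using R_mono[of "cmod (fst z)"] R_mono[of "cmod (snd z)"] by (auto simp: big_def)
  \<comment> \<open>X dominates Y in the vector, f is to dominate g in its image. But then g is
    about k' X while f is at most (k + l) X, so the ratio f / g cannot exceed R.\<close>
  have key: False
    if XY: "R * Y < X" "0 \<le> Y" and kl: "k \<in> {a, b, c}" "l \<in> {a, b, c}" "k' \<in> {a, b, c}" "l' \<in> {a, b, c}"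
      and fg: "f \<le> k * X + l * Y" "k' * X - l' * Y \<le> g" "R * g < f" for X Y f g k l k' l' :: real
  proof -
    have "Y \<le> X" "0 < X" using XY R_mono[OF XY(2)] by linarith+
    have p: "0 < k" "0 < l" "0 < k'" "0 < l'" using kl pos by auto
    have "R * (k' * X - l' * Y) \<le> R * g" using fg(2) R1 by (simp add: mult_left_mono)
    moreover have "l' * (R * Y) \<le> l' * X" using p XY by simp
    moreover have "l * Y \<le> l * X" using p \<open>Y \<le> X\<close> by simp
    moreover have "3 * s * X \<le> R * k' * X" using R[OF kl(3)] \<open>0 < X\<close> by simp
    ultimately have "3 * s * X < (k + l + l') * X" using fg by (simp add: algebra_simps)
    then have "3 * s < k + l + l'" using \<open>0 < X\<close> by simp
    moreover have "k \<le> s" "l \<le> s" "l' \<le> s" using kl pos by (auto simp: s_def)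
    ultimately show False by simp
  qed
  have cross: "\<not> (big e z \<and> big e' (?T z))" for e e' z
  proof
    assume *: "big e z \<and> big e' (?T z)"
    obtain z1 z2 where z: "z = (z1, z2)" by (cases z)
    let ?X = "cmod z1" and ?Y = "cmod z2"
    let ?f = "cmod (\<alpha> * z1 + (\<alpha> + 1) * z2)" and ?g = "cmod ((1 - \<alpha>) * z1 - \<alpha> * z2)"
    have f: "?f \<le> a * ?X + b * ?Y" "?f \<le> b * ?Y + a * ?X" "a * ?X - b * ?Y \<le> ?f" "b * ?Y - a * ?X \<le> ?f"
      using norm_triangle_ineq[of "\<alpha> * z1" "(\<alpha> + 1) * z2"] norm_diff_ineq[of "\<alpha> * z1" "(\<alpha> + 1) * z2"]
        norm_diff_ineq[of "(\<alpha> + 1) * z2" "\<alpha> * z1"]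
      by (simp_all add: a_def b_def norm_mult add.commute)
    have g: "?g \<le> c * ?X + a * ?Y" "?g \<le> a * ?Y + c * ?X" "c * ?X - a * ?Y \<le> ?g" "a * ?Y - c * ?X \<le> ?g"
      using norm_triangle_ineq4[of "(1 - \<alpha>) * z1" "\<alpha> * z2"] norm_triangle_ineq2[of "(1 - \<alpha>) * z1" "\<alpha> * z2"]
        norm_triangle_ineq2[of "\<alpha> * z2" "(1 - \<alpha>) * z1"]
      by (simp_all add: a_def c_def norm_mult norm_minus_commute)
    have T: "fst (?T z) = \<alpha> * z1 + (\<alpha> + 1) * z2" "snd (?T z) = (1 - \<alpha>) * z1 - \<alpha> * z2"
      by (simp_all add: involution_def z)
    show False
    proof (cases e; cases e')
      assume "e" "e'"
      then show False
        using * key[of ?Y ?X a b c a ?f ?g] f g by (simp add: big_def z T[unfolded z])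
    next
      assume "e" "\<not> e'"
      then show False
        using * key[of ?Y ?X c a a b ?g ?f] f g by (simp add: big_def z T[unfolded z])
    next
      assume "\<not> e" "e'"
      then show False
        using * key[of ?X ?Y b a a c ?f ?g] f g by (simp add: big_def z T[unfolded z])
    next
      assume "\<not> e" "\<not> e'"
      then show False
        using * key[of ?X ?Y a c b a ?g ?f] f g by (simp add: big_def z T[unfolded z])
    qed
  qed
  \<comment> \<open>The diagonal entries of the N-th power have ratio 4^N in modulus. One factor R
    leaves the complement of one cone, the other enters the opposite cone.\<close>
  obtain N where N: "R * R < 4 ^ N" using real_arch_pow[of 4 "R * R"] by auto
  define q where "q = cmod \<zeta> ^ N"
  have q: "0 < q" using \<zeta> by (simp add: q_def)
  define c1 c2 where "c1 = (2 * \<zeta>) ^ N" and "c2 = (\<zeta> / 2) ^ N"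
  have cn: "c1 \<noteq> 0" "c2 \<noteq> 0" using \<zeta> by (simp_all add: c1_def c2_def)
  have four: "(4 :: real) ^ N = 2 ^ N * 2 ^ N" by (simp flip: power_mult_distrib)
  have ratio: "R * R * cmod c2 < cmod c1"
  proof -
    have "R * R * q < 2 ^ N * 2 ^ N * q" using N q four by simp
    then show ?thesis
      by (simp add: c1_def c2_def q_def norm_mult norm_power norm_divide power_divide
          power_mult_distrib divide_less_eq mult.commute mult.left_commute)
  qed
  define D where "D = scale c1 c2"
  have D_pow: "scale (2 * \<zeta>) (\<zeta> / 2) [^]\<^bsub>perms\<^esub> int N = D"
    using scale_int_pow[of "2 * \<zeta>" "\<zeta> / 2" "int N"] \<zeta> by (simp add: D_def c1_def c2_def)
  have D: "bij D" "inv\<^bsub>perms\<^esub> D = scale (inverse c1) (inverse c2)"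
    unfolding D_def by (rule scale_inverse[OF cn])+
  have R0: "0 < R" using R1 by simp
  have stretch: "R * (y * Y) < x * X" if "Y \<le> R * X" "0 < X" "R * R * y < x" "0 \<le> y" for x y X Y :: real
  proof -
    have "R * (y * Y) \<le> R * (y * (R * X))"
      using that R0 by (simp add: mult_left_mono)
    also have "\<dots> = R * R * y * X" by (simp add: algebra_simps)
    also have "\<dots> < x * X" using that by simp
    finally show ?thesis .
  qed
  have D_big: "big True (D z)" if "z \<noteq> (0, 0)" "\<not> big False z" for z
  proof -
    obtain z1 z2 where z: "z = (z1, z2)" by (cases z)
    have le: "cmod z2 \<le> R * cmod z1" using that(2) by (simp add: big_def z)
    moreover have "z1 \<noteq> 0" using that(1) le z by auto
    ultimately show ?thesis
      using stretch[of "cmod z2" "cmod z1" "cmod c2" "cmod c1"] ratio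
      by (simp add: big_def z D_def scale_def norm_mult)
  qed
  have D_inv_big: "big False ((inv\<^bsub>perms\<^esub> D) z)" if "z \<noteq> (0, 0)" "\<not> big True z" for z
  proof -
    obtain z1 z2 where z: "z = (z1, z2)" by (cases z)
    have le: "cmod z1 \<le> R * cmod z2" using that(2) by (simp add: big_def z)
    moreover have "z2 \<noteq> 0" using that(1) le z by auto
    moreover have "R * R * inverse (cmod c1) < inverse (cmod c2)"
      using ratio cn by (simp add: field_simps)
    ultimately show ?thesis
      using stretch[of "cmod z1" "cmod z2" "inverse (cmod c1)" "inverse (cmod c2)"]
      by (simp add: big_def z D scale_def norm_mult norm_inverse)
  qed
  have TT: "?T (?T z) = z" for z using involution_involution[of \<alpha>] by (metis comp_apply id_apply)
  have T0: "?T z = (0, 0) \<longleftrightarrow> z = (0, 0)" for z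
    using TT[of z] by (auto simp: involution_def)
  define B where "B b = (if b then D else ?T \<circ> D \<circ> ?T)" for b
  have B: "bij (B b)" "inv\<^bsub>perms\<^esub> (B b) = (if b then inv\<^bsub>perms\<^esub> D else ?T \<circ> inv\<^bsub>perms\<^esub> D \<circ> ?T)" for b
  proof -
    have "(?T \<circ> D \<circ> ?T) \<circ> (?T \<circ> inv\<^bsub>perms\<^esub> D \<circ> ?T) = id" "(?T \<circ> inv\<^bsub>perms\<^esub> D \<circ> ?T) \<circ> (?T \<circ> D \<circ> ?T) = id"
      using D(1) by (auto simp: fun_eq_iff TT)
    from perms_inv_equality[OF this] D show "bij (B b)"
      "inv\<^bsub>perms\<^esub> (B b) = (if b then inv\<^bsub>perms\<^esub> D else ?T \<circ> inv\<^bsub>perms\<^esub> D \<circ> ?T)"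
      by (auto simp: B_def)
  qed
  define U where "U l = {z. z \<noteq> (0, 0) \<and> big (snd l) (if fst l then z else ?T z)}" for l
  have "word_value perms B v \<noteq> \<one>\<^bsub>perms\<^esub>" if v: "reduced v" "v \<noteq> []" for v
  proof (rule ping_pong[where U = U and X = "{z. z \<noteq> (0, 0)}" and p = "(1, - 1)"])
    have D0: "D z \<noteq> (0, 0)" "(inv\<^bsub>perms\<^esub> D) z \<noteq> (0, 0)" if "z \<noteq> (0, 0)" for z
      using that cn unfolding D(2) by (auto simp: D_def scale_def split: prod.splits)
    fix i and z :: "complex \<times> complex" assume "z \<in> {z. z \<noteq> (0, 0)}"
    then have z: "z \<noteq> (0, 0)" by simp
    show "B i z \<in> U (i, True)" if "z \<notin> U (i, False)"
      using that z D_big[of z] D_big[of "?T z"] D0 by (auto simp: U_def B_def TT T0)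
    show "(inv\<^bsub>perms\<^esub> (B i)) z \<in> U (i, False)" if "z \<notin> U (i, True)"
      using that z D_inv_big[of z] D_inv_big[of "?T z"] D0 by (auto simp: U_def B TT T0)
  next
    fix l l' :: "bool \<times> bool" assume "l \<noteq> l'"
    then have "\<not> (big (snd l) (if fst l then z else ?T z) \<and> big (snd l') (if fst l' then z else ?T z))" for z
      using big_excl[of "snd l" z] big_excl[of "snd l" "?T z"] cross[of "snd l" z "snd l'"] cross[of "snd l'" z "snd l"]
      by (cases l; cases l') (auto split: if_splits)
    then show "U l \<inter> U l' = {}" unfolding U_def by blast
  next
    \<comment> \<open>An eigenvector of the involution for every parameter; its coordinates have
      equal modulus, so it lies in none of the four cones.\<close>
    have "?T (1, - 1) = (- 1, 1)" by (simp add: involution_def)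
    then show "(1, - 1) \<notin> U l" for l using R1 by (auto simp: U_def big_def)
  qed (use v B in \<open>auto simp: U_def\<close>)
  then show ?thesis
    unfolding B_def[abs_def] D_pow[symmetric] by blast
qed

section \<open>The trace polynomial\<close>

text \<open>After splitting off the full power of the variable, a polynomial without any root is
  left, which is constant.\<close>

lemma monomial_of_roots_zero:
  fixes p :: "complex poly"
  assumes "\<And>z. poly p z = 0 \<Longrightarrow> z = 0"
  shows "p = monom (lead_coeff p) (degree p)"
proof (cases "p = 0")
  case False
  then obtain q where q: "p = [:- 0, 1:] ^ order 0 p * q" "\<not> [:- 0, 1:] dvd q"
    using order_decomp[of p 0] by blast
  have "poly q z \<noteq> 0" for z
  proof
    assume z: "poly q z = 0"
    then have "poly p z = 0" by (subst q(1)) simp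
    then have "z = 0" by (rule assms)
    then show False using z q(2) by (simp add: poly_eq_0_iff_dvd)
  qed
  then have "constant (poly q)" using fundamental_theorem_of_algebra by blast
  then obtain c where "q = [:c:]" using constant_degree degree_eq_zeroE by blast
  then have "p = monom c (order 0 p)"
    using q(1) by (simp add: monom_altdef)
  then show ?thesis by (metis degree_monom_eq lead_coeff_monom monom_eq_0_iff False)
qed simp

text \<open>
  The entries of the product of the matrices \<open>diag(2\<^sup>a, 2\<^sup>-\<^sup>a) \<sqdot> T\<close>, \<open>a\<close> in the given list, as polynomials
  in the parameter of the involution \<open>T\<close>.
\<close>

primrec matrix_entries :: "int list \<Rightarrow> complex poly \<times> complex poly \<times> complex poly \<times> complex poly" where
  "matrix_entries [] = (1, 0, 0, 1)"
| "matrix_entries (a # as) = (case matrix_entries as of (p, q, r, s) \<Rightarrow>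
     (smult (2 powi a) ([:0, 1:] * p + [:1, 1:] * r), smult (2 powi a) ([:0, 1:] * q + [:1, 1:] * s),
      smult (2 powi - a) ([:1, - 1:] * p - [:0, 1:] * r), smult (2 powi - a) ([:1, - 1:] * q - [:0, 1:] * s)))"

definition matrix_trace :: "int list \<Rightarrow> complex poly" where
  "matrix_trace as = (case matrix_entries as of (p, q, r, s) \<Rightarrow> p + s)"

definition leading_product :: "int list \<Rightarrow> complex" where
  "leading_product as = prod_list (map (\<lambda>a. 2 powi a - 2 powi - a) as)"

lemma matrix_entries_det:
  "matrix_entries as = (p, q, r, s) \<Longrightarrow> poly p z * poly s z - poly q z * poly r z = (- 1) ^ length as"
proof (induction as arbitrary: p q r s)
  case (Cons a as)
  obtain p' q' r' s' where e: "matrix_entries as = (p', q', r', s')" by (metis prod_cases4)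
  have "(2 :: complex) powi a * 2 powi - a = 1" by (simp add: power_int_minus)
  then have "poly p z * poly s z - poly q z * poly r z
    = - (poly p' z * poly s' z - poly q' z * poly r' z)"
    using Cons.prems e by (auto simp: algebra_simps)
  then show ?case using Cons.IH[OF e] by simp
qed auto

lemma matrix_entries_degree:
  "matrix_entries as = (p, q, r, s) \<Longrightarrow>
    degree p \<le> length as \<and> degree q \<le> length as \<and> degree r \<le> length as \<and> degree s \<le> length as"
proof (induction as arbitrary: p q r s)
  case (Cons a as)
  obtain p' q' r' s' where e: "matrix_entries as = (p', q', r', s')" by (metis prod_cases4)
  have "degree ([:b, c:] * f) \<le> Suc (length as)" if "degree f \<le> length as" for b c :: complex and f
    using degree_mult_le[of "[:b, c:]" f] that by (auto intro: order_trans)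
  then show ?case
    using Cons.prems Cons.IH[OF e] e
    by (auto intro!: degree_add_le degree_diff_le order_trans[OF degree_smult_le])
qed auto

text \<open>The linear coefficient of each factor has rank one: the column (2^a, -2^-a) times the
  row (1, 1). In the product every inner row meets the next column and contributes 2^a - 2^-a. For
  the empty list the trace is 2, hence the restriction.\<close>

lemma matrix_entries_leading:
  "matrix_entries as = (p, q, r, s) \<Longrightarrow>
    coeff p (length as) + coeff r (length as) = leading_product as \<and>
    coeff q (length as) + coeff s (length as) = leading_product as \<and>
    (as \<noteq> [] \<longrightarrow> coeff p (length as) + coeff s (length as) = leading_product as)"
proof (induction as arbitrary: p q r s)
  case (Cons a as)
  obtain p' q' r' s' where e: "matrix_entries as = (p', q', r', s')" by (metis prod_cases4)
  have d: "coeff p' (Suc (length as)) = 0" "coeff q' (Suc (length as)) = 0"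
    "coeff r' (Suc (length as)) = 0" "coeff s' (Suc (length as)) = 0"
    using matrix_entries_degree[OF e] by (auto intro: coeff_eq_0)
  have pqrs: "p = smult (2 powi a) ([:0, 1:] * p' + [:1, 1:] * r')"
    "q = smult (2 powi a) ([:0, 1:] * q' + [:1, 1:] * s')"
    "r = smult (2 powi - a) ([:1, - 1:] * p' - [:0, 1:] * r')"
    "s = smult (2 powi - a) ([:1, - 1:] * q' - [:0, 1:] * s')"
    using Cons.prems unfolding matrix_entries.simps e by (simp_all only: prod.case prod.inject)
  have lp: "leading_product (a # as) = (2 powi a - 2 powi - a) * leading_product as"
    by (simp add: leading_product_def)
  have "coeff p (Suc (length as)) = 2 powi a * (coeff p' (length as) + coeff r' (length as))"
    "coeff q (Suc (length as)) = 2 powi a * (coeff q' (length as) + coeff s' (length as))"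
    "coeff r (Suc (length as)) = - (2 powi - a) * (coeff p' (length as) + coeff r' (length as))"
    "coeff s (Suc (length as)) = - (2 powi - a) * (coeff q' (length as) + coeff s' (length as))"
    unfolding pqrs by (simp_all add: d algebra_simps)
  then show ?case
    using Cons.IH[OF e] lp by (simp add: left_diff_distrib)
qed (simp add: leading_product_def)

lemma matrix_trace_leading:
  assumes "as \<noteq> []"
  shows "coeff (matrix_trace as) (length as) = leading_product as"
  using matrix_entries_leading[of as] assms by (auto simp: matrix_trace_def split: prod.splits)

lemma matrix_trace_degree: "degree (matrix_trace as) \<le> length as"
  using matrix_entries_degree[of as] by (auto simp: matrix_trace_def intro: degree_add_le split: prod.splits)

text \<open>At 1 the involution is upper triangular with diagonal 1, -1, so diagonals
  multiply.\<close>

lemma matrix_trace_1: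
  "poly (matrix_trace as) 1 = 2 powi sum_list as + (- 1) ^ length as * 2 powi - sum_list as"
proof -
  have "matrix_entries as = (p, q, r, s) \<Longrightarrow> poly r 1 = 0 \<and> poly p 1 = 2 powi sum_list as \<and>
    poly s 1 = (- 1) ^ length as * 2 powi - sum_list as" for p q r s
  proof (induction as arbitrary: p q r s)
    case (Cons a as)
    obtain p' q' r' s' where e: "matrix_entries as = (p', q', r', s')" by (metis prod_cases4)
    show ?case
      using Cons.IH[OF e] Cons.prems e by (auto simp: power_int_add power_int_diff power_int_minus divide_inverse)
  qed auto
  then show ?thesis by (auto simp: matrix_trace_def split: prod.splits)
qed

text \<open>At -1 the involution is lower triangular with diagonal -1, 1.\<close>

lemma matrix_trace_minus_1:
  "poly (matrix_trace as) (- 1) = (- 1) ^ length as * 2 powi sum_list as + 2 powi - sum_list as"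
proof -
  have "matrix_entries as = (p, q, r, s) \<Longrightarrow> poly q (- 1) = 0 \<and>
    poly p (- 1) = (- 1) ^ length as * 2 powi sum_list as \<and> poly s (- 1) = 2 powi - sum_list as" for p q r s
  proof (induction as arbitrary: p q r s)
    case (Cons a as)
    obtain p' q' r' s' where e: "matrix_entries as = (p', q', r', s')" by (metis prod_cases4)
    show ?case
      using Cons.IH[OF e] Cons.prems e by (auto simp: power_int_add power_int_diff power_int_minus divide_inverse)
  qed auto
  then show ?thesis by (auto simp: matrix_trace_def split: prod.splits)
qed

lemma scale_apply: "scale c d (z1, z2) = (c * z1, d * z2)"
  by (simp add: scale_def)

lemma matrix_entries_action:
  assumes "\<zeta> \<noteq> 0" "matrix_entries as = (p, q, r, s)"
  shows "foldr (\<lambda>a y. scale (2 * \<zeta>) (\<zeta> / 2) [^]\<^bsub>perms\<^esub> a \<otimes>\<^bsub>perms\<^esub> (involution \<alpha> \<otimes>\<^bsub>perms\<^esub> y)) as \<one>\<^bsub>perms\<^esub> (z1, z2)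
    = (\<zeta> powi sum_list as * (poly p \<alpha> * z1 + poly q \<alpha> * z2),
       \<zeta> powi sum_list as * (poly r \<alpha> * z1 + poly s \<alpha> * z2))"
  using assms(2)
proof (induction as arbitrary: p q r s)
  case (Cons a as)
  obtain p' q' r' s' where e: "matrix_entries as = (p', q', r', s')" by (metis prod_cases4)
  have "(\<zeta> / 2) powi a = \<zeta> powi a * 2 powi - a"
    by (simp only: divide_inverse power_int_mult_distrib power_int_inverse power_int_minus)
  moreover have "scale (2 * \<zeta>) (\<zeta> / 2) [^]\<^bsub>perms\<^esub> a = scale ((2 * \<zeta>) powi a) ((\<zeta> / 2) powi a)"
    by (rule scale_int_pow) (use assms(1) in simp_all)
  ultimately have x: "scale (2 * \<zeta>) (\<zeta> / 2) [^]\<^bsub>perms\<^esub> a = scale (2 powi a * \<zeta> powi a) (\<zeta> powi a * 2 powi - a)"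
    by (simp only: power_int_mult_distrib)
  have \<zeta>: "\<zeta> powi sum_list (a # as) = \<zeta> powi a * \<zeta> powi sum_list as"
    using assms(1) by (simp add: power_int_add)
  show ?case
    unfolding \<zeta> using Cons.IH[OF e] Cons.prems e
    by (auto simp: x scale_apply involution_def comp_def) (simp_all add: algebra_simps)
qed simp

text \<open>Compare the powers of \<open>2\<close> and then the sizes of the two sides.\<close>

lemma leading_product_neq:
  assumes "0 \<notin> set as" "2 \<le> length as" "sum_list as \<noteq> 0"
  shows "leading_product as \<noteq> 2 powi sum_list as - 2 powi - sum_list as"
proof
  define m where "m bs = sum_list (map (\<lambda>a. nat \<bar>a\<bar>) bs)" for bs :: "int list"
  \<comment> \<open>Up to sign, the leading product with its denominator 2^m cleared; the point is
    that it is odd.\<close>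
  define P :: "int list \<Rightarrow> int" where "P bs = prod_list (map (\<lambda>a. 4 ^ nat \<bar>a\<bar> - 1) bs)" for bs
  have factor: "\<exists>\<sigma>\<in>{1, - 1}. ((2 :: complex) powi a - 2 powi - a) * 2 ^ nat \<bar>a\<bar> = \<sigma> * of_int (4 ^ nat \<bar>a\<bar> - 1)" for a
  proof -
    define k where "k = nat \<bar>a\<bar>"
    have "(4 :: complex) ^ k = 2 ^ k * 2 ^ k" by (simp flip: power_mult_distrib)
    moreover have "a = int k \<or> a = - int k" by (auto simp: k_def)
    ultimately show ?thesis
      unfolding k_def[symmetric] by (auto simp: power_int_minus field_simps)
  qed
  have lp: "\<exists>\<sigma>\<in>{1, - 1}. leading_product bs * 2 ^ m bs = \<sigma> * of_int (P bs)" for bs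
  proof (induction bs)
    case (Cons a bs)
    obtain \<sigma> where \<sigma>: "\<sigma> \<in> {1, - 1}" "leading_product bs * 2 ^ m bs = \<sigma> * of_int (P bs)"
      using Cons by blast
    obtain \<tau> where \<tau>: "\<tau> \<in> {1, - 1}" "((2 :: complex) powi a - 2 powi - a) * 2 ^ nat \<bar>a\<bar> = \<tau> * of_int (4 ^ nat \<bar>a\<bar> - 1)"
      using factor by blast
    have "leading_product (a # bs) * 2 ^ m (a # bs)
      = (((2 :: complex) powi a - 2 powi - a) * 2 ^ nat \<bar>a\<bar>) * (leading_product bs * 2 ^ m bs)"
      by (simp add: leading_product_def m_def power_add)
    also have "\<dots> = \<tau> * \<sigma> * of_int (P (a # bs))"
      unfolding \<sigma> \<tau> by (simp add: P_def)
    finally show ?case using \<sigma>(1) \<tau>(1) by (intro bexI[of _ "\<tau> * \<sigma>"]) auto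
  qed (simp add: leading_product_def m_def P_def)
  have P: "odd (P bs) \<and> 0 < P bs \<and> P bs \<le> 4 ^ m bs" if "0 \<notin> set bs" for bs
    using that
  proof (induction bs)
    case (Cons a bs)
    have "4 ^ 1 \<le> (4 :: int) ^ nat \<bar>a\<bar>" using Cons.prems by (intro power_increasing) auto
    then have 1: "3 \<le> (4 :: int) ^ nat \<bar>a\<bar> - 1" by simp
    have "((4 :: int) ^ nat \<bar>a\<bar> - 1) * P bs \<le> 4 ^ nat \<bar>a\<bar> * 4 ^ m bs"
      by (rule mult_mono) (use Cons in auto)
    moreover have "odd ((4 :: int) ^ nat \<bar>a\<bar> - 1)" using Cons.prems by simp
    ultimately show ?case using Cons 1 by (simp add: P_def m_def power_add)
  qed (simp add: P_def m_def)
  have m: "nat \<bar>sum_list bs\<bar> \<le> m bs" for bs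
    by (induction bs) (auto simp: m_def)
  define A where "A = nat \<bar>sum_list as\<bar>"
  assume eq: "leading_product as = 2 powi sum_list as - 2 powi - sum_list as"
  obtain \<sigma> where \<sigma>: "\<sigma> \<in> {1, - 1}" "leading_product as * 2 ^ m as = \<sigma> * of_int (P as)"
    using lp by blast
  obtain \<tau> where \<tau>: "\<tau> \<in> {1, - 1}" "leading_product as * 2 ^ A = \<tau> * of_int (4 ^ A - 1)"
    using factor unfolding eq A_def by blast
  have pm: "x = y \<or> x = - y" if "\<sigma> * x = \<tau> * y" for x y
    using that \<sigma>(1) \<tau>(1) by (elim insertE emptyE) (auto dest: arg_cong[of _ _ uminus])
  have "\<sigma> * of_int (P as * 2 ^ A) = (leading_product as * 2 ^ m as) * 2 ^ A"
    unfolding \<sigma>(2) by simp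
  also have "\<dots> = (leading_product as * 2 ^ A) * 2 ^ m as" by (simp add: mult.commute mult.left_commute)
  also have "\<dots> = \<tau> * of_int ((4 ^ A - 1) * 2 ^ m as)" unfolding \<tau>(2) by simp
  finally have "\<sigma> * of_int (P as * 2 ^ A) = \<tau> * of_int ((4 ^ A - 1) * 2 ^ m as)" .
  from pm[OF this] have "of_int (P as * 2 ^ A) = (of_int ((4 ^ A - 1) * 2 ^ m as) :: complex)
    \<or> of_int (P as * 2 ^ A) = (of_int (- ((4 ^ A - 1) * 2 ^ m as)) :: complex)"
    by simp
  then have "P as * 2 ^ A = (4 ^ A - 1) * 2 ^ m as \<or> P as * 2 ^ A = - ((4 ^ A - 1) * 2 ^ m as)"
    by (simp only: of_int_eq_iff)
  moreover have "0 < P as * 2 ^ A" using P[OF assms(1)] by simp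
  moreover have "(0 :: int) \<le> (4 ^ A - 1) * 2 ^ m as" by simp
  ultimately have "P as * 2 ^ A = (4 ^ A - 1) * 2 ^ m as" by linarith
  also have "(2 :: int) ^ m as = 2 ^ (m as - A) * 2 ^ A"
    using m[of as] by (simp add: A_def flip: power_add)
  finally have PA: "P as = (4 ^ A - 1) * 2 ^ (m as - A)" by simp
  \<comment> \<open>An odd number has no factor 2, so the sum of absolute values equals the absolute
    value of the sum.\<close>
  then have "odd ((2 :: int) ^ (m as - A))" using P[OF assms(1)] by auto
  then have "m as - A = 0" by (metis even_power even_numeral not_gr_zero)
  then have "m as = A" using m[of as] by (simp add: A_def)
  with PA have PA: "P as = 4 ^ m as - 1" by simp
  \<comment> \<open>With at least two factors the product of the numbers 4^k - 1 falls short of 4^m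
    - 1.\<close>
  obtain a b bs where as: "as = a # b # bs"
    using assms(2) by (metis Suc_le_length_iff numeral_2_eq_2)
  have "P as = (4 ^ nat \<bar>a\<bar> - 1) * P (b # bs)" by (simp add: as P_def)
  also have "\<dots> \<le> (4 ^ nat \<bar>a\<bar> - 1) * 4 ^ m (b # bs)"
    using P[of "b # bs"] assms(1) as by (intro mult_left_mono) auto
  also have "\<dots> = 4 ^ m as - 4 ^ m (b # bs)"
    by (simp add: as m_def power_add algebra_simps)
  finally have "(4 :: int) ^ m (b # bs) \<le> 1" using PA by simp
  moreover have "4 ^ 1 \<le> (4 :: int) ^ m (b # bs)"
    using assms(1) as by (intro power_increasing) (auto simp: m_def)
  ultimately show False by simp
qed

lemma two_powi_eq_inverse: "(2 :: complex) powi a = 2 powi - a \<longleftrightarrow> a = 0"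
proof
  assume "(2 :: complex) powi a = 2 powi - a"
  then have "norm ((2 :: complex) powi a) = norm ((2 :: complex) powi - a)" by simp
  then have eq: "(2 :: real) powi a = 2 powi - a" by (simp add: norm_power_int)
  show "a = 0"
    using power_int_strict_increasing[of a "- a" "2 :: real"] power_int_strict_increasing[of "- a" a "2 :: real"] eq
    by (cases a "0 :: int" rule: linorder_cases) auto
qed simp

text \<open>For odd length the trace is nonzero at 1 and -1. If 0 were its only root, it would be a
  monomial and its value at 1 its leading coefficient, which \<open>leading_product_neq\<close>
  excludes.\<close>

lemma exists_good_parameter:
  assumes as: "0 \<notin> set as" "odd (length as)" "3 \<le> length as" "sum_list as \<noteq> 0"
  obtains \<alpha> where "\<alpha> \<noteq> 0" "\<alpha> \<noteq> 1" "\<alpha> \<noteq> - 1" "poly (matrix_trace as) \<alpha> = 0"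
proof -
  have ne: "(2 :: complex) powi sum_list as \<noteq> 2 powi - sum_list as"
    using as(4) by (simp only: two_powi_eq_inverse not_False_eq_True)
  have lp: "leading_product as \<noteq> 0"
    unfolding leading_product_def prod_list_zero_iff
  proof
    assume "0 \<in> set (map (\<lambda>a. 2 powi a - 2 powi - a :: complex) as)"
    then obtain a where a: "a \<in> set as" "(2 :: complex) powi a = 2 powi - a" by auto
    then show False using as(1) by (simp only: two_powi_eq_inverse)
  qed
  have "as \<noteq> []" using as by auto
  then have "degree (matrix_trace as) = length as"
    using matrix_trace_degree[of as] matrix_trace_leading[of as] lp le_degree[of "matrix_trace as" "length as"]
    by simp
  then have lc: "lead_coeff (matrix_trace as) = leading_product as"
    using matrix_trace_leading \<open>as \<noteq> []\<close> by simp
  have v1: "poly (matrix_trace as) 1 = 2 powi sum_list as - 2 powi - sum_list as"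
    and v2: "poly (matrix_trace as) (- 1) = 2 powi - sum_list as - 2 powi sum_list as"
    using as(2) by (simp_all add: matrix_trace_1 matrix_trace_minus_1)
  have "\<exists>\<alpha>. poly (matrix_trace as) \<alpha> = 0 \<and> \<alpha> \<noteq> 0"
  proof (rule ccontr)
    assume "\<not> ?thesis"
    then have "matrix_trace as = monom (leading_product as) (degree (matrix_trace as))"
      using monomial_of_roots_zero[of "matrix_trace as"] lc by auto
    then have "poly (matrix_trace as) 1 = leading_product as"
      by (metis mult.right_neutral poly_monom power_one)
    then show False using leading_product_neq[of as] as v1 by simp
  qed
  then obtain \<alpha> where \<alpha>: "poly (matrix_trace as) \<alpha> = 0" "\<alpha> \<noteq> 0" by blast
  then show ?thesis using that[of \<alpha>] ne v1 v2 by force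
qed

section \<open>Free subgroups for two generators\<close>

text \<open>By Cayley-Hamilton, (A - \<nu>) z and (A - \<mu>) z are fixed by A up to the factors
  \<mu> and \<nu>, and their difference is (\<mu> - \<nu>) z. This avoids choosing eigenvectors, and
  with it any case distinction on the entries.\<close>

lemma two_by_two_power:
  fixes p q r s \<mu> \<nu> :: complex
  assumes "p + s = \<mu> + \<nu>" "p * s - q * r = \<mu> * \<nu>" "\<mu> \<noteq> \<nu>" "\<mu> ^ M = 1" "\<nu> ^ M = 1"
  shows "(\<lambda>(z1, z2). (p * z1 + q * z2, r * z1 + s * z2)) ^^ M = id"
proof -
  let ?G = "\<lambda>(z1, z2). (p * z1 + q * z2, r * z1 + s * z2)"
  have s: "s = \<mu> + \<nu> - p" using assms(1) by (simp add: algebra_simps)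
  have qr: "q * r = p * (\<mu> + \<nu> - p) - \<mu> * \<nu>" using assms(2) s by (simp add: algebra_simps)
  have pow: "(?G ^^ k) ((x1 - y1) / (\<mu> - \<nu>), (x2 - y2) / (\<mu> - \<nu>))
      = ((\<mu> ^ k * x1 - \<nu> ^ k * y1) / (\<mu> - \<nu>), (\<mu> ^ k * x2 - \<nu> ^ k * y2) / (\<mu> - \<nu>))"
    if x: "?G (x1, x2) = (\<mu> * x1, \<mu> * x2)" and y: "?G (y1, y2) = (\<nu> * y1, \<nu> * y2)" for k x1 x2 y1 y2
  proof (induction k)
    case (Suc k)
    have "p * (\<mu> ^ k * x1) + q * (\<mu> ^ k * x2) = \<mu> ^ k * (p * x1 + q * x2)"
      "r * (\<mu> ^ k * x1) + s * (\<mu> ^ k * x2) = \<mu> ^ k * (r * x1 + s * x2)"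
      "p * (\<nu> ^ k * y1) + q * (\<nu> ^ k * y2) = \<nu> ^ k * (p * y1 + q * y2)"
      "r * (\<nu> ^ k * y1) + s * (\<nu> ^ k * y2) = \<nu> ^ k * (r * y1 + s * y2)"
      by (simp_all add: algebra_simps)
    then have e: "p * (\<mu> ^ k * x1) + q * (\<mu> ^ k * x2) = \<mu> ^ Suc k * x1"
      "r * (\<mu> ^ k * x1) + s * (\<mu> ^ k * x2) = \<mu> ^ Suc k * x2"
      "p * (\<nu> ^ k * y1) + q * (\<nu> ^ k * y2) = \<nu> ^ Suc k * y1"
      "r * (\<nu> ^ k * y1) + s * (\<nu> ^ k * y2) = \<nu> ^ Suc k * y2"
      using x y by (simp_all add: mult_ac)
    have "a * ((b - c) / d) + a' * ((b' - c') / d) = ((a * b + a' * b') - (a * c + a' * c')) / d"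
      for a b c a' b' c' d :: complex
      by (simp add: diff_divide_distrib add_divide_distrib algebra_simps)
    then show ?case using Suc by (simp only: funpow.simps comp_apply prod.case e)
  qed simp
  have "(?G ^^ M) (z1, z2) = (z1, z2)" for z1 z2
  proof -
    have 1: "?G (p * z1 + q * z2 - \<nu> * z1, r * z1 + s * z2 - \<nu> * z2)
        = (\<mu> * (p * z1 + q * z2 - \<nu> * z1), \<mu> * (r * z1 + s * z2 - \<nu> * z2))"
      and 2: "?G (p * z1 + q * z2 - \<mu> * z1, r * z1 + s * z2 - \<mu> * z2)
        = (\<nu> * (p * z1 + q * z2 - \<mu> * z1), \<nu> * (r * z1 + s * z2 - \<mu> * z2))"
      using qr unfolding s prod.case prod.inject by algebra+
    have z: "((p * z1 + q * z2 - \<nu> * z1) - (p * z1 + q * z2 - \<mu> * z1)) / (\<mu> - \<nu>) = z1"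
      "((r * z1 + s * z2 - \<nu> * z2) - (r * z1 + s * z2 - \<mu> * z2)) / (\<mu> - \<nu>) = z2"
      using assms(3) by (simp_all add: field_simps)
    show ?thesis
      using pow[OF 1 2, of M] unfolding assms(4,5) mult_1 z .
  qed
  then show ?thesis by auto
qed

context redundant_cyclic_presentation
begin

text \<open>The relator becomes F^M t^-M, where F has eigenvalues \<mu> and \<nu>. The minus sign in
  the determinant condition comes from the odd number of involutions in F.\<close>

lemma contains_nonabelian_free_of_parameter:
  assumes n: "n = 2" and as: "odd (length as)" and M: "even M"
    and wv: "cyclic_permutation w (concat (map (\<lambda>j. (theta 2 ^^ j) (alternating 0 as)) [0..<M]))"
    and \<alpha>: "\<alpha> \<noteq> 0" "\<alpha> \<noteq> 1" "\<alpha> \<noteq> - 1" and \<zeta>: "\<zeta> \<noteq> 0"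
    and tr: "\<zeta> powi sum_list as * poly (matrix_trace as) \<alpha> = \<mu> + \<nu>"
    and det: "(\<zeta> powi sum_list as)\<^sup>2 = - \<mu> * \<nu>"
    and \<mu>\<nu>: "\<mu> \<noteq> \<nu>" "\<mu> ^ M = 1" "\<nu> ^ M = 1"
  shows "contains_nonabelian_free_subgroup (presented_group (cyclic_presentation n w))"
proof -
  define x where "x = scale (2 * \<zeta>) (\<zeta> / 2)"
  define t where "t = involution \<alpha>"
  define c where "c = \<zeta> powi sum_list as"
  define F where "F = foldr (\<lambda>a y. x [^]\<^bsub>perms\<^esub> a \<otimes>\<^bsub>perms\<^esub> (t \<otimes>\<^bsub>perms\<^esub> y)) as \<one>\<^bsub>perms\<^esub>"
  have x: "x \<in> carrier perms" unfolding x_def using scale_inverse(1)[of "2 * \<zeta>" "\<zeta> / 2"] \<zeta> by simp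
  have t: "t \<in> carrier perms" by (simp add: t_def)
  have tt: "t \<otimes>\<^bsub>perms\<^esub> t = \<one>\<^bsub>perms\<^esub>" by (simp add: t_def involution_involution)
  obtain p q r s where e: "matrix_entries as = (p, q, r, s)" by (metis prod_cases4)
  have F_eq: "F = (\<lambda>(z1, z2). (c * poly p \<alpha> * z1 + c * poly q \<alpha> * z2, c * poly r \<alpha> * z1 + c * poly s \<alpha> * z2))"
    unfolding F_def x_def t_def c_def
    using matrix_entries_action[OF \<zeta> e, of \<alpha>] by (auto simp: fun_eq_iff algebra_simps)
  have F: "F ^^ M = id"
    unfolding F_eq
  proof (rule two_by_two_power[OF _ _ \<mu>\<nu>])
    show "c * poly p \<alpha> + c * poly s \<alpha> = \<mu> + \<nu>"
      using tr e by (simp add: c_def matrix_trace_def distrib_left)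
    have "poly p \<alpha> * poly s \<alpha> - poly q \<alpha> * poly r \<alpha> = - 1"
      using matrix_entries_det[OF e] as by simp
    moreover have "c * poly p \<alpha> * (c * poly s \<alpha>) - c * poly q \<alpha> * (c * poly r \<alpha>)
      = c\<^sup>2 * (poly p \<alpha> * poly s \<alpha> - poly q \<alpha> * poly r \<alpha>)"
      by (simp add: power2_eq_square algebra_simps)
    ultimately show "c * poly p \<alpha> * (c * poly s \<alpha>) - c * poly q \<alpha> * (c * poly r \<alpha>) = \<mu> * \<nu>"
      using det by (simp add: c_def)
  qed
  let ?\<phi> = "half_turn perms x t"
  define u where "u = alternating 0 as"
  define v where "v = concat (map (\<lambda>j. (theta 2 ^^ j) u) [0..<M])"
  have u: "u \<in> lists ({..<2} \<times> UNIV)" unfolding u_def by (rule alternating_lists) simp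
  have v: "v \<in> lists ({..<2} \<times> UNIV)"
    using theta_funpow_lists[OF u] unfolding v_def by (fastforce simp: lists_eq_set)
  have t_even: "t ^^ (2 * k) = id" for k
    using tt by (induction k) (simp_all add: comp_assoc[symmetric])
  have tM: "t ^^ M = id" using M t_even by (metis evenE)
  obtain k where "length as = Suc (2 * k)" using as by (metis oddE Suc_eq_plus1)
  then have tl: "t ^^ length as = t" using t_even[of k] by simp
  have "word_value perms ?\<phi> u \<circ> t = F"
    using perms.word_value_half_turn_alternating[OF x t tt, of 0 as] tl
    by (simp add: u_def F_def nat_pow_perms)
  then have "word_value perms ?\<phi> v = id"
    using perms.word_value_half_turn_concat[OF x t tt u, of M] tM F
    by (simp add: v_def nat_pow_perms)
  then have rel: "word_value perms ?\<phi> r = \<one>\<^bsub>perms\<^esub>" if "r \<in> set (snd (cyclic_presentation n w))" for r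
    using perms.word_value_cyclic_permutation[OF perms.half_turn_closed[OF x t tt] v]
      relator_cyclic_permutation[OF n _ that] wv by (simp add: v_def u_def)
  obtain N :: int where N: "\<forall>v. reduced v \<longrightarrow> v \<noteq> [] \<longrightarrow>
    word_value perms (\<lambda>b. if b then x [^]\<^bsub>perms\<^esub> N else t \<circ> x [^]\<^bsub>perms\<^esub> N \<circ> t) v \<noteq> \<one>\<^bsub>perms\<^esub>"
    using scale_involution_free[OF \<alpha> \<zeta>, folded x_def t_def] by blast
  show ?thesis
  proof (rule contains_nonabelian_freeI[OF group_perms _ rel])
    show "?\<phi> \<in> fst (cyclic_presentation n w) \<rightarrow> carrier perms"
      using perms.half_turn_closed[OF x t tt] unfolding generators unfolding n .
    let ?\<alpha> = "\<lambda>b. syllable (if b then 0 else 1 :: nat) N"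
    have sl: "syllable 0 N \<in> lists ({..<2 :: nat} \<times> UNIV)" by (rule syllable_lists) simp
    show "?\<alpha> b \<in> lists (fst (cyclic_presentation n w) \<times> UNIV)" for b
      unfolding generators unfolding n by (rule syllable_lists) simp
    have "syllable 1 N = theta 2 (syllable 0 N)" by (simp add: syllable_def theta_def)
    then have "word_value perms ?\<phi> (syllable 1 N) = t \<circ> x [^]\<^bsub>perms\<^esub> N \<circ> t"
      using perms.word_value_half_turn_theta[OF x t tt sl]
        perms.word_value_syllable[of ?\<phi> 0 N] x by (simp add: half_turn_def)
    moreover have "word_value perms ?\<phi> (syllable 0 N) = x [^]\<^bsub>perms\<^esub> N"
      using perms.word_value_syllable[of ?\<phi> 0 N] x by (simp add: half_turn_def)
    ultimately have "(\<lambda>b. word_value perms ?\<phi> (?\<alpha> b)) = (\<lambda>b. if b then x [^]\<^bsub>perms\<^esub> N else t \<circ> x [^]\<^bsub>perms\<^esub> N \<circ> t)"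
      by auto
    then show "word_value perms (\<lambda>b. word_value perms ?\<phi> (?\<alpha> b)) v \<noteq> \<one>\<^bsub>perms\<^esub>"
      if "reduced v" "v \<noteq> []" for v using N that by simp
  qed
qed

text \<open>Trace 0 and determinant -1 give the eigenvalues 1 and -1, whose M-th powers are 1
  because M is even.\<close>

lemma contains_nonabelian_free_of_length_ge_3:
  assumes n: "n = 2" and as: "0 \<notin> set as" "odd (length as)" "3 \<le> length as" "sum_list as \<noteq> 0" and M: "even M"
    and wv: "cyclic_permutation w (concat (map (\<lambda>j. (theta 2 ^^ j) (alternating 0 as)) [0..<M]))"
  shows "contains_nonabelian_free_subgroup (presented_group (cyclic_presentation n w))"
proof -
  obtain \<alpha> where \<alpha>: "\<alpha> \<noteq> 0" "\<alpha> \<noteq> 1" "\<alpha> \<noteq> - 1" "poly (matrix_trace as) \<alpha> = 0"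
    using exists_good_parameter[OF as] by blast
  show ?thesis
    by (rule contains_nonabelian_free_of_parameter[OF n as(2) M wv \<alpha>(1-3), of 1 1 "- 1"])
       (use \<alpha> M in simp_all)
qed

text \<open>Here the trace is \<alpha> (2^a - 2^-a), so the eigenvalues 1 and -1 would need the
  forbidden parameter 0. The pair exp(2 pi i / M) and -1 is used instead; it is distinct since M >=
  4.\<close>

lemma contains_nonabelian_free_of_power:
  assumes n: "n = 2" and a: "a \<noteq> 0" and M: "even M" "4 \<le> M"
    and wv: "cyclic_permutation w (concat (map (\<lambda>j. (theta 2 ^^ j) (alternating 0 [a])) [0..<M]))"
  shows "contains_nonabelian_free_subgroup (presented_group (cyclic_presentation n w))"
proof -
  define x where "x = pi / real M"
  have x: "0 < x" "2 * x \<le> pi / 2" "real M * (2 * x) = 2 * pi"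
    using M(2) by (auto simp: x_def field_simps)
  then have "sin x > 0" by (intro sin_gt_zero) (use pi_gt_zero in linarith)+
  define d where "d = (2 :: real) powi a - 2 powi - a"
  have "d \<noteq> 0"
    using two_powi_eq_inverse[of a] a unfolding d_def
    by (metis eq_iff_diff_eq_0 of_real_minus of_real_numeral of_real_power_int)
  \<comment> \<open>The determinant asks for \<zeta>^a = exp(i x), and exp(2 i x) - 1 = exp(i x) 2 i
    sin x. So the trace apart from \<zeta> is purely imaginary and nonzero, which keeps \<alpha>
    away from 0, 1, -1.\<close>
  define \<alpha> where "\<alpha> = Complex 0 (2 * sin x / d)"
  have \<alpha>: "\<alpha> \<noteq> 0" "\<alpha> \<noteq> 1" "\<alpha> \<noteq> - 1"
    using \<open>d \<noteq> 0\<close> \<open>sin x > 0\<close> by (auto simp: \<alpha>_def complex_eq_iff)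
  define \<zeta> where "\<zeta> = cis (x / real_of_int a)"
  have \<zeta>a: "\<zeta> powi a = cis x" using a by (simp add: \<zeta>_def cis_power_int)
  have "(2 :: complex) powi a - 2 powi - a = of_real d" by (simp add: d_def)
  moreover have "poly (matrix_trace [a]) \<alpha> = \<alpha> * (2 powi a - 2 powi - a)"
    by (simp add: matrix_trace_def algebra_simps)
  ultimately have tr: "poly (matrix_trace [a]) \<alpha> = Complex 0 (2 * sin x)"
    using \<open>d \<noteq> 0\<close> by (simp add: \<alpha>_def complex_eq_iff)
  have cis2: "cis x * cis x = cis (2 * x)" by (simp add: cis_mult)
  show ?thesis
  proof (rule contains_nonabelian_free_of_parameter[OF n _ M(1) wv \<alpha>, of \<zeta> "cis (2 * x)" "- 1"])
    have "cis x * Complex 0 (2 * sin x) = cis (2 * x) - 1"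
      using sin_cos_squared_add[of x] unfolding cis2[symmetric]
      by (simp add: complex_eq_iff power2_eq_square)
    then show "\<zeta> powi sum_list [a] * poly (matrix_trace [a]) \<alpha> = cis (2 * x) + - 1"
      using \<zeta>a tr by simp
    show "(\<zeta> powi sum_list [a])\<^sup>2 = - cis (2 * x) * - 1"
      using \<zeta>a cis2 by (simp add: power2_eq_square)
    have "0 \<le> cos (2 * x)" using x by (intro cos_ge_zero) auto
    then show "cis (2 * x) \<noteq> - 1" by (auto simp: complex_eq_iff)
    show "cis (2 * x) ^ M = 1" unfolding DeMoivre x(3) by (rule cis_2pi)
  qed (use M(1) in \<open>simp_all add: \<zeta>_def\<close>)
qed

text \<open>Conjugate the inverse shift by a fibrewise map of period |a|: the conjugating map
  commutes with the a-th power of the shift, so x_0^a x_1^a acts trivially. The product x_0 x_1 acts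
  on the fibre at s by \<delta>(s - 1)^-1 \<delta>(s).\<close>

lemma contains_nonabelian_free_of_ge_3_exponent:
  assumes n: "n = 2" and a: "3 \<le> \<bar>a\<bar>"
    and wv: "cyclic_permutation w (syllable 0 a @ syllable 1 a)"
  shows "contains_nonabelian_free_subgroup (presented_group (cyclic_presentation n w))"
proof -
  define y where "y b = letter_action (b :: bool, True)" for b
  \<comment> \<open>Two residues carry free generators and a third carries the identity next to each
    of them, which is where |a| >= 3 enters.\<close>
  define \<delta> where "\<delta> s = (if s mod \<bar>a\<bar> = 1 then y True else if s mod \<bar>a\<bar> = 2 then y False else id)" for s :: int
  have \<delta>: "bij (\<delta> s)" for s by (simp add: \<delta>_def y_def)
  define \<sigma> where "\<sigma> = skew_action (\<lambda>_. 1) (\<lambda>_ _. id :: bool word \<Rightarrow> _) ()"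
  define \<Delta> where "\<Delta> = skew_action (\<lambda>_. 0) (\<lambda>_. \<delta>) ()"
  have \<sigma>: "bij \<sigma>" unfolding \<sigma>_def by (rule skew_action_inverse) simp
  have \<Delta>: "bij \<Delta>" "inv\<^bsub>perms\<^esub> \<Delta> = (\<lambda>(s, x). (s, (inv\<^bsub>perms\<^esub> (\<delta> s)) x))"
    unfolding \<Delta>_def using skew_action_inverse[of "\<lambda>_. \<delta>" "()" "\<lambda>_. 0"] \<delta> by auto
  have \<Delta>_apply: "\<Delta> (s, x) = (s, \<delta> s x)" for s x by (simp add: \<Delta>_def skew_action_def)
  have \<sigma>_pow: "(\<sigma> [^]\<^bsub>perms\<^esub> (k :: int)) (s, x) = (s + k, x)" for k s x
    unfolding \<sigma>_def by (rule skew_action_shift) simp_all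
  define \<tau> where "\<tau> = inv\<^bsub>perms\<^esub> \<Delta> \<circ> inv\<^bsub>perms\<^esub> \<sigma> \<circ> \<Delta>"
  have \<tau>: "bij \<tau>" using \<sigma> \<Delta>(1) by (simp add: \<tau>_def bij_comp)
  have \<tau>_pow: "\<tau> [^]\<^bsub>perms\<^esub> (k :: int) = inv\<^bsub>perms\<^esub> \<Delta> \<circ> \<sigma> [^]\<^bsub>perms\<^esub> (- k) \<circ> \<Delta>" for k
  proof -
    have "(\<lambda>g. inv\<^bsub>perms\<^esub> \<Delta> \<circ> g \<circ> \<Delta>) \<in> hom perms perms"
      by (rule homI) (use \<Delta>(1) in \<open>simp_all add: bij_comp fun_eq_iff\<close>)
    from hom_int_pow[OF this, of "inv\<^bsub>perms\<^esub> \<sigma>" k] \<sigma> show ?thesis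
      by (simp add: \<tau>_def perms.int_pow_inv perms.int_pow_neg group_perms)
  qed
  define \<phi> where "\<phi> i = (if i = 0 then \<sigma> else \<tau>)" for i :: nat
  have \<phi>: "\<phi> \<in> {..<2} \<rightarrow> carrier perms" using \<sigma> \<tau> by (simp add: \<phi>_def)
  have \<phi>_syl: "word_value perms \<phi> (syllable 0 k) = \<sigma> [^]\<^bsub>perms\<^esub> k" "word_value perms \<phi> (syllable 1 k) = \<tau> [^]\<^bsub>perms\<^esub> k" for k
    using perms.word_value_syllable[of \<phi>] \<sigma> \<tau> by (simp_all add: \<phi>_def)
  note \<phi>_syl = \<phi>_syl \<phi>_syl(2)[unfolded One_nat_def]
  have sl: "syllable i k \<in> lists ({..<2} \<times> UNIV)" if "i < 2" for i :: nat and k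
    using that by (intro syllable_lists) simp
  have append: "word_value perms \<phi> (u @ v) = word_value perms \<phi> u \<circ> word_value perms \<phi> v"
    if "u \<in> lists ({..<2} \<times> UNIV)" "v \<in> lists ({..<2} \<times> UNIV)" for u v
    using perms.word_value_append[OF \<phi> that] by simp
  have period: "\<delta> (s - a) = \<delta> s" for s
  proof -
    have "(s - a) mod \<bar>a\<bar> = s mod \<bar>a\<bar>" by (simp add: mod_eq_dvd_iff)
    then show ?thesis by (simp add: \<delta>_def)
  qed
  have "word_value perms \<phi> (syllable 0 a @ syllable 1 a) = \<one>\<^bsub>perms\<^esub>"
    using append[OF sl sl, of 0 1 a a] \<sigma>_pow \<delta>
    by (auto simp: \<phi>_syl \<tau>_pow \<Delta>(2) \<Delta>_apply period fun_eq_iff)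
  then have rel: "word_value perms \<phi> r = \<one>\<^bsub>perms\<^esub>" if "r \<in> set (snd (cyclic_presentation n w))" for r
    using perms.word_value_cyclic_permutation[OF \<phi> _ relator_cyclic_permutation[OF n wv that]] sl by simp
  define u where "u = syllable 0 1 @ syllable (1 :: nat) 1"
  have u: "u \<in> lists ({..<2} \<times> UNIV)" unfolding u_def using sl by simp
  have u_val: "word_value perms \<phi> u (s, x) = (s, (inv\<^bsub>perms\<^esub> (\<delta> (s - 1))) (\<delta> s x))" for s x
    using append[OF sl sl, of 0 1 1 1] \<sigma>_pow \<delta>
    by (simp add: u_def \<phi>_syl \<tau>_pow \<Delta>(2) \<Delta>_apply)
  show ?thesis
  \<comment> \<open>Position 1 reads \<delta>(0)^-1 \<delta>(1), the first generator; conjugation by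
    x_0^2 moves to position 3 and reads \<delta>(2)^-1 \<delta>(3), the inverse of the
    second.\<close>
  proof (rule contains_nonabelian_free_fibreI[OF _ rel, where s = 1
        and \<alpha> = "\<lambda>b. if b then u else syllable 0 (- 2) @ u @ syllable 0 2"
        and B = "\<lambda>b. letter_action (b, True) [^]\<^bsub>perms\<^esub> (if b then 1 else - 1 :: int)"])
    show "bij (\<phi> i)" for i using \<sigma> \<tau> by (simp add: \<phi>_def)
    show "(if b then u else syllable 0 (- 2) @ u @ syllable 0 2) \<in> lists (fst (cyclic_presentation n w) \<times> UNIV)" for b
      unfolding generators unfolding n using u sl by simp
    \<comment> \<open>If |a| = 3, position 3 wraps around to residue 0, where \<delta> is again the
      identity.\<close>
    have \<delta>_val: "\<delta> 0 = id" "\<delta> 1 = y True" "\<delta> 2 = y False" "\<delta> 3 = id"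
    proof -
      have "3 mod \<bar>a\<bar> = 3 \<or> 3 mod \<bar>a\<bar> = 0" using a by (cases "\<bar>a\<bar> = 3") auto
      then show "\<delta> 0 = id" "\<delta> 1 = y True" "\<delta> 2 = y False" "\<delta> 3 = id"
        using a by (auto simp: \<delta>_def)
    qed
    have inv_id: "inv\<^bsub>perms\<^esub> id = (id :: bool word \<Rightarrow> _)" using perms.inv_one by simp
    show "word_value perms \<phi> (if b then u else syllable 0 (- 2) @ u @ syllable 0 2) (1, x)
      = (1, (letter_action (b, True) [^]\<^bsub>perms\<^esub> (if b then 1 else - 1 :: int)) x)" for b x
    proof (cases b)
      case True
      then show ?thesis by (simp add: u_val \<delta>_val inv_id y_def)
    next
      case False
      have "word_value perms \<phi> (syllable 0 (- 2) @ u @ syllable 0 2) (1, x) = (1, (inv\<^bsub>perms\<^esub> (y False)) x)"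
        using append[OF sl, of 0 "u @ syllable 0 2" "- 2"] append[OF u sl, of 0 2] u sl[of 0 2]
        by (simp add: \<phi>_syl \<sigma>_pow u_val \<delta>_val)
      then show ?thesis
        using False perms.int_pow_neg[of "letter_action (False, True)" 1] by (simp add: y_def)
    qed
    show "word_value perms (\<lambda>b. letter_action (b, True) [^]\<^bsub>perms\<^esub> (if b then 1 else - 1 :: int)) v \<noteq> \<one>\<^bsub>perms\<^esub>"
      if "reduced v" "v \<noteq> []" for v :: "bool word"
      by (rule letter_action_powers_free) (use that in auto)
  qed (assumption | rule bij_int_pow_perms[OF bij_letter_action])+
qed

lemma contains_nonabelian_free_or_exceptional:
  assumes "cyclically_reduced w"
  shows "contains_nonabelian_free_subgroup (presented_group (cyclic_presentation n w)) \<or>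
    n = 2 \<and> ((\<exists>\<epsilon>. cyclic_permutation w [(0, \<epsilon>), (1, \<epsilon>)]) \<or>
             (\<exists>\<epsilon>. cyclic_permutation w [(0, \<epsilon>), (0, \<epsilon>), (1, \<epsilon>), (1, \<epsilon>)]))"
proof (cases "n = 2")
  case False
  obtain d where "0 < d" "d < n" "d dvd n" "cyclic_permutation w ((theta n ^^ d) w)"
    by (rule symmetry_exponent)
  \<comment> \<open>The proper nonzero shift exponent excludes n = 1.\<close>
  then have "3 \<le> n" using False by auto
  then show ?thesis using contains_nonabelian_free_of_ge_3 by blast
next
  case n: True
  obtain as M where as: "0 \<notin> set as" "odd (length as)" and M: "even M" "0 < M"
    and wv: "cyclic_permutation w (concat (map (\<lambda>j. (theta 2 ^^ j) (alternating 0 as)) [0..<M]))"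
    using half_turn_decomposition[OF n assms] by blast
  consider "sum_list as = 0" | "sum_list as \<noteq> 0" "3 \<le> length as" | a where "as = [a]"
  proof (cases "3 \<le> length as")
    case False
    then have "length as = 1" using as(2) by presburger
    then show ?thesis using that(3) by (auto simp: length_Suc_conv)
  qed (use that in blast)
  then show ?thesis
  proof cases
    case 1
    then show ?thesis using contains_nonabelian_free_of_sum_zero[OF n M(1) wv] by blast
  next
    case 2
    then show ?thesis using contains_nonabelian_free_of_length_ge_3[OF n as _ _ M(1) wv] by blast
  next
    case 3
    then have a: "a \<noteq> 0" using as by auto
    show ?thesis
    proof (cases "4 \<le> M")
      case True
      then show ?thesis using contains_nonabelian_free_of_power[OF n a M(1)] wv 3 by blast
    next
      case False
      then have M2: "M = 2" using M by presburger
      have "theta 2 (syllable 0 a) = syllable 1 a" by (simp add: theta_def syllable_def)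
      then have wa: "cyclic_permutation w (syllable 0 a @ syllable 1 a)"
        using wv by (simp add: 3 M2 numeral_2_eq_2)
      consider "3 \<le> \<bar>a\<bar>" | "\<bar>a\<bar> = 1" | "\<bar>a\<bar> = 2" using a by linarith
      then show ?thesis
      proof cases
        case 1
        then show ?thesis using contains_nonabelian_free_of_ge_3_exponent[OF n _ wa] by blast
      next
        case 2
        then show ?thesis using wa n by (auto simp: syllable_def)
      next
        case 3
        then show ?thesis using wa n by (auto simp: syllable_def numeral_2_eq_2)
      qed
    qed
  qed
qed

end

section \<open>The exceptional presentations\<close>

text \<open>For negative \<epsilon> the relator is the inverse of the positive one with its two
  halves exchanged, and exchanging them is a conjugation.\<close>

lemma (in group) word_value_exceptional:
  assumes "\<phi> 0 \<in> carrier G" "\<phi> 1 \<in> carrier G"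
  shows "word_value G \<phi> [(0, \<epsilon>), (1, \<epsilon>)] = \<one> \<longleftrightarrow> \<phi> 0 \<otimes> \<phi> 1 = \<one>"
    and "word_value G \<phi> [(0, \<epsilon>), (0, \<epsilon>), (1, \<epsilon>), (1, \<epsilon>)] = \<one> \<longleftrightarrow>
      \<phi> 0 \<otimes> \<phi> 0 \<otimes> (\<phi> 1 \<otimes> \<phi> 1) = \<one>"
proof -
  have inv_flip: "inv a \<otimes> inv b = \<one> \<longleftrightarrow> a \<otimes> b = \<one>" if "a \<in> carrier G" "b \<in> carrier G" for a b
    using that by (metis inv_comm inv_inv inv_one inv_mult_group inv_closed)
  show "word_value G \<phi> [(0, \<epsilon>), (1, \<epsilon>)] = \<one> \<longleftrightarrow> \<phi> 0 \<otimes> \<phi> 1 = \<one>"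
    using assms inv_flip[of "\<phi> 0" "\<phi> 1"] by (cases \<epsilon>) simp_all
  show "word_value G \<phi> [(0, \<epsilon>), (0, \<epsilon>), (1, \<epsilon>), (1, \<epsilon>)] = \<one> \<longleftrightarrow>
      \<phi> 0 \<otimes> \<phi> 0 \<otimes> (\<phi> 1 \<otimes> \<phi> 1) = \<one>"
    using assms inv_flip[of "\<phi> 0 \<otimes> \<phi> 0" "\<phi> 1 \<otimes> \<phi> 1"]
    by (cases \<epsilon>) (simp_all add: inv_mult_group m_assoc)
qed

context redundant_cyclic_presentation
begin

text \<open>All relators are rotations of \<open>v\<close>, and \<open>w\<close> is one of them, so
  the presentation amounts to the single relator \<open>v\<close>.\<close>

lemma word_value_relator_iff:
  assumes "group K" "n = 2" "cyclic_permutation w v" "\<phi> \<in> {..<2} \<rightarrow> carrier K"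
  shows "(\<forall>r\<in>set (snd (cyclic_presentation n w)). word_value K \<phi> r = \<one>\<^bsub>K\<^esub>) \<longleftrightarrow> word_value K \<phi> v = \<one>\<^bsub>K\<^esub>"
proof -
  interpret K: group K by (rule assms(1))
  have w: "w \<in> lists ({..<2} \<times> UNIV)" using w_lists assms(2) by simp
  have v: "v \<in> lists ({..<2} \<times> UNIV)"
    using cyclic_permutation_set[OF assms(3)] w by (simp add: lists_eq_set)
  have "(theta n ^^ 0) w \<in> set (snd (cyclic_presentation n w))"
    unfolding relators_iff using assms(2) by (intro exI[of _ 0]) simp
  then have "w \<in> set (snd (cyclic_presentation n w))" by simp
  then show ?thesis
    using K.word_value_cyclic_permutation[OF assms(4) v relator_cyclic_permutation[OF assms(2,3)]]
      K.word_value_cyclic_permutation[OF assms(4) w cyclic_permutation_sym[OF assms(3)]] by blast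
qed

lemma iso_integer_group:
  assumes n: "n = 2" and w: "cyclic_permutation w [(0, \<epsilon>), (1, \<epsilon>)]"
  shows "presented_group (cyclic_presentation n w) \<cong> integer_group"
proof -
  let ?P = "cyclic_presentation n w"
  interpret G: group "presented_group ?P" by (rule group_presented)
  define \<phi> :: "nat \<Rightarrow> int" where "\<phi> i = (if i = 0 then 1 else - 1)" for i
  have \<phi>: "\<phi> \<in> {..<2} \<rightarrow> carrier integer_group" by simp
  have "word_value integer_group \<phi> [(0, \<epsilon>), (1, \<epsilon>)] = \<one>\<^bsub>integer_group\<^esub>"
    using group.word_value_exceptional(1)[OF group_integer_group, of \<phi> \<epsilon>]
    by (simp add: \<phi>_def)
  then have rel: "word_value integer_group \<phi> r = \<one>\<^bsub>integer_group\<^esub>" if "r \<in> set (snd ?P)" for r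
    using word_value_relator_iff[OF group_integer_group n w \<phi>] that by blast
  obtain h where h: "h \<in> hom (presented_group ?P) integer_group"
    "\<And>i. i \<in> fst ?P \<Longrightarrow> h (presented_gen ?P i) = \<phi> i"
    using von_dyck[OF group_integer_group _ rel] \<phi> generators n by metis
  let ?x = "presented_gen ?P"
  have x: "?x \<in> {..<2} \<rightarrow> carrier (presented_group ?P)"
    using presented_gen_closed unfolding generators unfolding n .
  then have x01: "?x 0 \<in> carrier (presented_group ?P)" "?x 1 \<in> carrier (presented_group ?P)" by auto
  have "word_value (presented_group ?P) ?x [(0, \<epsilon>), (1, \<epsilon>)] = \<one>\<^bsub>presented_group ?P\<^esub>"
    using word_value_relator_iff[OF group_presented n w x] word_value_relator by blast
  then have "?x 0 \<otimes>\<^bsub>presented_group ?P\<^esub> ?x 1 = \<one>\<^bsub>presented_group ?P\<^esub>"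
    using G.word_value_exceptional(1)[of ?x \<epsilon>] x01 by simp
  then have x1: "?x 1 = inv\<^bsub>presented_group ?P\<^esub> ?x 0"
    using x01 G.inv_equality G.inv_comm by metis
  define k where "k j = ?x 0 [^]\<^bsub>presented_group ?P\<^esub> j" for j :: int
  show ?thesis
  proof (rule iso_of_inverse_homs[OF h(1)])
    show "k \<in> hom integer_group (presented_group ?P)"
      using x01 by (auto simp: hom_def k_def G.int_pow_mult)
    have h0: "h (?x 0) = 1" "h (?x 1) = - 1" using h(2)[of 0] h(2)[of 1] unfolding generators unfolding n by (simp_all add: \<phi>_def)
    show "k (h (?x i)) = ?x i" if "i \<in> fst ?P" for i
    proof -
      have "i = 0 \<or> i = 1" using that unfolding generators unfolding n by auto
      then show ?thesis
        using h0 x01 x1 G.int_pow_neg[of "?x 0" 1] by (auto simp: k_def)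
    qed
    show "h (k j) = j" if "j \<in> carrier integer_group" for j
      using hom_int_pow[OF h(1) x01(1) group_presented group_integer_group, of j] h0 by (simp add: k_def)
  qed
qed

text \<open>Substitute b = x_0 and a = x_0 x_1: then b a b^-1 a becomes x_0^2 x_1^2. The inverse
  substitution is x_0 = b, x_1 = b^-1 a.\<close>

lemma iso_klein_bottle_group:
  assumes n: "n = 2" and w: "cyclic_permutation w [(0, \<epsilon>), (0, \<epsilon>), (1, \<epsilon>), (1, \<epsilon>)]"
  shows "presented_group (cyclic_presentation n w) \<cong> klein_bottle_group"
proof -
  let ?P = "cyclic_presentation n w"
  define Q :: "nat presentation" where
    "Q = ({0, 1}, [[(1, True), (0, True), (1, False), (0, True)]])"
  have K: "klein_bottle_group = presented_group Q" by (simp add: klein_bottle_group_def Q_def)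
  interpret Q: presentation Q
    by standard (simp add: Q_def free_group_carrier reduced_def inv_letter_def)
  have Q_sel: "fst Q = {0, 1}" "snd Q = [[(1, True), (0, True), (1, False), (0, True)]]"
    by (simp_all add: Q_def)
  interpret G: group "presented_group ?P" by (rule group_presented)
  interpret H: group "presented_group Q" by (rule Q.group_presented)
  let ?x = "presented_gen ?P" and ?y = "presented_gen Q"
  have x: "?x \<in> {..<2} \<rightarrow> carrier (presented_group ?P)"
    using presented_gen_closed unfolding generators unfolding n .
  then have x01: "?x 0 \<in> carrier (presented_group ?P)" "?x 1 \<in> carrier (presented_group ?P)" by auto
  have y01: "?y 0 \<in> carrier (presented_group Q)" "?y 1 \<in> carrier (presented_group Q)"
    using Q.presented_gen_closed by (auto simp: Q_sel)
  have "word_value (presented_group ?P) ?x [(0, \<epsilon>), (0, \<epsilon>), (1, \<epsilon>), (1, \<epsilon>)] = \<one>\<^bsub>presented_group ?P\<^esub>"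
    using word_value_relator_iff[OF group_presented n w x] word_value_relator by blast
  then have xrel: "?x 0 \<otimes>\<^bsub>presented_group ?P\<^esub> ?x 0 \<otimes>\<^bsub>presented_group ?P\<^esub>
      (?x 1 \<otimes>\<^bsub>presented_group ?P\<^esub> ?x 1) = \<one>\<^bsub>presented_group ?P\<^esub>"
    using G.word_value_exceptional(2)[of ?x \<epsilon>] x01 by simp
  have yrel: "?y 1 \<otimes>\<^bsub>presented_group Q\<^esub> (?y 0 \<otimes>\<^bsub>presented_group Q\<^esub>
      (inv\<^bsub>presented_group Q\<^esub> (?y 1) \<otimes>\<^bsub>presented_group Q\<^esub> ?y 0)) = \<one>\<^bsub>presented_group Q\<^esub>"
    using Q.word_value_relator[of "[(1, True), (0, True), (1, False), (0, True)]"] y01 by (simp add: Q_sel)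
  define \<phi> where "\<phi> i = (if i = 0 then ?y 1 else inv\<^bsub>presented_group Q\<^esub> (?y 1) \<otimes>\<^bsub>presented_group Q\<^esub> ?y 0)" for i :: nat
  define \<psi> where "\<psi> i = (if i = 0 then ?x 0 \<otimes>\<^bsub>presented_group ?P\<^esub> ?x 1 else ?x 0)" for i :: nat
  have \<phi>: "\<phi> \<in> {..<2} \<rightarrow> carrier (presented_group Q)" using y01 by (simp add: \<phi>_def)
  have \<psi>: "\<psi> \<in> fst Q \<rightarrow> carrier (presented_group ?P)" using x01 by (simp add: \<psi>_def)
  have "word_value (presented_group Q) \<phi> [(0, \<epsilon>), (0, \<epsilon>), (1, \<epsilon>), (1, \<epsilon>)] = \<one>\<^bsub>presented_group Q\<^esub>"
    using H.word_value_exceptional(2)[of \<phi> \<epsilon>] yrel y01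
    by (simp add: \<phi>_def H.m_assoc) (simp flip: H.m_assoc)
  then have rel: "word_value (presented_group Q) \<phi> r = \<one>\<^bsub>presented_group Q\<^esub>" if "r \<in> set (snd ?P)" for r
    using word_value_relator_iff[OF Q.group_presented n w \<phi>] that by blast
  have \<phi>': "\<phi> \<in> fst ?P \<rightarrow> carrier (presented_group Q)" using \<phi> unfolding generators unfolding n .
  obtain h where h: "h \<in> hom (presented_group ?P) (presented_group Q)"
    "\<And>i. i \<in> fst ?P \<Longrightarrow> h (presented_gen ?P i) = \<phi> i"
    using von_dyck[OF Q.group_presented \<phi>' rel] by metis
  have rel': "word_value (presented_group ?P) \<psi> r = \<one>\<^bsub>presented_group ?P\<^esub>" if "r \<in> set (snd Q)" for r
  proof -
    have "inv\<^bsub>presented_group ?P\<^esub> (?x 0) \<otimes>\<^bsub>presented_group ?P\<^esub> (?x 0 \<otimes>\<^bsub>presented_group ?P\<^esub> ?x 1) = ?x 1"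
      using x01 by (simp flip: G.m_assoc)
    then show ?thesis
      using that x01 xrel by (simp add: Q_sel \<psi>_def G.m_assoc)
  qed
  obtain k where k: "k \<in> hom (presented_group Q) (presented_group ?P)"
    "\<And>i. i \<in> fst Q \<Longrightarrow> k (?y i) = \<psi> i"
    using Q.von_dyck[OF group_presented \<psi> rel'] by metis
  have h01: "h (?x 0) = ?y 1" "h (?x 1) = inv\<^bsub>presented_group Q\<^esub> (?y 1) \<otimes>\<^bsub>presented_group Q\<^esub> ?y 0"
    using h(2)[of 0] h(2)[of 1] unfolding generators unfolding n by (simp_all add: \<phi>_def)
  have k01: "k (?y 0) = ?x 0 \<otimes>\<^bsub>presented_group ?P\<^esub> ?x 1" "k (?y 1) = ?x 0"
    using k(2)[of 0] k(2)[of 1] by (simp_all add: Q_sel \<psi>_def)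
  interpret h: group_hom "presented_group ?P" "presented_group Q" h
    using h(1) group_presented Q.group_presented by (simp add: group_hom_def group_hom_axioms_def)
  interpret k: group_hom "presented_group Q" "presented_group ?P" k
    using k(1) group_presented Q.group_presented by (simp add: group_hom_def group_hom_axioms_def)
  show ?thesis
    unfolding K
  proof (rule iso_of_inverse_homs[OF h(1) k(1)])
    fix i assume "i \<in> fst ?P"
    then have "i = 0 \<or> i = 1" unfolding generators unfolding n by auto
    then show "k (h (?x i)) = ?x i"
      using x01 y01 by (auto simp: h01[unfolded One_nat_def] h01 k01[unfolded One_nat_def] k01 simp flip: G.m_assoc)
  next
    fix C assume "C \<in> carrier (presented_group Q)"
    have "(h \<circ> k) (?y i) = ?y i" if "i \<in> fst Q" for i
    proof -
      have "i = 0 \<or> i = 1" using that by (auto simp: Q_sel)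
      then show ?thesis
        using x01 y01 by (auto simp: h01[unfolded One_nat_def] h01 k01[unfolded One_nat_def] k01 simp flip: H.m_assoc)
    qed
    from Q.endomorphism_identity[OF hom_compose[OF k(1) h(1)] this \<open>C \<in> _\<close>]
    show "h (k C) = C" by simp
  qed
qed

end

theorem corollary4p3:
  fixes n :: nat and w :: "nat word"
  assumes "n \<ge> 1"
    and "w \<in> carrier (free_group {..<n})"
    and "w \<noteq> []"
    and "cyclically_reduced w"
    and "orientable n w"
    and "redundant (cyclic_presentation n w)"
  shows "(contains_nonabelian_free_subgroup (cyclically_presented_group n w) \<or>
          n = 2 \<and> ((\<exists>\<epsilon>. cyclic_permutation w [(0, \<epsilon>), (1, \<epsilon>)]) \<or>
                    (\<exists>\<epsilon>. cyclic_permutation w [(0, \<epsilon>), (0, \<epsilon>), (1, \<epsilon>), (1, \<epsilon>)]))) \<and>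
         (n = 2 \<and> (\<exists>\<epsilon>. cyclic_permutation w [(0, \<epsilon>), (1, \<epsilon>)])
            \<longrightarrow> cyclically_presented_group n w \<cong> integer_group) \<and>
         (n = 2 \<and> (\<exists>\<epsilon>. cyclic_permutation w [(0, \<epsilon>), (0, \<epsilon>), (1, \<epsilon>), (1, \<epsilon>)])
            \<longrightarrow> cyclically_presented_group n w \<cong> klein_bottle_group)"
proof -
  interpret redundant_cyclic_presentation n w
    using assms by unfold_locales
  show ?thesis
    unfolding cyclically_presented_group_def
    using contains_nonabelian_free_or_exceptional[OF assms(4)] iso_integer_group iso_klein_bottle_group
    by blast
qed

end
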